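(* Let $n\geq 2$, let $\Omega\subset\mathbb{R}^n$ be a bounded convex domain, let $\beta\in(0,1)$, and let $f\in C^{2,\beta}(\overline{\Omega})$ satisfy $0<\lambda\leq f\leq \Lambda$ for constants $\lambda\le\Lambda$. Let $u\in C(\overline{\Omega})$ be the convex Aleksandrov solution to \[ \det D^2 u = f \ \text{ in }\Omega,\qquad u=0\ \text{ on }\partial\Omega . \] Then the following statements hold. (i) For every $0<\delta<\frac{1}{n-1}$ we have $D^2u\in L^\delta(\Omega)$, with the estimate \[ \int_\Omega \|D^2u\|^\delta\,dx\leq C, \] where $C$ is a constant depending only on $n,\Omega,\delta,\lambda,\Lambda$ and $\|\log f\|_{C^2(\overline{\Omega})}$. (ii) If, in addition, $\Omega$ is a rectangular box, then $D^2u\notin L^{\frac{n}{2(n-1)}}(\Omega)$.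
   Context: A convex function $u$ on $\Omega$ is an Aleksandrov solution of $\det D^2u=f$ in $\Omega$ if its Monge--Ampère measure $E\mapsto |\partial u(E)|$ ($\partial u$ the subdifferential, $|\cdot|$ Lebesgue measure, $E\subset\Omega$ Borel) equals $f\,dx$. Under the present hypotheses $u$ is known to be in $C^{4,\beta}(\Omega)$, so $D^2u$ is the classical Hessian in $\Omega$, and $\|D^2u\|$ is its matrix norm. For $p>0$ (possibly $p<1$), $D^2u\in L^p(\Omega)$ means $\int_\Omega\|D^2u\|^p\,dx<\infty$. A rectangular box is, up to a rigid motion, a product of $n$ bounded open intervals. *)

theory Defs
  imports "HOL-Analysis.Analysis"
begin

text \<open>Only evaluated at points of an open set, so the values of \<open>g\<close> off that set do not matter.\<close>

definition pderiv_at :: "'n \<Rightarrow> (real^'n::finite \<Rightarrow> real) \<Rightarrow> real^'n \<Rightarrow> real" where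
  "pderiv_at i g x = frechet_derivative g (at x) (axis i 1)"

definition hessian :: "(real^'n::finite \<Rightarrow> real) \<Rightarrow> real^'n \<Rightarrow> real^'n^'n" where
  "hessian g x = (\<chi> i j. pderiv_at i (pderiv_at j g) x)"

definition C2_on :: "(real^'n::finite) set \<Rightarrow> (real^'n \<Rightarrow> real) \<Rightarrow> bool" where
  "C2_on \<Omega> g \<longleftrightarrow>
     g differentiable_on \<Omega> \<and>
     (\<forall>i. pderiv_at i g differentiable_on \<Omega>) \<and>
     (\<forall>i j. continuous_on \<Omega> (pderiv_at i (pderiv_at j g)))"

definition extends_to_closure :: "(real^'n::finite) set \<Rightarrow> (real^'n \<Rightarrow> real) \<Rightarrow> bool" where
  "extends_to_closure \<Omega> g \<longleftrightarrow>
     (\<exists>h. continuous_on (closure \<Omega>) h \<and> (\<forall>x\<in>\<Omega>. h x = g x))"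

definition hoelder_on :: "(real^'n::finite) set \<Rightarrow> real \<Rightarrow> (real^'n \<Rightarrow> real) \<Rightarrow> bool" where
  "hoelder_on \<Omega> \<beta> g \<longleftrightarrow>
     (\<exists>M. \<forall>x\<in>\<Omega>. \<forall>y\<in>\<Omega>. \<bar>g x - g y\<bar> \<le> M * norm (x - y) powr \<beta>)"

text \<open>\<open>C\<^sup>2\<^sup>,\<^sup>\<beta>\<close> up to the boundary of the open set \<open>\<Omega>\<close>: all derivatives of order at most two extend
  continuously to the closure, and those of order two are uniformly Hoelder continuous
  with exponent \<open>\<beta>\<close>.\<close>

definition C2_hoelder_closure :: "(real^'n::finite) set \<Rightarrow> real \<Rightarrow> (real^'n \<Rightarrow> real) \<Rightarrow> bool" where
  "C2_hoelder_closure \<Omega> \<beta> g \<longleftrightarrow>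
     C2_on \<Omega> g \<and>
     continuous_on (closure \<Omega>) g \<and>
     (\<forall>i. extends_to_closure \<Omega> (pderiv_at i g)) \<and>
     (\<forall>i j. extends_to_closure \<Omega> (pderiv_at i (pderiv_at j g)) \<and>
            hoelder_on \<Omega> \<beta> (pderiv_at i (pderiv_at j g)))"

text \<open>The suprema over \<open>\<Omega>\<close> equal those over its closure, by continuous extension. They are
  meaningful only for functions whose derivatives of order at most two are bounded on \<open>\<Omega>\<close>.\<close>

definition C2_norm :: "(real^'n::finite) set \<Rightarrow> (real^'n \<Rightarrow> real) \<Rightarrow> real" where
  "C2_norm \<Omega> g =
     (SUP x\<in>\<Omega>. \<bar>g x\<bar>) +
     (\<Sum>i\<in>UNIV. SUP x\<in>\<Omega>. \<bar>pderiv_at i g x\<bar>) +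
     (\<Sum>i\<in>UNIV. \<Sum>j\<in>UNIV. SUP x\<in>\<Omega>. \<bar>pderiv_at i (pderiv_at j g) x\<bar>)"

definition subdifferential ::
  "(real^'n::finite) set \<Rightarrow> (real^'n \<Rightarrow> real) \<Rightarrow> real^'n \<Rightarrow> (real^'n) set" where
  "subdifferential \<Omega> u x = {p. \<forall>y\<in>\<Omega>. u x + p \<bullet> (y - x) \<le> u y}"

definition monge_ampere :: "(real^'n::finite) set \<Rightarrow> (real^'n \<Rightarrow> real) \<Rightarrow> (real^'n) set \<Rightarrow> ennreal" where
  "monge_ampere \<Omega> u E = emeasure lebesgue (\<Union>x\<in>E. subdifferential \<Omega> u x)"

definition aleksandrov_solution ::
  "(real^'n::finite) set \<Rightarrow> (real^'n \<Rightarrow> real) \<Rightarrow> (real^'n \<Rightarrow> real) \<Rightarrow> bool" where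
  "aleksandrov_solution \<Omega> f u \<longleftrightarrow>
     convex_on \<Omega> u \<and>
     (\<forall>E\<in>sets borel. E \<subseteq> \<Omega> \<longrightarrow> monge_ampere \<Omega> u E = (\<integral>\<^sup>+x\<in>E. ennreal (f x) \<partial>lborel))"

definition dirichlet_solution ::
  "(real^'n::finite) set \<Rightarrow> (real^'n \<Rightarrow> real) \<Rightarrow> (real^'n \<Rightarrow> real) \<Rightarrow> bool" where
  "dirichlet_solution \<Omega> f u \<longleftrightarrow>
     continuous_on (closure \<Omega>) u \<and> aleksandrov_solution \<Omega> f u \<and> (\<forall>x\<in>frontier \<Omega>. u x = 0)"

text \<open>The matrix norm is the operator norm for the Euclidean norm. The integral is an unsigned
  one, so any exponent \<open>p > 0\<close> is allowed.\<close>

definition hessian_integral :: "(real^'n::finite) set \<Rightarrow> real \<Rightarrow> (real^'n \<Rightarrow> real) \<Rightarrow> ennreal" where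
  "hessian_integral \<Omega> p u =
     (\<integral>\<^sup>+x\<in>\<Omega>. ennreal (onorm (\<lambda>v. hessian u x *v v) powr p) \<partial>lborel)"

definition hessian_in_Lp :: "(real^'n::finite) set \<Rightarrow> real \<Rightarrow> (real^'n \<Rightarrow> real) \<Rightarrow> bool" where
  "hessian_in_Lp \<Omega> p u \<longleftrightarrow> hessian_integral \<Omega> p u < \<infinity>"

definition rectangular_box :: "(real^'n::finite) set \<Rightarrow> bool" where
  "rectangular_box \<Omega> \<longleftrightarrow>
     (\<exists>(a::real^'n) b c (T :: real^'n \<Rightarrow> real^'n). (\<forall>i. a $ i < b $ i) \<and> orthogonal_transformation T \<and>
        \<Omega> = (\<lambda>x. c + T x) ` box a b)"

end

theory Submission
  imports Defs
begin

text \<open>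
  The right-hand side enters only through \<open>\<lambda>|E| \<le> |\<partial>u(E)| \<le> \<Lambda>|E|\<close>, and no higher regularity theory is used.
  Normalising sections of \<open>u\<close> by a basis of maximal determinant gives Aleksandrov's maximum principle
  and Caffarelli's argument that \<open>u\<close> is strictly convex and differentiable. The inverse of
  \<open>id + \<nabla>u\<close> is nonexpansive, so by Rademacher's theorem and Sard's lemma \<open>\<nabla>u\<close> is differentiable almost
  everywhere, with a symmetric nonnegative derivative whose determinant is at least \<open>\<lambda>\<close> in absolute value.
  The maximum principle on dyadic slabs at a supporting hyperplane gives \<open>|u| \<le> K d\<^sup>\<alpha>\<close> for \<open>\<alpha> < 1\<close>,
  \<open>\<alpha> \<le> 2/n\<close>, where \<open>d\<close> is the distance to a boundary point.

  For (i), on a chord in direction \<open>e\<close> this bounds \<open>\<partial>\<^sub>e u\<close> by \<open>d\<^sup>\<alpha>\<^sup>-\<^sup>1\<close>; summing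
  \<open>X\<^sup>\<delta> \<le> c\<^sup>\<delta> + c\<^sup>\<delta>\<^sup>-\<^sup>1 X\<close> over dyadic intervals and integrating over all chords controls the diagonal second derivatives,
  hence the Hessian. For (ii), in a strip at distance about \<open>2\<^sup>-\<^sup>k\<close> from a face, \<open>|u| \<le> m\<close> with
  \<open>m\<^sup>n\<^sup>/\<^sup>2\<close> at most a multiple of \<open>k 2\<^sup>-\<^sup>k\<close>, so the tangential second derivatives are at most a multiple of \<open>m\<close> on half of the strip.
  There the normal one is at least a multiple of \<open>m\<^sup>1\<^sup>-\<^sup>n\<close> because a nonnegative matrix satisfies
  \<open>|det A| \<le> n! \<Prod> a\<^sub>i\<^sub>i\<close>, and the integral dominates the harmonic series.
\<close>

section \<open>Change of variables over arbitrary finite index types\<close>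

text \<open>Two one-sided facts about second derivatives carry everything. The gradient is
  differentiable only almost everywhere and might a priori have singular second derivatives. Upper
  bounds need just the limits of its difference quotients, whose integral along a line Fatou's lemma
  bounds by the increment of the monotone directional derivative. Lower bounds come from the
  Jacobian: a set of positive measure on which it stayed below \<open>lam\<close> would have too
  small a gradient image. The exponents arise as follows. Decay of order \<open>\<alpha>\<close>
  gives, on a piece of a chord of length \<open>t\<close> at distance \<open>t\<close> from its end,
  second derivatives of typical size \<open>t powr (\<alpha> - 2)\<close>; their power
  \<open>\<delta>\<close> integrates to \<open>t powr (1 - \<delta> * (2 - \<alpha>))\<close>, which
  is summable over dyadic \<open>t\<close> if \<open>\<delta> * (2 - \<alpha>) < 1\<close>. For
  \<open>\<alpha> = 2 / n\<close> this reads \<open>\<delta> < n / (2 * (n - 1))\<close>, and that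
  bound is at least \<open>1 / (n - 1)\<close> and is the exponent of (ii). For \<open>n = 2\<close>
  the rate \<open>2 / n = 1\<close> coincides with the halving rate of the slab iteration, which
  costs a factor \<open>k\<close> at scale \<open>2 ^ - k\<close>: (i) avoids it by lowering
  \<open>\<alpha>\<close>, (ii) can afford it because the harmonic series still diverges.\<close>

text \<open>The change of variables theorems of HOL-Analysis need a well-ordered index type; they are
  transported from a copy of the index type with an arbitrary well-order.\<close>

typedef 'a wo = "UNIV :: 'a set" ..

instance wo :: (finite) finite
proof
  have "inj (Rep_wo :: 'a wo \<Rightarrow> 'a)"
    by (metis Rep_wo_inverse injI)
  then show "finite (UNIV :: 'a wo set)"
    by (rule finite_imageD[rotated]) simp
qed

definition wo_index :: "'a::finite wo \<Rightarrow> nat" where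
  "wo_index = (SOME f. inj f)"

lemma inj_wo_index: "inj (wo_index :: 'a::finite wo \<Rightarrow> nat)"
proof -
  have "\<exists>f :: 'a wo \<Rightarrow> nat. inj f"
    using finite_imp_inj_to_nat_seg[OF finite, of "UNIV :: 'a wo set"] by blast
  then show ?thesis
    unfolding wo_index_def by (rule someI_ex)
qed

instantiation wo :: (finite) wellorder
begin

definition less_eq_wo :: "'a wo \<Rightarrow> 'a wo \<Rightarrow> bool" where
  "x \<le> y \<longleftrightarrow> wo_index x \<le> wo_index y"

definition less_wo :: "'a wo \<Rightarrow> 'a wo \<Rightarrow> bool" where
  "x < y \<longleftrightarrow> wo_index x < wo_index y"

instance
proof
  fix P :: "'a wo \<Rightarrow> bool" and a
  assume H: "\<And>x. (\<And>y. y < x \<Longrightarrow> P y) \<Longrightarrow> P x"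
  show "P a"
    by (induction a rule: measure_induct_rule[where f = wo_index]) (metis H less_wo_def)
qed (auto simp: less_eq_wo_def less_wo_def intro: injD[OF inj_wo_index])

end

lemma bij_Rep_wo: "bij (Rep_wo :: 'a wo \<Rightarrow> 'a)"
  by (rule bij_betw_byWitness[where f' = Abs_wo]) (auto simp: Rep_wo_inverse Abs_wo_inverse)

definition reindex :: "('m \<Rightarrow> 'n) \<Rightarrow> real^'n \<Rightarrow> real^'m" where
  "reindex \<pi> x = (\<chi> i. x $ \<pi> i)"

lemma reindex_linear: "linear (reindex \<pi>)"
  by (rule linearI) (auto simp: reindex_def vec_eq_iff)

lemma reindex_inv:
  assumes "bij \<pi>"
  shows "reindex (inv \<pi>) (reindex \<pi> x) = x" "reindex \<pi> (reindex (inv \<pi>) y) = y"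
  using assms by (auto simp: reindex_def vec_eq_iff bij_is_surj surj_f_inv_f bij_is_inj inv_f_f)

section \<open>Lebesgue measure under a renaming of coordinates\<close>

lemma prod_Basis_vec:
  fixes x :: "real^'k::finite"
  shows "(\<Prod>b\<in>Basis. x \<bullet> b) = (\<Prod>i\<in>UNIV. x $ i)"
proof -
  have B: "(Basis :: (real^'k) set) = range (\<lambda>i. axis i 1)"
    by (auto simp: Basis_vec_def)
  have i: "inj (\<lambda>i. axis i 1 :: real^'k)"
    by (auto simp: inj_on_def axis_eq_axis)
  show ?thesis
    unfolding B by (subst prod.reindex[OF i]) (simp add: inner_axis)
qed

text \<open>Boxes pull back to boxes with the same side lengths in another order, and
  \<open>lborel\<close> is determined by its values on boxes.\<close>

lemma lborel_reindex:
  fixes \<pi> :: "'m::finite \<Rightarrow> 'n::finite"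
  assumes b: "bij \<pi>"
  shows "lborel = distr lborel borel (reindex \<pi>)"
proof (rule lborel_eqI)
  have meas: "reindex \<pi> \<in> borel \<rightarrow>\<^sub>M borel"
    by (intro borel_measurable_continuous_onI linear_continuous_on linear_conv_bounded_linear[THEN iffD1] reindex_linear)
  fix l u :: "real^'m" assume le: "\<And>b. b \<in> Basis \<Longrightarrow> l \<bullet> b \<le> u \<bullet> b"
  have l': "l $ i \<le> u $ i" for i
    using le[of "axis i 1"] by (auto simp: inner_axis Basis_vec_def)
  have "emeasure (distr lborel borel (reindex \<pi>)) (box l u) = emeasure lborel (reindex \<pi> -` box l u)"
    using meas by (simp add: emeasure_distr)
  also have "reindex \<pi> -` box l u = box (reindex (inv \<pi>) l) (reindex (inv \<pi>) u)"
  proof -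
    have "(\<forall>i. l $ i < x $ \<pi> i \<and> x $ \<pi> i < u $ i) \<longleftrightarrow>
        (\<forall>i. l $ inv \<pi> i < x $ i \<and> x $ i < u $ inv \<pi> i)" for x
      using b by (metis bij_inv_eq_iff)
    then show ?thesis
      by (auto simp: mem_box_cart reindex_def)
  qed
  also have "emeasure lborel \<dots> = (\<Prod>b\<in>Basis. (reindex (inv \<pi>) u - reindex (inv \<pi>) l) \<bullet> b)"
    by (rule emeasure_lborel_box) (auto simp: Basis_vec_def inner_axis reindex_def l')
  also have "\<dots> = (\<Prod>i\<in>UNIV. u $ inv \<pi> i - l $ inv \<pi> i)"
    by (simp only: prod_Basis_vec) (simp add: reindex_def)
  also have "\<dots> = (\<Prod>i\<in>UNIV. u $ i - l $ i)"
    by (rule arg_cong[where f = ennreal],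
        rule prod.reindex_bij_betw[OF bij_imp_bij_inv[OF b], of "\<lambda>i. u $ i - l $ i"])
  also have "\<dots> = (\<Prod>b\<in>Basis. (u - l) \<bullet> b)"
    by (simp only: prod_Basis_vec) simp
  finally show "emeasure (distr lborel borel (reindex \<pi>)) (box l u) = (\<Prod>b\<in>Basis. (u - l) \<bullet> b)" .
qed simp

lemma lebesgue_reindex:
  fixes \<pi> :: "'m::finite \<Rightarrow> 'n::finite"
  assumes b: "bij \<pi>"
  shows "lebesgue = distr lebesgue lebesgue (reindex \<pi>)" "reindex \<pi> \<in> lebesgue \<rightarrow>\<^sub>M lebesgue"
proof -
  have meas[measurable]: "reindex \<pi> \<in> borel \<rightarrow>\<^sub>M borel"
    by (intro borel_measurable_continuous_onI linear_continuous_on linear_conv_bounded_linear[THEN iffD1] reindex_linear)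
  have d: "distr lebesgue lborel (reindex \<pi>) = lborel"
    by (subst lborel_reindex[OF b]) (simp add: distr_completion cong: distr_cong)
  show "reindex \<pi> \<in> lebesgue \<rightarrow>\<^sub>M lebesgue"
    by (rule completion.measurable_completion2) (auto simp: d measurable_completion)
  have "lebesgue = completion (distr lebesgue lborel (reindex \<pi>))"
    by (simp add: d)
  also have "\<dots> = distr lebesgue lebesgue (reindex \<pi>)"
    by (subst completion.completion_distr_eq) (auto simp: d measurable_completion)
  finally show "lebesgue = distr lebesgue lebesgue (reindex \<pi>)" .
qed

lemma lebesgue_reindex_image:
  fixes \<pi> :: "'m::finite \<Rightarrow> 'n::finite"
  assumes b: "bij \<pi>" and S: "S \<in> sets lebesgue"
  shows "reindex \<pi> ` S \<in> sets lebesgue" "emeasure lebesgue (reindex \<pi> ` S) = emeasure lebesgue S"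
proof -
  have eq: "reindex \<pi> ` S = reindex (inv \<pi>) -` S"
    using reindex_inv[OF b] by (auto intro: rev_image_eqI)
  have b': "bij (inv \<pi>)" using b by (rule bij_imp_bij_inv)
  show "reindex \<pi> ` S \<in> sets lebesgue"
    using measurable_sets[OF lebesgue_reindex(2)[OF b'] S] by (simp add: eq)
  have "emeasure lebesgue S = emeasure (distr lebesgue lebesgue (reindex (inv \<pi>))) S"
    using lebesgue_reindex(1)[OF b'] by simp
  also have "\<dots> = emeasure lebesgue (reindex \<pi> ` S)"
    by (subst emeasure_distr[OF lebesgue_reindex(2)[OF b'] S]) (simp add: eq)
  finally show "emeasure lebesgue (reindex \<pi> ` S) = emeasure lebesgue S" ..
qed

lemma reindex_image_iff:
  fixes \<pi> :: "'m::finite \<Rightarrow> 'n::finite"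
  assumes b: "bij \<pi>"
  shows "reindex \<pi> ` S \<in> lmeasurable \<longleftrightarrow> S \<in> lmeasurable"
    and "measure lebesgue (reindex \<pi> ` S) = measure lebesgue S"
    and "negligible (reindex \<pi> ` S) \<longleftrightarrow> negligible S"
proof -
  have b': "bij (inv \<pi>)" using b by (rule bij_imp_bij_inv)
  have bk: "reindex (inv \<pi>) ` reindex \<pi> ` S = S"
    using reindex_inv[OF b] by (simp add: image_image)
  have s: "reindex \<pi> ` S \<in> sets lebesgue \<longleftrightarrow> S \<in> sets lebesgue"
    using lebesgue_reindex_image(1)[OF b, of S] lebesgue_reindex_image(1)[OF b', of "reindex \<pi> ` S"]
    unfolding bk by (rule iffI[rotated])
  \<comment> \<open>If \<open>S\<close> is not measurable, neither is its image, and both sides take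
    the default value 0.\<close>
  have e: "emeasure lebesgue (reindex \<pi> ` S) = emeasure lebesgue S"
    using lebesgue_reindex_image(2)[OF b] s by (metis emeasure_notin_sets)
  show "reindex \<pi> ` S \<in> lmeasurable \<longleftrightarrow> S \<in> lmeasurable"
    using s e by (simp add: fmeasurable_def)
  show "measure lebesgue (reindex \<pi> ` S) = measure lebesgue S"
    using e by (simp add: measure_def)
  show "negligible (reindex \<pi> ` S) \<longleftrightarrow> negligible S"
    using s e by (simp add: negligible_iff_null_sets null_sets_def)
qed

text \<open>Conjugation by \<open>\<pi>\<close> is a sign-preserving bijection between the
  permutations of the two index types; it matches the Leibniz sums term by term.\<close>

lemma det_reindex:
  fixes \<pi> :: "'m::finite \<Rightarrow> 'n::finite" and A :: "real^'n^'n"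
  assumes b: "bij \<pi>"
  shows "det (\<chi> i j. A $ \<pi> i $ \<pi> j) = det A"
proof -
  define F where "F = map_permutation UNIV \<pi>"
  have app: "F p (\<pi> i) = \<pi> (p i)" for p i
    unfolding F_def by (rule map_permutation_apply) (use b in \<open>auto simp: bij_def\<close>)
  have F: "bij_betw F {p. p permutes UNIV} {p. p permutes UNIV}"
  proof (rule bij_betw_byWitness[where f' = "map_permutation UNIV (inv \<pi>)"])
    show "\<forall>a\<in>{p. p permutes UNIV}. map_permutation UNIV (inv \<pi>) (F a) = a"
      unfolding F_def using b
      by (auto intro!: map_permutation_compose_inv simp: inv_f_f bij_is_inj)
    show "\<forall>a\<in>{p. p permutes UNIV}. F (map_permutation UNIV (inv \<pi>) a) = a"
      unfolding F_def using b
      by (auto intro!: map_permutation_compose_inv bij_imp_bij_inv simp: surj_f_inv_f bij_is_surj)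
    show "F ` {p. p permutes UNIV} \<subseteq> {p. p permutes UNIV}"
      unfolding F_def using b by (auto intro!: map_permutation_permutes)
    show "map_permutation UNIV (inv \<pi>) ` {p. p permutes UNIV} \<subseteq> {p. p permutes UNIV}"
      using b by (auto intro!: map_permutation_permutes bij_imp_bij_inv)
  qed
  have "det A = (\<Sum>p | p permutes UNIV. of_int (sign (F p)) * (\<Prod>i\<in>UNIV. A $ i $ F p i))"
    unfolding det_def by (rule sum.reindex_bij_betw[OF F, symmetric])
  also have "\<dots> = (\<Sum>p | p permutes UNIV. of_int (sign p) * (\<Prod>i\<in>UNIV. A $ \<pi> i $ \<pi> (p i)))"
  proof (rule sum.cong[OF refl])
    fix p :: "'m \<Rightarrow> 'm" assume p: "p \<in> {p. p permutes UNIV}"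
    have "sign (F p) = sign p"
      unfolding F_def by (rule sign_map_permutation) (use b p in \<open>auto simp: bij_def\<close>)
    moreover have "(\<Prod>i\<in>UNIV. A $ i $ F p i) = (\<Prod>i\<in>UNIV. A $ \<pi> i $ F p (\<pi> i))"
      by (rule prod.reindex_bij_betw[OF b, symmetric])
    ultimately show "of_int (sign (F p)) * (\<Prod>i\<in>UNIV. A $ i $ F p i) =
        of_int (sign p) * (\<Prod>i\<in>UNIV. A $ \<pi> i $ \<pi> (p i))"
      by (simp add: app)
  qed
  finally show ?thesis
    by (simp add: det_def)
qed

lemma det_matrix_reindex:
  fixes \<pi> :: "'m::finite \<Rightarrow> 'n::finite" and f :: "real^'n \<Rightarrow> real^'n"
  assumes b: "bij \<pi>"
  shows "det (matrix (reindex \<pi> \<circ> f \<circ> reindex (inv \<pi>))) = det (matrix f)"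
proof -
  have ax: "reindex (inv \<pi>) (axis j 1) = axis (\<pi> j) 1" for j
    using b by (auto simp: reindex_def vec_eq_iff axis_def) (metis bij_inv_eq_iff)+
  have "matrix (reindex \<pi> \<circ> f \<circ> reindex (inv \<pi>)) = (\<chi> i j. matrix f $ \<pi> i $ \<pi> j)"
    by (simp add: matrix_def vec_eq_iff ax) (simp add: reindex_def)
  then show ?thesis
    using det_reindex[OF b] by simp
qed

lemma reindex_has_derivative:
  fixes \<pi> :: "'m::finite \<Rightarrow> 'n::finite" and f :: "real^'n \<Rightarrow> real^'n"
  assumes b: "bij \<pi>" and f: "(f has_derivative f') (at x within S)"
  shows "((reindex \<pi> \<circ> f \<circ> reindex (inv \<pi>)) has_derivative (reindex \<pi> \<circ> f' \<circ> reindex (inv \<pi>)))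
     (at (reindex \<pi> x) within reindex \<pi> ` S)"
proof -
  have bl: "bounded_linear (reindex \<sigma>)" for \<sigma> :: "'a::finite \<Rightarrow> 'b::finite"
    using reindex_linear linear_conv_bounded_linear by blast
  have 1: "(reindex (inv \<pi>) has_derivative reindex (inv \<pi>)) (at (reindex \<pi> x) within reindex \<pi> ` S)"
    by (rule bounded_linear_imp_has_derivative[OF bl])
  have im: "reindex (inv \<pi>) ` reindex \<pi> ` S = S"
    using reindex_inv[OF b] by (simp add: image_image)
  have 2: "((f \<circ> reindex (inv \<pi>)) has_derivative (f' \<circ> reindex (inv \<pi>))) (at (reindex \<pi> x) within reindex \<pi> ` S)"
    by (rule diff_chain_within[OF 1]) (use f in \<open>simp add: im reindex_inv[OF b]\<close>)
  show ?thesis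
    unfolding comp_assoc
    by (rule diff_chain_within[OF 2]) (rule bounded_linear_imp_has_derivative[OF bl])
qed

section \<open>Linear images, critical values and images under differentiable maps\<close>

lemma measure_linear_image_fin:
  fixes f :: "real^'n::finite \<Rightarrow> real^'n"
  assumes f: "linear f" and S: "S \<in> lmeasurable"
  shows "f ` S \<in> lmeasurable" "measure lebesgue (f ` S) = \<bar>det (matrix f)\<bar> * measure lebesgue S"
proof -
  note b = bij_Rep_wo[where 'a = 'n]
  let ?R = "reindex Rep_wo :: real^'n \<Rightarrow> real^'n wo" and ?Q = "reindex (inv Rep_wo) :: real^'n wo \<Rightarrow> real^'n"
  have lin: "linear (?R \<circ> f \<circ> ?Q)"
    by (intro linear_compose reindex_linear f)
  have im: "(?R \<circ> f \<circ> ?Q) ` (?R ` S) = ?R ` f ` S"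
    using reindex_inv[OF b] by (simp add: image_image)
  have S': "?R ` S \<in> lmeasurable"
    using reindex_image_iff(1)[OF b] S by blast
  show "f ` S \<in> lmeasurable"
    using measurable_linear_image[OF lin S'] reindex_image_iff(1)[OF b] by (simp only: im)
  show "measure lebesgue (f ` S) = \<bar>det (matrix f)\<bar> * measure lebesgue S"
    using measure_linear_image[OF lin S'] reindex_image_iff(2)[OF b]
    by (simp only: im det_matrix_reindex[OF b])
qed

lemma Sard_fin:
  fixes f :: "real^'n::finite \<Rightarrow> real^'n"
  assumes f: "\<And>x. x \<in> S \<Longrightarrow> (f has_derivative f' x) (at x within S)"
    and z: "\<And>x. x \<in> S \<Longrightarrow> det (matrix (f' x)) = 0"
  shows "negligible (f ` S)"
proof -
  note b = bij_Rep_wo[where 'a = 'n]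
  let ?R = "reindex Rep_wo :: real^'n \<Rightarrow> real^'n wo" and ?Q = "reindex (inv Rep_wo) :: real^'n wo \<Rightarrow> real^'n"
  have im: "(?R \<circ> f \<circ> ?Q) ` (?R ` S) = ?R ` f ` S"
    using reindex_inv[OF b] by (simp add: image_image)
  have "negligible ((?R \<circ> f \<circ> ?Q) ` (?R ` S))"
  proof (rule baby_Sard[where f' = "\<lambda>y. ?R \<circ> f' (?Q y) \<circ> ?Q"])
    fix y assume "y \<in> ?R ` S"
    then obtain x where x: "x \<in> S" "y = ?R x" by blast
    have Qy: "?Q y = x" using reindex_inv[OF b] x by simp
    show "((?R \<circ> f \<circ> ?Q) has_derivative (?R \<circ> f' (?Q y) \<circ> ?Q)) (at y within ?R ` S)"
      unfolding Qy unfolding x(2) by (rule reindex_has_derivative[OF b f[OF x(1)]])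
    have "det (matrix (?R \<circ> f' (?Q y) \<circ> ?Q)) = 0"
      unfolding det_matrix_reindex[OF b] Qy by (rule z[OF x(1)])
    then show "rank (matrix (?R \<circ> f' (?Q y) \<circ> ?Q)) < CARD('n wo)"
      using det_eq_0_rank by blast
  qed simp
  then show ?thesis
    by (simp only: im reindex_image_iff(3)[OF b])
qed

text \<open>Integrability of the Jacobian comes from the bound \<open>B\<close> and the finite
  measure of \<open>S\<close>, so only its measurability has to be supplied.\<close>

lemma measure_bounded_differentiable_image_fin:
  fixes f :: "real^'n::finite \<Rightarrow> real^'n"
  assumes S: "S \<in> lmeasurable"
    and f: "\<And>x. x \<in> S \<Longrightarrow> (f has_derivative f' x) (at x within S)"
    and int: "(\<lambda>x. det (matrix (f' x))) \<in> borel_measurable (lebesgue_on S)"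
    and bd: "\<And>x. x \<in> S \<Longrightarrow> \<bar>det (matrix (f' x))\<bar> \<le> B"
  shows "f ` S \<in> lmeasurable" "measure lebesgue (f ` S) \<le> B * measure lebesgue S"
proof -
  note b = bij_Rep_wo[where 'a = 'n]
  let ?R = "reindex Rep_wo :: real^'n \<Rightarrow> real^'n wo" and ?Q = "reindex (inv Rep_wo) :: real^'n wo \<Rightarrow> real^'n"
  have im: "(?R \<circ> f \<circ> ?Q) ` (?R ` S) = ?R ` f ` S"
    using reindex_inv[OF b] by (simp add: image_image)
  have QR: "?Q (?R x) = x" for x using reindex_inv[OF b] by simp
  have S': "?R ` S \<in> lmeasurable"
    using reindex_image_iff(1)[OF b] S by blast
  have d: "((?R \<circ> f \<circ> ?Q) has_derivative (?R \<circ> f' (?Q y) \<circ> ?Q)) (at y within ?R ` S)" if "y \<in> ?R ` S" for y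
    using that reindex_has_derivative[OF b f] by (auto simp: QR)
  have bd': "\<bar>det (matrix (?R \<circ> f' (?Q y) \<circ> ?Q))\<bar> \<le> B" if "y \<in> ?R ` S" for y
    using that bd by (auto simp: det_matrix_reindex[OF b] QR)
  have meas: "(\<lambda>y. \<bar>det (matrix (f' (?Q y)))\<bar>) \<in> borel_measurable (lebesgue_on (?R ` S))"
  proof -
    have "?Q \<in> lebesgue_on (?R ` S) \<rightarrow>\<^sub>M lebesgue_on S"
      using lebesgue_reindex(2)[OF bij_imp_bij_inv[OF b]]
      by (intro measurable_restrict_space3) (auto simp: QR)
    from measurable_compose[OF this int] show ?thesis by simp
  qed
  have int': "(\<lambda>y. \<bar>det (matrix (?R \<circ> f' (?Q y) \<circ> ?Q))\<bar>) integrable_on (?R ` S)"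
    unfolding det_matrix_reindex[OF b]
    by (rule measurable_bounded_by_integrable_imp_integrable[OF meas, of "\<lambda>_. B"])
       (use S' bd in \<open>auto simp: QR fmeasurableD integrable_on_const\<close>)
  show "f ` S \<in> lmeasurable"
    using measurable_bounded_differentiable_image[OF S' d int' bd'] reindex_image_iff(1)[OF b] by (simp only: im)
  show "measure lebesgue (f ` S) \<le> B * measure lebesgue S"
    using measure_bounded_differentiable_image[OF S' d int' bd'] reindex_image_iff(2)[OF b] by (simp only: im)
qed

section \<open>One-dimensional Dini derivatives and integration along lines\<close>

text \<open>One-sided difference quotients live on \<open>{x..x+h}\<close>, with \<open>x\<close> at
  an end. Reading it as the ball about its midpoint turns the covering theorem for balls into one
  for such intervals; \<open>U\<close> confines them near \<open>D\<close>.\<close>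

lemma vitali_intervals:
  fixes D :: "real set" and P :: "real \<Rightarrow> real \<Rightarrow> bool"
  assumes U: "open U" "D \<subseteq> U"
    and P: "\<And>x d. x \<in> D \<Longrightarrow> 0 < d \<Longrightarrow> \<exists>h. 0 < h \<and> h < d \<and> P x h"
  shows "\<exists>C. countable C \<and> (\<forall>x h. (x, h) \<in> C \<longrightarrow> 0 < h \<and> P x h \<and> {x..x+h} \<subseteq> U) \<and>
    disjoint_family_on (\<lambda>(x, h). {x..x+h}) C \<and> negligible (D - (\<Union>(x, h)\<in>C. {x..x+h}))"
proof -
  define K where "K = {(x, h). 0 < h \<and> P x h \<and> {x..x+h} \<subseteq> U}"
  have cb: "cball (fst i + snd i / 2) (snd i / 2) = (case i of (x, h) \<Rightarrow> {x..x+h})" for i :: "real \<times> real"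
    by (cases i) (auto simp: cball_eq_atLeastAtMost field_simps)
  have 1: "0 < snd i / 2" if "i \<in> K" for i
    using that by (auto simp: K_def)
  have 2: "\<exists>i. i \<in> K \<and> x \<in> cball (fst i + snd i / 2) (snd i / 2) \<and> snd i / 2 < d"
    if x: "x \<in> D" and d: "0 < d" for x d
  proof -
    obtain e where e: "e > 0" "ball x e \<subseteq> U"
      using U x openE by blast
    obtain h where h: "0 < h" "h < min d e" "P x h"
      using P[OF x, of "min d e"] d e by auto
    have "{x..x+h} \<subseteq> U"
    proof
      fix y assume "y \<in> {x..x+h}"
      then have "y \<in> ball x e" using h by (auto simp: dist_real_def)
      then show "y \<in> U" using e by auto
    qed
    then show ?thesis
      using h cb[of "(x, h)"] by (intro exI[of _ "(x, h)"]) (auto simp: K_def simp del: mem_cball)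
  qed
  obtain C where C: "countable C" "C \<subseteq> K"
      "pairwise (\<lambda>i j. disjnt (cball (fst i + snd i / 2) (snd i / 2)) (cball (fst j + snd j / 2) (snd j / 2))) C"
      "negligible (D - (\<Union>i\<in>C. cball (fst i + snd i / 2) (snd i / 2)))"
    using Vitali_covering_theorem_cballs[of K "\<lambda>i. snd i / 2" D "\<lambda>i. fst i + snd i / 2", OF 1 2] by blast
  show ?thesis
  proof (intro exI[of _ C] conjI C(1))
    show "\<forall>x h. (x, h) \<in> C \<longrightarrow> 0 < h \<and> P x h \<and> {x..x+h} \<subseteq> U"
      using C(2) by (auto simp: K_def)
    show "disjoint_family_on (\<lambda>(x, h). {x..x+h}) C"
      using C(3) by (simp add: cb disjoint_family_on_def pairwise_def disjnt_def)
    show "negligible (D - (\<Union>(x, h)\<in>C. {x..x+h}))"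
      using C(4) by (simp add: cb)
  qed
qed

text \<open>Compare Lebesgue measure with the Stieltjes measure \<open>?M\<close> of
  \<open>\<phi>\<close> on two Vitali families: slow intervals covering almost all of
  \<open>D\<close> inside an open set of nearly the same measure, then fast intervals inside those.
  The result is \<open>v * |D| \<le> u * (|D| + e)\<close> for every \<open>e > 0\<close>.\<close>

lemma dini_gap_null_mono:
  fixes \<phi> :: "real \<Rightarrow> real"
  assumes mono: "\<And>x y. x \<le> y \<Longrightarrow> \<phi> x \<le> \<phi> y" and cont: "continuous_on UNIV \<phi>"
    and uv: "0 \<le> u" "u < v"
    and D: "D \<in> sets lborel" "bounded D"
    and Du: "\<And>x d. x \<in> D \<Longrightarrow> 0 < d \<Longrightarrow> \<exists>h. 0 < h \<and> h < d \<and> \<phi> (x + h) - \<phi> x \<le> u * h"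
    and Dv: "\<And>x d. x \<in> D \<Longrightarrow> 0 < d \<Longrightarrow> \<exists>h. 0 < h \<and> h < d \<and> \<phi> (x + h) - \<phi> x \<ge> v * h"
  shows "D \<in> null_sets lborel"
proof -
  let ?m = "emeasure lborel D" and ?M = "interval_measure \<phi>"
  have fin: "?m < \<infinity>"
    by (rule emeasure_bounded_finite[OF D(2)])
  have I: "emeasure ?M {x..x+h} = ennreal (\<phi> (x + h) - \<phi> x)" if "0 < h" for x h
    by (rule emeasure_interval_measure_Icc) (use that mono cont in auto)
  have le: "ennreal v * ?m \<le> ennreal u * (?m + ennreal e)" if e: "e > 0" for e
  proof -
    have "D \<in> sets lebesgue" using D(1) by simp
    then obtain U where U: "open U" "D \<subseteq> U" "U - D \<in> lmeasurable" "emeasure lebesgue (U - D) < ennreal e"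
      using sets_lebesgue_outer_open[OF _ e] by metis
    have Uborel: "U \<in> sets borel" using U(1) by simp
    have mU: "emeasure lborel U \<le> ?m + ennreal e"
    proof -
      have "emeasure lborel U = emeasure lborel (D \<union> (U - D))"
        using U(2) by (simp add: Un_absorb1)
      also have "\<dots> \<le> ?m + emeasure lborel (U - D)"
        using D(1) U(1) by (intro emeasure_subadditive) auto
      also have "emeasure lborel (U - D) \<le> ennreal e"
      proof -
        have "U - D \<in> sets lborel" using D(1) Uborel by simp
        then show ?thesis using U(4) by simp
      qed
      finally show ?thesis by (simp add: add_left_mono)
    qed
    obtain C where C: "countable C" "\<And>x h. (x, h) \<in> C \<Longrightarrow> 0 < h \<and> \<phi> (x + h) - \<phi> x \<le> u * h \<and> {x..x+h} \<subseteq> U"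
      "disjoint_family_on (\<lambda>(x, h). {x..x+h}) C" "negligible (D - (\<Union>(x, h)\<in>C. {x..x+h}))"
      using vitali_intervals[OF U(1,2), of "\<lambda>x h. \<phi> (x + h) - \<phi> x \<le> u * h", OF Du] by blast
    let ?V = "\<Union>(x, h)\<in>C. {x..x+h}"
    have s: "(case i of (x, h) \<Rightarrow> {x..x+h}) \<in> sets borel" for i :: "real \<times> real"
      by (cases i) auto
    have V1: "emeasure ?M ?V \<le> ennreal u * (?m + ennreal e)"
    proof -
      have "emeasure ?M ?V = (\<integral>\<^sup>+i. emeasure ?M (case i of (x, h) \<Rightarrow> {x..x+h}) \<partial>count_space C)"
        using C s by (intro emeasure_UN_countable) auto
      also have "\<dots> \<le> (\<integral>\<^sup>+i. ennreal u * emeasure lborel (case i of (x, h) \<Rightarrow> {x..x+h}) \<partial>count_space C)"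
      proof (rule nn_integral_mono)
        fix i assume "i \<in> space (count_space C)"
        then obtain x h where i: "i = (x, h)" "(x, h) \<in> C" by (cases i) auto
        show "emeasure ?M (case i of (x, h) \<Rightarrow> {x..x+h}) \<le> ennreal u * emeasure lborel (case i of (x, h) \<Rightarrow> {x..x+h})"
          using C(2)[OF i(2)] uv I[of h x] by (simp add: i ennreal_leI flip: ennreal_mult')
      qed
      also have "\<dots> = ennreal u * (\<integral>\<^sup>+i. emeasure lborel (case i of (x, h) \<Rightarrow> {x..x+h}) \<partial>count_space C)"
        by (rule nn_integral_cmult) simp
      also have "(\<integral>\<^sup>+i. emeasure lborel (case i of (x, h) \<Rightarrow> {x..x+h}) \<partial>count_space C) = emeasure lborel ?V"
        using C s by (intro emeasure_UN_countable[symmetric]) auto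
      also have "\<dots> \<le> emeasure lborel U"
        using C(2) U(1) by (intro emeasure_mono) auto
      finally show ?thesis
        using mU by (meson mult_left_mono order_trans zero_le)
    qed
    \<comment> \<open>Dropping the endpoints, a countable set, leaves an open set in which the fast
      intervals can be chosen.\<close>
    let ?W = "\<Union>(x, h)\<in>C. {x<..<x+h}"
    have Wopen: "open ?W" by auto
    have nD: "negligible (D - ?W)"
    proof -
      have "D - ?W \<subseteq> (D - ?V) \<union> (fst ` C \<union> (\<lambda>i. fst i + snd i) ` C)"
      proof
        fix y assume y: "y \<in> D - ?W"
        show "y \<in> (D - ?V) \<union> (fst ` C \<union> (\<lambda>i. fst i + snd i) ` C)"
        proof (cases "y \<in> ?V")
          case True
          then obtain x h where xh: "(x, h) \<in> C" "y \<in> {x..x+h}" by auto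
          with y have "y = x \<or> y = x + h" by force
          then show ?thesis using xh by force
        qed (use y in auto)
      qed
      moreover have "negligible (fst ` C \<union> (\<lambda>i. fst i + snd i) ` C)"
        unfolding negligible_iff_null_sets
        by (intro null_sets_completionI countable_imp_null_set_lborel countable_Un countable_image C(1))
      ultimately show ?thesis
        using C(4) negligible_Un negligible_subset by blast
    qed
    have "\<exists>h. 0 < h \<and> h < d \<and> \<phi> (x + h) - \<phi> x \<ge> v * h" if "x \<in> D \<inter> ?W" "0 < d" for x d
      using Dv that by blast
    then obtain C' where C': "countable C'" "\<And>x h. (x, h) \<in> C' \<Longrightarrow> 0 < h \<and> \<phi> (x + h) - \<phi> x \<ge> v * h \<and> {x..x+h} \<subseteq> ?W"
      "disjoint_family_on (\<lambda>(x, h). {x..x+h}) C'" "negligible (D \<inter> ?W - (\<Union>(x, h)\<in>C'. {x..x+h}))"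
      using vitali_intervals[OF Wopen Int_lower2, of D "\<lambda>x h. \<phi> (x + h) - \<phi> x \<ge> v * h"] by blast
    let ?V' = "\<Union>(x, h)\<in>C'. {x..x+h}"
    have V': "?V' \<in> sets borel" using C'(1) s by (intro sets.countable_UN'') auto
    have "?m \<le> emeasure lborel ?V'"
    proof -
      have "negligible (D - ?V')"
        using nD C'(4) by (rule negligible_subset[OF negligible_Un]) blast
      then have "D - ?V' \<in> null_sets lborel"
        using D(1) V' by (simp add: negligible_iff_null_sets null_sets_completion_iff)
      then have "emeasure lborel (?V' \<union> (D - ?V')) = emeasure lborel ?V'"
        by (rule emeasure_Un_null_set[rotated]) (use V' in simp)
      moreover have "?m \<le> emeasure lborel (?V' \<union> (D - ?V'))"
        using V' D(1) by (intro emeasure_mono) auto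
      ultimately show ?thesis by simp
    qed
    then have "ennreal v * ?m \<le> ennreal v * emeasure lborel ?V'"
      by (rule mult_left_mono) simp
    also have "emeasure lborel ?V' = (\<integral>\<^sup>+i. emeasure lborel (case i of (x, h) \<Rightarrow> {x..x+h}) \<partial>count_space C')"
      using C' s by (intro emeasure_UN_countable) auto
    also have "ennreal v * \<dots> = (\<integral>\<^sup>+i. ennreal v * emeasure lborel (case i of (x, h) \<Rightarrow> {x..x+h}) \<partial>count_space C')"
      by (rule nn_integral_cmult[symmetric]) simp
    also have "\<dots> \<le> (\<integral>\<^sup>+i. emeasure ?M (case i of (x, h) \<Rightarrow> {x..x+h}) \<partial>count_space C')"
    proof (rule nn_integral_mono)
      fix i assume "i \<in> space (count_space C')"
      then obtain x h where i: "i = (x, h)" "(x, h) \<in> C'" by (cases i) auto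
      show "ennreal v * emeasure lborel (case i of (x, h) \<Rightarrow> {x..x+h}) \<le> emeasure ?M (case i of (x, h) \<Rightarrow> {x..x+h})"
        using C'(2)[OF i(2)] uv I[of h x] by (simp add: i flip: ennreal_mult') (simp add: ennreal_leI)
    qed
    also have "\<dots> = emeasure ?M ?V'"
      using C' s by (intro emeasure_UN_countable[symmetric]) auto
    also have "\<dots> \<le> emeasure ?M ?V"
    proof (rule emeasure_mono)
      have "?W \<subseteq> ?V" by fastforce
      moreover have "?V' \<subseteq> ?W" using C'(2) by auto
      ultimately show "?V' \<subseteq> ?V" by (rule subset_trans[rotated])
      show "?V \<in> sets ?M" using C(1) s by (auto intro!: sets.countable_UN'')
    qed
    finally show ?thesis using V1 by order
  qed
  define m where "m = enn2real ?m"
  have m: "?m = ennreal m" "m \<ge> 0"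
    using fin by (auto simp: m_def)
  have "v * m \<le> u * (m + e)" if "e > 0" for e
    using le[OF that] m uv that by (simp add: ennreal_le_iff flip: ennreal_mult' ennreal_plus)
  then have "v * m \<le> u * m + e" if "e > 0" for e
  proof -
    have "u * (e / (u + 1)) \<le> e"
      using uv that by (simp add: field_simps)
    with \<open>\<And>e. e > 0 \<Longrightarrow> v * m \<le> u * (m + e)\<close>[of "e / (u + 1)"] uv that show ?thesis
      by (simp add: distrib_left)
  qed
  then have "v * m \<le> u * m"
    using field_le_epsilon by blast
  then have "m = 0"
    using uv m(2) by (metis mult_right_mono_neg mult_le_cancel_right not_le order_antisym)
  then show ?thesis
    using m D(1) by (auto intro: null_setsI)
qed

text \<open>Adding \<open>L * x\<close> makes \<open>\<phi>\<close> nondecreasing and shifts both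
  slopes by \<open>L\<close>.\<close>

lemma dini_gap_null:
  fixes \<phi> :: "real \<Rightarrow> real"
  assumes lip: "\<And>x y. \<bar>\<phi> x - \<phi> y\<bar> \<le> L * \<bar>x - y\<bar>"
    and uv: "u < v" and D: "D \<in> sets lborel"
    and Du: "\<And>x d. x \<in> D \<Longrightarrow> 0 < d \<Longrightarrow> \<exists>h. 0 < h \<and> h < d \<and> \<phi> (x + h) - \<phi> x \<le> u * h"
    and Dv: "\<And>x d. x \<in> D \<Longrightarrow> 0 < d \<Longrightarrow> \<exists>h. 0 < h \<and> h < d \<and> \<phi> (x + h) - \<phi> x \<ge> v * h"
  shows "D \<in> null_sets lborel"
proof -
  have L0: "0 \<le> L" using lip[of 0 1] by simp
  define \<psi> where "\<psi> x = \<phi> x + L * x" for x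
  have mono: "\<psi> x \<le> \<psi> y" if "x \<le> y" for x y
    using lip[of x y] that by (simp add: \<psi>_def algebra_simps)
  have "L-lipschitz_on UNIV \<phi>"
    by (rule lipschitz_onI) (use lip L0 in \<open>auto simp: dist_real_def\<close>)
  then have cont: "continuous_on UNIV \<psi>"
    unfolding \<psi>_def by (intro continuous_intros lipschitz_on_continuous_on)
  have bdd: "D \<inter> {-real k..real k} \<in> null_sets lborel" for k
  proof (cases "u + L \<ge> 0")
    case True
    show ?thesis
    proof (rule dini_gap_null_mono[OF mono cont True, of "v + L"])
      show "\<exists>h>0. h < d \<and> \<psi> (x + h) - \<psi> x \<le> (u + L) * h" if "x \<in> D \<inter> {- real k..real k}" "0 < d" for x d
        using Du[of x d] that by (auto simp: \<psi>_def algebra_simps)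
      show "\<exists>h>0. h < d \<and> (v + L) * h \<le> \<psi> (x + h) - \<psi> x" if "x \<in> D \<inter> {- real k..real k}" "0 < d" for x d
        using Dv[of x d] that by (auto simp: \<psi>_def algebra_simps)
    qed (use uv D in \<open>auto simp: bounded_Int\<close>)
  next
    case False
    \<comment> \<open>A forward slope below \<open>- L\<close> is impossible for an
      \<open>L\<close>-Lipschitz function.\<close>
    have "D = {}"
    proof (rule ccontr)
      assume "D \<noteq> {}"
      then obtain x where "x \<in> D" by blast
      then obtain h where h: "h > 0" "\<phi> (x + h) - \<phi> x \<le> u * h"
        using Du[of x 1] by auto
      have "\<phi> (x + h) - \<phi> x \<ge> - L * h"
        using lip[of "x + h" x] h by (simp add: abs_le_iff)
      with h have "(- L) * h \<le> u * h" by simp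
      with h(1) have "- L \<le> u" by (simp only: mult_le_cancel_right_pos)
      with False show False by simp
    qed
    then show ?thesis by simp
  qed
  have "D = (\<Union>k. D \<inter> {-real k..real k})"
  proof -
    have "\<exists>k. - real k \<le> x \<and> x \<le> real k" for x
      using real_arch_simple[of "\<bar>x\<bar>"] by (metis abs_le_iff minus_le_iff)
    then show ?thesis by auto
  qed
  then show ?thesis
    using null_sets_UN[of "\<lambda>k. D \<inter> {-real k..real k}" lborel] bdd by metis
qed

text \<open>Fubini in a direction that need not be an axis. By translation invariance, integrating
  the translates of \<open>F\<close> over \<open>t\<close> in \<open>{0..T}\<close> gives
  \<open>T\<close> times its integral; exchanging the integrals leaves line integrals with base
  points in \<open>B\<close>.\<close>

lemma line_integral_bound:
  fixes F :: "'a::euclidean_space \<Rightarrow> ennreal"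
  assumes F: "F \<in> borel_measurable borel" and B: "B \<in> sets borel" and T: "0 \<le> T"
    and supp: "\<And>x t. F x \<noteq> 0 \<Longrightarrow> 0 \<le> t \<Longrightarrow> t \<le> T \<Longrightarrow> x - t *\<^sub>R e \<in> B"
    and bd: "\<And>x. x \<in> B \<Longrightarrow> (\<integral>\<^sup>+t\<in>{0..T}. F (x + t *\<^sub>R e) \<partial>lborel) \<le> c"
  shows "ennreal T * (\<integral>\<^sup>+x. F x \<partial>lborel) \<le> c * emeasure lborel B"
proof -
  note [measurable] = F B
  have tr: "(\<integral>\<^sup>+x. F (x + a) \<partial>lborel) = (\<integral>\<^sup>+x. F x \<partial>lborel)" for a
  proof -
    have "(\<integral>\<^sup>+x. F x \<partial>lborel) = (\<integral>\<^sup>+x. F x \<partial>distr lborel borel ((+) a))"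
      by (simp add: lborel_distr_plus)
    also have "\<dots> = (\<integral>\<^sup>+x. F (a + x) \<partial>lborel)"
      by (subst nn_integral_distr) auto
    finally show ?thesis by (simp add: add.commute)
  qed
  have "ennreal T * (\<integral>\<^sup>+x. F x \<partial>lborel) = (\<integral>\<^sup>+t. (\<integral>\<^sup>+x. F x \<partial>lborel) * indicator {0..T} t \<partial>lborel)"
    using T by (subst nn_integral_cmult_indicator) (auto simp: mult.commute)
  also have "\<dots> = (\<integral>\<^sup>+t. (\<integral>\<^sup>+x. F (x + t *\<^sub>R e) * indicator {0..T} t * indicator B x \<partial>lborel) \<partial>lborel)"
  proof (rule nn_integral_cong)
    fix t :: real
    have "(\<integral>\<^sup>+x. F x \<partial>lborel) * indicator {0..T} t = (\<integral>\<^sup>+x. F (x + t *\<^sub>R e) * indicator {0..T} t \<partial>lborel)"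
      by (subst nn_integral_multc) (auto simp: tr)
    also have "\<dots> = (\<integral>\<^sup>+x. F (x + t *\<^sub>R e) * indicator {0..T} t * indicator B x \<partial>lborel)"
      using supp[of "_ + t *\<^sub>R e" t] by (intro nn_integral_cong) (auto simp: indicator_def)
    finally show "(\<integral>\<^sup>+x. F x \<partial>lborel) * indicator {0..T} t = (\<integral>\<^sup>+x. F (x + t *\<^sub>R e) * indicator {0..T} t * indicator B x \<partial>lborel)" .
  qed
  also have "\<dots> = (\<integral>\<^sup>+x. (\<integral>\<^sup>+t. F (x + t *\<^sub>R e) * indicator {0..T} t * indicator B x \<partial>lborel) \<partial>lborel)"
    by (rule lborel_pair.Fubini') measurable
  also have "\<dots> \<le> (\<integral>\<^sup>+x. c * indicator B x \<partial>lborel)"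
  proof (rule nn_integral_mono)
    fix x :: 'a
    have "(\<integral>\<^sup>+t. F (x + t *\<^sub>R e) * indicator {0..T} t * indicator B x \<partial>lborel) =
        (\<integral>\<^sup>+t. F (x + t *\<^sub>R e) * indicator {0..T} t \<partial>lborel) * indicator B x"
      by (rule nn_integral_multc) auto
    also have "\<dots> \<le> c * indicator B x"
      using bd[of x] by (auto simp: indicator_def)
    finally show "(\<integral>\<^sup>+t. F (x + t *\<^sub>R e) * indicator {0..T} t * indicator B x \<partial>lborel) \<le> c * indicator B x" .
  qed
  also have "\<dots> = c * emeasure lborel B"
    by (rule nn_integral_cmult_indicator) simp
  finally show ?thesis .
qed

lemma null_on_lines:
  fixes N :: "'a::euclidean_space set"
  assumes N: "N \<in> sets borel" and l: "\<And>x. {t. x + t *\<^sub>R e \<in> N} \<in> null_sets lborel"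
  shows "N \<in> null_sets lborel"
proof -
  have "N \<inter> cball 0 (real k) \<in> null_sets lborel" for k
  proof -
    let ?F = "\<lambda>x. indicator (N \<inter> cball 0 (real k)) x :: ennreal"
    have "ennreal 1 * (\<integral>\<^sup>+x. ?F x \<partial>lborel) \<le> 0 * emeasure lborel (cball (0::'a) (real k + norm e))"
    proof (rule line_integral_bound)
      show "?F \<in> borel_measurable borel" by (rule borel_measurable_indicator, rule sets.Int[OF N borel_closed]) simp
      show "x - t *\<^sub>R e \<in> cball 0 (real k + norm e)" if x: "?F x \<noteq> 0" and t: "0 \<le> t" "t \<le> 1" for x t
      proof -
        have "norm (x - t *\<^sub>R e) \<le> norm x + norm (t *\<^sub>R e)" by (rule norm_triangle_ineq4)
        also have "norm (t *\<^sub>R e) \<le> norm e" using t by (simp add: mult_left_le_one_le)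
        finally show ?thesis using x by (auto simp: indicator_def split: if_splits)
      qed
      show "(\<integral>\<^sup>+t\<in>{0..1}. ?F (x + t *\<^sub>R e) \<partial>lborel) \<le> 0" for x
      proof -
        have "(\<integral>\<^sup>+t\<in>{0..1}. ?F (x + t *\<^sub>R e) \<partial>lborel) \<le> (\<integral>\<^sup>+t. indicator {t. x + t *\<^sub>R e \<in> N} t \<partial>lborel)"
          by (rule nn_integral_mono) (auto simp: indicator_def)
        also have "\<dots> = 0"
          using l[of x] by (subst nn_integral_indicator) auto
        finally show ?thesis .
      qed
    qed auto
    then show ?thesis
      using N by (auto simp: nn_integral_indicator null_sets_def)
  qed
  moreover have "N = (\<Union>k. N \<inter> cball 0 (real k))"
    using real_arch_simple by auto
  ultimately show ?thesis
    using null_sets_UN[of "\<lambda>k. N \<inter> cball 0 (real k)" lborel] by metis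
qed

section \<open>Rademacher's theorem\<close>

text \<open>Near a point at which a closed set \<open>E\<close> is not porous, every point is close to \<open>E\<close>. For the sets
  \<open>lin_set\<close> below one can therefore change one coordinate at a time, starting each step in \<open>E\<close>.\<close>

definition porous_at :: "'a::metric_space set \<Rightarrow> real \<Rightarrow> 'a \<Rightarrow> bool" where
  "porous_at E \<eta> x \<longleftrightarrow> (\<forall>d>0. \<exists>r z. 0 < r \<and> r < d \<and> z \<in> ball x r \<and> ball z (\<eta> * r) \<inter> E = {})"

text \<open>A weak form of the density theorem: small balls about porous points lose at least the
  fraction \<open>1 / K\<close> of their volume to the complement of \<open>E\<close>. A disjoint
  Vitali family of such balls inside \<open>U\<close> has total volume at most \<open>K\<close>
  times that of \<open>U - E\<close>, which is arbitrarily small.\<close>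

lemma negligible_porous_bounded:
  fixes E :: "'a::euclidean_space set"
  assumes E: "closed E" "bounded E" and \<eta>: "0 < \<eta>" "\<eta> \<le> 1"
  shows "negligible {x\<in>E. porous_at E \<eta> x}"
  unfolding negligible_outer_le
proof (intro allI impI)
  fix e :: real assume e: "e > 0"
  let ?D = "{x\<in>E. porous_at E \<eta> x}"
  \<comment> \<open>The volume ratio of \<open>ball x (2 * r)\<close> to the hole
    \<open>ball z (\<eta> * r)\<close> that it contains.\<close>
  define K where "K = (2 / \<eta>) ^ DIM('a)"
  have K: "K > 0" using \<eta> by (simp add: K_def)
  have Elm: "E \<in> lmeasurable" using E by (simp add: bounded_set_imp_lmeasurable borel_closed)
  obtain U where U: "open U" "E \<subseteq> U" "U - E \<in> lmeasurable" "emeasure lebesgue (U - E) < ennreal (e / K)"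
    using sets_lebesgue_outer_open[of E "e / K"] Elm e K by (auto simp: fmeasurableD)
  have Ulm: "U \<in> lmeasurable"
    using fmeasurable.Un[OF Elm U(3)] U(2) by (simp add: Un_absorb1)
  define I where "I = {(x, r). 0 < r \<and> ball x r \<subseteq> U \<and> measure lebesgue (ball x r) \<le> K * measure lebesgue (ball x r - E)}"
  have cov: "\<exists>i. i \<in> I \<and> x \<in> ball (fst i) (snd i) \<and> snd i < d" if x: "x \<in> ?D" and d: "0 < d" for x d
  proof -
    obtain s where s: "s > 0" "ball x s \<subseteq> U" using U x openE by blast
    obtain r z where r: "0 < r" "r < min d s / 2" "z \<in> ball x r" "ball z (\<eta> * r) \<inter> E = {}"
    proof -
      have "0 < min d s / 2" using d s by simp
      moreover have "porous_at E \<eta> x" using x by simp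
      ultimately show thesis using that unfolding porous_at_def by blast
    qed
    have sub: "ball z (\<eta> * r) \<subseteq> ball x (2 * r) - E"
    proof -
      have "\<eta> * r \<le> r" using \<eta> r by simp
      then have "ball z (\<eta> * r) \<subseteq> ball x (2 * r)"
        using r(3) by (intro ball_subset_ball_iff[THEN iffD2]) (auto simp: dist_commute)
      then show ?thesis using r(4) by blast
    qed
    have "measure lebesgue (ball x (2 * r)) = (2 * r) ^ DIM('a) * unit_ball_vol DIM('a)"
      using r by (simp add: content_ball)
    also have "\<dots> = K * ((\<eta> * r) ^ DIM('a) * unit_ball_vol DIM('a))"
      using \<eta> by (simp add: K_def power_mult_distrib power_divide)
    also have "(\<eta> * r) ^ DIM('a) * unit_ball_vol DIM('a) = measure lebesgue (ball z (\<eta> * r))"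
      using r \<eta> by (simp add: content_ball)
    also have "K * \<dots> \<le> K * measure lebesgue (ball x (2 * r) - E)"
      using K sub Elm by (intro mult_left_mono measure_mono_fmeasurable) (auto simp: fmeasurableD intro!: fmeasurable.Diff)
    finally show ?thesis
      using r s(2) by (intro exI[of _ "(x, 2 * r)"]) (auto simp: I_def)
  qed
  obtain C where C: "countable C" "C \<subseteq> I"
      "pairwise (\<lambda>i j. disjnt (ball (fst i) (snd i)) (ball (fst j) (snd j))) C"
      "negligible (?D - (\<Union>i \<in> C. ball (fst i) (snd i)))"
    using Vitali_covering_theorem_balls[of ?D I fst snd, OF cov] by blast
  let ?V = "\<Union>i \<in> C. ball (fst i) (snd i)"
  have "ball (fst i) (snd i) \<subseteq> U" if "i \<in> C" for i
  proof -
    have "i \<in> I" using C(2) that by blast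
    then show ?thesis by (cases i) (simp add: I_def)
  qed
  then have VU: "?V \<subseteq> U" by blast
  have Vlm: "?V \<in> lmeasurable"
    by (rule fmeasurableI2[OF Ulm VU]) (intro sets_completionI_sets, simp, intro borel_open open_UN ballI open_ball)
  have df: "disjoint_family_on (\<lambda>i. ball (fst i) (snd i)) C"
    using C(3) by (simp add: disjoint_family_on_def pairwise_def disjnt_def)
  have "emeasure lebesgue ?V = (\<integral>\<^sup>+i. emeasure lebesgue (ball (fst i) (snd i)) \<partial>count_space C)"
    using C(1) df by (intro emeasure_UN_countable) auto
  also have "\<dots> \<le> (\<integral>\<^sup>+i. ennreal K * emeasure lebesgue (ball (fst i) (snd i) - E) \<partial>count_space C)"
  proof (rule nn_integral_mono)
    fix i assume "i \<in> space (count_space C)"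
    then have "measure lebesgue (ball (fst i) (snd i)) \<le> K * measure lebesgue (ball (fst i) (snd i) - E)"
      using C(2) by (auto simp: I_def)
    moreover have "ball (fst i) (snd i) - E \<in> lmeasurable"
      using Elm by (intro fmeasurable.Diff) (auto simp: fmeasurableD)
    ultimately show "emeasure lebesgue (ball (fst i) (snd i)) \<le> ennreal K * emeasure lebesgue (ball (fst i) (snd i) - E)"
      using K by (subst (1 2) emeasure_eq_measure2) (auto simp flip: ennreal_mult' intro: ennreal_leI)
  qed
  also have "\<dots> = ennreal K * (\<integral>\<^sup>+i. emeasure lebesgue (ball (fst i) (snd i) - E) \<partial>count_space C)"
    by (rule nn_integral_cmult) simp
  also have "(\<integral>\<^sup>+i. emeasure lebesgue (ball (fst i) (snd i) - E) \<partial>count_space C) =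
      emeasure lebesgue (\<Union>i\<in>C. ball (fst i) (snd i) - E)"
  proof (rule emeasure_UN_countable[symmetric])
    show "disjoint_family_on (\<lambda>i. ball (fst i) (snd i) - E) C"
      using df unfolding disjoint_family_on_def by blast
  qed (use C(1) Elm in \<open>auto simp: fmeasurableD\<close>)
  also have "ennreal K * emeasure lebesgue (\<Union>i\<in>C. ball (fst i) (snd i) - E) \<le> ennreal K * ennreal (e / K)"
  proof (rule mult_left_mono)
    have "emeasure lebesgue (\<Union>i\<in>C. ball (fst i) (snd i) - E) \<le> emeasure lebesgue (U - E)"
      using VU U(3) by (intro emeasure_mono) (auto simp: fmeasurableD)
    then show "emeasure lebesgue (\<Union>i\<in>C. ball (fst i) (snd i) - E) \<le> ennreal (e / K)"
      using U(4) by order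
  qed simp
  also have "\<dots> = ennreal e" using K by (simp flip: ennreal_mult')
  finally have Ve: "measure lebesgue ?V \<le> e"
    using Vlm e by (simp add: emeasure_eq_measure2)
  define T where "T = ?V \<union> (?D - ?V)"
  show "\<exists>T. ?D \<subseteq> T \<and> T \<in> lmeasurable \<and> measure lebesgue T \<le> e"
  proof (intro exI conjI)
    show "?D \<subseteq> T" by (auto simp: T_def)
    show "T \<in> lmeasurable"
      unfolding T_def by (rule fmeasurable.Un[OF Vlm negligible_imp_measurable[OF C(4)]])
    have "measure lebesgue T \<le> measure lebesgue ?V + measure lebesgue (?D - ?V)"
      unfolding T_def
      by (rule measure_Un_le[OF fmeasurableD[OF Vlm] fmeasurableD[OF negligible_imp_measurable[OF C(4)]]])
    then show "measure lebesgue T \<le> e"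
      using Ve negligible_imp_measure0[OF C(4)] by linarith
  qed
qed

lemma negligible_porous:
  fixes E :: "'a::euclidean_space set"
  assumes E: "closed E" and \<eta>: "0 < \<eta>" "\<eta> \<le> 1"
  shows "negligible {x\<in>E. porous_at E \<eta> x}"
proof -
  have "{x\<in>E. porous_at E \<eta> x} \<subseteq> (\<Union>k. {x\<in>E \<inter> cball 0 (real k). porous_at (E \<inter> cball 0 (real k)) \<eta> x})"
  proof
    fix x assume x: "x \<in> {x\<in>E. porous_at E \<eta> x}"
    obtain k where "norm x \<le> real k" using real_arch_simple by blast
    moreover have "porous_at (E \<inter> A) \<eta> x" for A
    proof -
      have "porous_at E \<eta> x" using x by simp
      then show ?thesis unfolding porous_at_def by (fast intro: disjointI)
    qed
    ultimately show "x \<in> (\<Union>k. {x\<in>E \<inter> cball 0 (real k). porous_at (E \<inter> cball 0 (real k)) \<eta> x})"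
      using x by auto
  qed
  moreover have "negligible (\<Union>k. {x\<in>E \<inter> cball 0 (real k). porous_at (E \<inter> cball 0 (real k)) \<eta> x})"
  proof (rule negligible_countable_Union)
    show "negligible S" if "S \<in> range (\<lambda>k. {x\<in>E \<inter> cball 0 (real k). porous_at (E \<inter> cball 0 (real k)) \<eta> x})" for S
    proof -
      obtain k where S: "S = {x\<in>E \<inter> cball 0 (real k). porous_at (E \<inter> cball 0 (real k)) \<eta> x}"
        using \<open>S \<in> _\<close> by blast
      show ?thesis
        unfolding S by (rule negligible_porous_bounded) (use assms in \<open>auto simp: bounded_Int\<close>)
    qed
  qed simp
  ultimately show ?thesis by (rule negligible_subset[rotated])
qed

lemma axis_scaleR: "axis i t = (t *\<^sub>R axis i 1 :: real^'n::finite)"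
  by (simp add: vec_eq_iff axis_def)

lemma norm_axis: "norm (axis i t :: real^'n::finite) = \<bar>t\<bar>"
  by (subst axis_scaleR) simp

lemma axis_add: "axis i (t + s) = (axis i t + axis i s :: real^'n::finite)"
  by (simp add: vec_eq_iff axis_def)

section \<open>Partial difference quotients of a Lipschitz function\<close>

context
  fixes g :: "real^'n::finite \<Rightarrow> real" and L :: real
  assumes lip: "\<And>x y. \<bar>g x - g y\<bar> \<le> L * norm (x - y)"
begin

definition lin_set :: "('n \<Rightarrow> real) \<Rightarrow> real \<Rightarrow> nat \<Rightarrow> (real^'n) set" where
  "lin_set q \<epsilon> m = {x. \<forall>i t. 0 < t \<and> t < 1 / Suc m \<longrightarrow> \<bar>g (x + axis i t) - g x - q i * t\<bar> \<le> \<epsilon> * t}"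

text \<open>A gap between the lower and upper right Dini derivatives. Strict inequalities make the
  unions over \<open>h\<close> open, which keeps the set Borel.\<close>

definition dini_set :: "'n \<Rightarrow> real \<Rightarrow> real \<Rightarrow> (real^'n) set" where
  "dini_set i u v = {x. \<forall>k::nat. (\<exists>h\<in>{0<..<1 / Suc k}. g (x + axis i h) - g x < u * h) \<and>
     (\<exists>h\<in>{0<..<1 / Suc k}. g (x + axis i h) - g x > v * h)}"

lemma L_nonneg: "0 \<le> L"
  using lip[of "axis undefined 1" 0] by (simp add: norm_axis)

lemma g_cont: "continuous_on S g"
proof -
  have "L-lipschitz_on UNIV g"
    by (rule lipschitz_onI) (use lip L_nonneg in \<open>auto simp: dist_norm\<close>)
  then show ?thesis
    using lipschitz_on_continuous_on continuous_on_subset by blast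
qed

lemma g_comp_cont [continuous_intros]: "continuous_on S f \<Longrightarrow> continuous_on S (\<lambda>x. g (f x))"
  using continuous_on_compose2[OF g_cont[of UNIV]] by blast

lemma closed_lin_set: "closed (lin_set q \<epsilon> m)"
proof -
  have "lin_set q \<epsilon> m = (\<Inter>i. \<Inter>t\<in>{0<..<1 / Suc m}. {x. \<bar>g (x + axis i t) - g x - q i * t\<bar> \<le> \<epsilon> * t})"
    by (auto simp: lin_set_def)
  also have "closed \<dots>"
    by (intro closed_INT ballI closed_Collect_le continuous_intros)
  finally show ?thesis .
qed

lemma borel_dini_set: "dini_set i u v \<in> sets borel"
proof -
  have "dini_set i u v = (\<Inter>k::nat. (\<Union>h\<in>{0<..<1 / Suc k}. {x. g (x + axis i h) - g x < u * h}) \<inter>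
     (\<Union>h\<in>{0<..<1 / Suc k}. {x. v * h < g (x + axis i h) - g x}))"
    unfolding dini_set_def by auto
  also have "\<dots> \<in> sets borel"
    by (rule sets.countable_INT''; (intro sets.Int borel_open open_UN ballI open_Collect_less continuous_intros)?) auto
  finally show ?thesis .
qed

lemma null_dini_set: "u < v \<Longrightarrow> dini_set i u v \<in> null_sets lborel"
proof (rule null_on_lines[OF borel_dini_set, where e = "axis i 1"])
  fix x assume uv: "u < v"
  have ax: "t *\<^sub>R axis i 1 = (axis i t :: real^'n)" for t
    by (rule axis_scaleR[symmetric])
  have ax': "axis i (t + s) = (axis i t + axis i s :: real^'n)" for t s
    by (rule axis_add)
  let ?\<phi> = "\<lambda>t. g (x + axis i t)"
  have small: "\<exists>k::nat. 1 / Suc k < d" if "d > 0" for d :: real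
    using that by (metis nat_approx_posE)
  show "{t. x + t *\<^sub>R axis i 1 \<in> dini_set i u v} \<in> null_sets lborel"
  proof (rule dini_gap_null[of ?\<phi> L u v])
    show "\<bar>?\<phi> a - ?\<phi> b\<bar> \<le> L * \<bar>a - b\<bar>" for a b
    proof -
      have "norm (x + axis i a - (x + axis i b)) = norm (axis i (a - b) :: real^'n)"
        by (rule arg_cong[where f = norm]) (simp add: vec_eq_iff axis_def)
      then show ?thesis using lip[of "x + axis i a" "x + axis i b"] by (simp add: norm_axis)
    qed
    have "(\<lambda>t. x + t *\<^sub>R axis i 1) \<in> borel \<rightarrow>\<^sub>M borel" by measurable
    from measurable_sets[OF this borel_dini_set[of i u v]]
    show "{t. x + t *\<^sub>R axis i 1 \<in> dini_set i u v} \<in> sets lborel"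
      by (simp add: vimage_def)
    show "\<exists>h>0. h < d \<and> g (x + axis i (t + h)) - g (x + axis i t) \<le> u * h"
      if t: "t \<in> {t. x + t *\<^sub>R axis i 1 \<in> dini_set i u v}" and d: "0 < d" for t d
    proof -
      obtain k :: nat where k: "1 / Suc k < d" using small d by blast
      have "x + axis i t \<in> dini_set i u v" using t by (simp add: ax)
      then obtain h where h: "h \<in> {0<..<1 / Suc k}" "g (x + axis i t + axis i h) - g (x + axis i t) < u * h"
        unfolding dini_set_def by blast
      show ?thesis
        by (rule exI[of _ h]) (use h k in \<open>simp add: ax' add.assoc\<close>)
    qed
    show "\<exists>h>0. h < d \<and> g (x + axis i (t + h)) - g (x + axis i t) \<ge> v * h"
      if t: "t \<in> {t. x + t *\<^sub>R axis i 1 \<in> dini_set i u v}" and d: "0 < d" for t d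
    proof -
      obtain k :: nat where k: "1 / Suc k < d" using small d by blast
      have "x + axis i t \<in> dini_set i u v" using t by (simp add: ax)
      then obtain h where h: "h \<in> {0<..<1 / Suc k}" "g (x + axis i t + axis i h) - g (x + axis i t) > v * h"
        unfolding dini_set_def by blast
      show ?thesis
        by (rule exI[of _ h]) (use h k in \<open>simp add: ax' add.assoc\<close>)
    qed
  qed (fact uv)
qed


lemma lin_set_approx:
  assumes x: "x \<in> lin_set q \<epsilon> m" and np: "\<not> porous_at (lin_set q \<epsilon> m) \<epsilon> x" and \<epsilon>: "0 < \<epsilon>"
  shows "\<exists>d>0. \<forall>y. norm y < d \<longrightarrow>
    \<bar>g (x + y) - g x - (\<Sum>i\<in>UNIV. q i * y $ i)\<bar> \<le> (real CARD('n) * (1 + 4 * L) * \<epsilon>) * norm y"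
proof -
  let ?E = "lin_set q \<epsilon> m"
  obtain d where d: "d > 0" "\<And>r z. 0 < r \<Longrightarrow> r < d \<Longrightarrow> z \<in> ball x r \<Longrightarrow> ball z (\<epsilon> * r) \<inter> ?E \<noteq> {}"
    using np unfolding porous_at_def by blast
  show ?thesis
  proof (intro exI[of _ "min (d / 2) (1 / Suc m)"] conjI allI impI)
    fix y :: "real^'n" assume y: "norm y < min (d / 2) (1 / Suc m)"
    \<comment> \<open>The factor 2 places all intermediate points strictly inside
      \<open>ball x r\<close>; the two Lipschitz errors \<open>L * (\<epsilon> * r)\<close> below
      then account for \<open>4 * L\<close>.\<close>
    define r where "r = 2 * norm y"
    define yI where "yI I = (\<chi> j. if j \<in> I then y $ j else 0)" for I
    let ?c = "(1 + 4 * L) * \<epsilon> * norm y"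
    have nI: "norm (yI I) \<le> norm y" for I
      by (rule norm_le_componentwise_cart) (simp add: yI_def)
    have step: "\<bar>g (x + yI (insert i I)) - g (x + yI I) - q i * y $ i\<bar> \<le> ?c" if iI: "i \<notin> I" for i I
    proof (cases "y $ i = 0")
      case True
      then have "yI (insert i I) = yI I" by (auto simp: yI_def vec_eq_iff)
      then show ?thesis using True \<epsilon> L_nonneg by simp
    next
      case False
      define s where "s = \<bar>y $ i\<bar>"
      \<comment> \<open>\<open>lin_set\<close> controls positive increments only, so the step starts
        from the endpoint with the smaller coordinate \<open>i\<close>.\<close>
      define b where "b = (if y $ i < 0 then yI (insert i I) else yI I)"
      define b' where "b' = (if y $ i < 0 then yI I else yI (insert i I))"
      have s: "0 < s" "s \<le> norm y" using False component_le_norm_cart[of y i] by (auto simp: s_def)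
      have b': "b' = b + axis i s"
        using iI by (auto simp: b_def b'_def yI_def vec_eq_iff s_def axis_def)
      have r: "0 < r" "r < d" "norm y < r" using s y by (auto simp: r_def)
      have "norm b \<le> norm y" using nI by (simp add: b_def)
      then have "x + b \<in> ball x r" using r by (simp add: dist_norm)
      then obtain w where w: "w \<in> ball (x + b) (\<epsilon> * r)" "w \<in> ?E"
        using d(2)[OF r(1,2)] by blast
      have 1: "\<bar>g (w + axis i s) - g w - q i * s\<bar> \<le> \<epsilon> * s"
        using w(2) s y by (simp add: lin_set_def)
      have nw: "norm (x + b - w) \<le> \<epsilon> * r" using w(1) by (simp add: dist_norm)
      have 2: "\<bar>g (x + b) - g w\<bar> \<le> L * (\<epsilon> * r)"
        using lip[of "x + b" w] mult_left_mono[OF nw L_nonneg] by linarith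
      have e: "x + b' - (w + axis i s) = x + b - w" by (simp add: b')
      have 3: "\<bar>g (x + b') - g (w + axis i s)\<bar> \<le> L * (\<epsilon> * r)"
        using lip[of "x + b'" "w + axis i s", unfolded e] mult_left_mono[OF nw L_nonneg] by linarith
      have "\<epsilon> * s \<le> \<epsilon> * norm y" using s \<epsilon> by simp
      then have "\<bar>g (x + b') - g (x + b) - q i * s\<bar> \<le> \<epsilon> * norm y + 2 * (L * (\<epsilon> * r))"
        using 1 2 3 by linarith
      also have "\<dots> = ?c" by (simp add: r_def algebra_simps)
      finally have "\<bar>g (x + b') - g (x + b) - q i * s\<bar> \<le> ?c" .
      then show ?thesis
        by (cases "y $ i < 0") (auto simp: b_def b'_def s_def abs_if split: if_splits)
    qed
    have ind: "\<bar>g (x + yI I) - g x - (\<Sum>i\<in>I. q i * y $ i)\<bar> \<le> real (card I) * ?c" if "finite I" for I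
      using that
    proof induction
      case empty
      have "yI {} = 0" by (simp add: yI_def vec_eq_iff)
      then show ?case by simp
    next
      case (insert i I)
      then show ?case using step[of i I] by (simp add: algebra_simps abs_le_iff)
    qed
    have "yI UNIV = y" by (simp add: yI_def vec_eq_iff)
    then show "\<bar>g (x + y) - g x - (\<Sum>i\<in>UNIV. q i * y $ i)\<bar> \<le> (real CARD('n) * (1 + 4 * L) * \<epsilon>) * norm y"
      using ind[of UNIV] by (simp add: mult.assoc)
  qed (use d in auto)
qed

text \<open>Testing two approximating slopes on a small multiple of their difference shows that they
  differ by at most the sum of their tolerances. The slopes are therefore Cauchy, and their limit is
  the derivative.\<close>

lemma differentiable_by_linear_approx:
  assumes H: "\<And>e. e > 0 \<Longrightarrow> \<exists>q d. d > 0 \<and> (\<forall>y. norm y < d \<longrightarrow> \<bar>g (x + y) - g x - q \<bullet> y\<bar> \<le> e * norm y)"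
  shows "g differentiable (at x)"
proof -
  let ?e = "\<lambda>k. 1 / real (Suc k)"
  have "\<forall>k. \<exists>q d. d > 0 \<and> (\<forall>y. norm y < d \<longrightarrow> \<bar>g (x + y) - g x - q \<bullet> y\<bar> \<le> ?e k * norm y)"
  proof
    fix k show "\<exists>q d. d > 0 \<and> (\<forall>y. norm y < d \<longrightarrow> \<bar>g (x + y) - g x - q \<bullet> y\<bar> \<le> ?e k * norm y)"
      by (rule H) simp
  qed
  then obtain q d where d: "\<And>k. d k > 0"
    and q: "\<And>k y. norm y < d k \<Longrightarrow> \<bar>g (x + y) - g x - q k \<bullet> y\<bar> \<le> ?e k * norm y"
    by metis
  have qq: "norm (q k - q l) \<le> ?e k + ?e l" for k l
  proof (cases "q k = q l")
    case False
    define v where "v = q k - q l"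
    have v: "norm v > 0" using False by (simp add: v_def)
    define t where "t = min (d k) (d l) / (2 * norm v)"
    have t: "t > 0" using v d by (simp add: t_def)
    have "norm (t *\<^sub>R v) = min (d k) (d l) / 2"
      using v d[of k] d[of l] by (simp add: t_def)
    then have n: "norm (t *\<^sub>R v) < d k" "norm (t *\<^sub>R v) < d l"
      using d[of k] d[of l] by linarith+
    have "v \<bullet> (t *\<^sub>R v) \<le> (?e k + ?e l) * norm (t *\<^sub>R v)"
      using q[OF n(1)] q[OF n(2)] by (simp add: v_def inner_diff_left algebra_simps abs_le_iff)
    then have "t * (norm v * norm v) \<le> t * ((?e k + ?e l) * norm v)"
      using t by (simp add: power2_norm_eq_inner[symmetric] power2_eq_square mult.left_commute)
    then have "norm v * norm v \<le> (?e k + ?e l) * norm v"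
      using t by (simp only: mult_le_cancel_left_pos)
    then show ?thesis using v by (simp only: mult_le_cancel_right_pos v_def)
  qed simp
  have "Cauchy q"
  proof (rule metric_CauchyI)
    fix e :: real assume "e > 0"
    then obtain M where M: "?e M < e / 2" using nat_approx_posE[of "e / 2"] by auto
    have "dist (q k) (q l) < e" if "k \<ge> M" "l \<ge> M" for k l
    proof -
      have "?e k \<le> ?e M" "?e l \<le> ?e M" using that by (auto simp: field_simps)
      then show ?thesis using qq[of k l] M unfolding dist_norm by linarith
    qed
    then show "\<exists>M. \<forall>k\<ge>M. \<forall>l\<ge>M. dist (q k) (q l) < e" by blast
  qed
  then obtain p where p: "q \<longlonglongrightarrow> p" using Cauchy_convergent convergent_def by blast
  have qp: "norm (q k - p) \<le> ?e k" for k
  proof (rule LIMSEQ_le)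
    show "(\<lambda>l. norm (q k - q l)) \<longlonglongrightarrow> norm (q k - p)" using p by (intro tendsto_intros)
    have "(\<lambda>l. ?e k + ?e l) \<longlonglongrightarrow> ?e k + 0" by (intro tendsto_intros LIMSEQ_Suc[OF lim_1_over_n])
    then show "(\<lambda>l. ?e k + ?e l) \<longlonglongrightarrow> ?e k" by simp
  qed (use qq in blast)
  have "(g has_derivative (\<lambda>y. p \<bullet> y)) (at x)"
    unfolding has_derivative_at_alt
  proof (intro conjI allI impI)
    fix e :: real assume "e > 0"
    then obtain k where k: "?e k < e / 2" using nat_approx_posE[of "e / 2"] by auto
    show "\<exists>d>0. \<forall>y. norm (y - x) < d \<longrightarrow> norm (g y - g x - p \<bullet> (y - x)) \<le> e * norm (y - x)"
    proof (intro exI[of _ "d k"] conjI d allI impI)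
      fix y assume "norm (y - x) < d k"
      from q[OF this] have 1: "\<bar>g y - g x - q k \<bullet> (y - x)\<bar> \<le> ?e k * norm (y - x)" by simp
      have "\<bar>(q k - p) \<bullet> (y - x)\<bar> \<le> norm (q k - p) * norm (y - x)" by (rule Cauchy_Schwarz_ineq2)
      also have "\<dots> \<le> ?e k * norm (y - x)" by (rule mult_right_mono[OF qp]) simp
      finally have 2: "\<bar>(q k - p) \<bullet> (y - x)\<bar> \<le> ?e k * norm (y - x)" .
      have "(?e k + ?e k) * norm (y - x) \<le> e * norm (y - x)"
        by (rule mult_right_mono) (use k in auto)
      then show "norm (g y - g x - p \<bullet> (y - x)) \<le> e * norm (y - x)"
        using 1 2 unfolding inner_diff_left real_norm_def distrib_right by linarith
    qed
  qed (rule bounded_linear_inner_right)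
  then show ?thesis by (rule differentiableI)
qed

text \<open>Slopes are quantised to multiples of \<open>1 / Suc k\<close>. Take \<open>j\<close>
  such that \<open>j / Suc k\<close> bounds the quotients from below at small scales but
  \<open>(j + 1) / Suc k\<close> does not. Since there is no gap from \<open>j + 1\<close> to
  \<open>j + 2\<close>, the latter gives an upper bound at small scales, and the middle value
  \<open>j + 1\<close> serves as slope.\<close>

lemma exists_lin_set:
  assumes x: "\<And>i j. x \<notin> dini_set i (real_of_int j / Suc k) (real_of_int (j + 1) / Suc k)"
  shows "\<exists>j m. x \<in> lin_set (\<lambda>i. real_of_int (j i) / Suc k) (1 / Suc k) m"
proof -
  let ?e = "1 / real (Suc k)"
  have "\<exists>j m. \<forall>t. 0 < t \<and> t < 1 / Suc m \<longrightarrow> \<bar>g (x + axis i t) - g x - real_of_int j / Suc k * t\<bar> \<le> ?e * t" for i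
  proof -
    define P where "P j \<longleftrightarrow> (\<exists>m. \<forall>t\<in>{0<..<1 / real (Suc m)}. real_of_int j / Suc k * t \<le> g (x + axis i t) - g x)" for j
    have gL: "\<bar>g (x + axis i t) - g x\<bar> \<le> L * t" if "0 < t" for t
      using lip[of "x + axis i t" x] that by (simp add: norm_axis)
    obtain N :: nat where N: "L * Suc k < real N" using reals_Archimedean2 by blast
    have P1: "P (- int N)"
      unfolding P_def
    proof (intro exI[of _ 0] ballI)
      fix t :: real assume t: "t \<in> {0<..<1 / real (Suc 0)}"
      have "real_of_int (- int N) / Suc k \<le> - L" using N by (simp add: field_simps)
      then have "real_of_int (- int N) / Suc k * t \<le> - L * t" using t by (intro mult_right_mono) auto
      then show "real_of_int (- int N) / Suc k * t \<le> g (x + axis i t) - g x"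
        using gL[of t] t by (simp add: abs_le_iff)
    qed
    have P2: "\<not> P (int N)"
    proof
      assume "P (int N)"
      then obtain m where m: "\<forall>t\<in>{0<..<1 / real (Suc m)}. real_of_int (int N) / Suc k * t \<le> g (x + axis i t) - g x"
        unfolding P_def by blast
      define t where "t = 1 / real (Suc m) / 2"
      have t: "0 < t" "t < 1 / real (Suc m)" by (auto simp: t_def field_simps)
      have "L < real N / Suc k" using N by (simp add: field_simps)
      then have "L * t < real N / Suc k * t" using t by (intro mult_strict_right_mono)
      then show False using m t gL[of t] by (auto simp: abs_le_iff dest!: bspec[of _ _ t])
    qed
    have "\<exists>j. P j \<and> \<not> P (j + 1)"
    proof (rule ccontr)
      assume "\<not> (\<exists>j. P j \<and> \<not> P (j + 1))"
      then have step: "P j \<Longrightarrow> P (j + 1)" for j by blast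
      have "P j" if "- int N \<le> j" for j
        using that
      proof (induction j rule: int_ge_induct)
        case base show ?case by (rule P1)
      next
        case (step i) then show ?case using \<open>\<And>j. P j \<Longrightarrow> P (j + 1)\<close> by blast
      qed
      then show False using P2 by simp
    qed
    then obtain j where j: "P j" "\<not> P (j + 1)" by blast
    obtain m1 where m1: "\<And>t. t \<in> {0<..<1 / real (Suc m1)} \<Longrightarrow> real_of_int j / Suc k * t \<le> g (x + axis i t) - g x"
      using j(1) unfolding P_def by blast
    obtain m2 where m2: "(\<forall>h\<in>{0<..<1 / real (Suc m2)}. real_of_int (j + 1) / Suc k * h \<le> g (x + axis i h) - g x) \<or>
        (\<forall>h\<in>{0<..<1 / real (Suc m2)}. g (x + axis i h) - g x \<le> real_of_int (j + 1 + 1) / Suc k * h)"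
      using x[of i "j + 1"] unfolding dini_set_def by (simp only: mem_Collect_eq not_all de_Morgan_conj bex_simps(8) not_less) blast
    have m2': "g (x + axis i h) - g x \<le> real_of_int (j + 1 + 1) / Suc k * h" if "h \<in> {0<..<1 / real (Suc m2)}" for h
      using m2 j(2) that unfolding P_def by blast
    show ?thesis
    proof (intro exI[of _ "j + 1"] exI[of _ "m1 + m2"] allI impI)
      fix t :: real assume t: "0 < t \<and> t < 1 / Suc (m1 + m2)"
      have "1 / real (Suc (m1 + m2)) \<le> 1 / real (Suc m1)" "1 / real (Suc (m1 + m2)) \<le> 1 / real (Suc m2)"
        by (auto simp: field_simps)
      then have t': "t \<in> {0<..<1 / real (Suc m1)}" "t \<in> {0<..<1 / real (Suc m2)}" using t by auto
      define a where "a = real_of_int j / Suc k * t"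
      define b where "b = ?e * t"
      have e1: "real_of_int (j + 1) / Suc k * t = a + b"
        by (simp add: a_def b_def add_divide_distrib distrib_right)
      have e2: "real_of_int (j + 1 + 1) / Suc k * t = a + b + b"
        by (simp add: a_def b_def add_divide_distrib distrib_right)
      show "\<bar>g (x + axis i t) - g x - real_of_int (j + 1) / Suc k * t\<bar> \<le> ?e * t"
        using m1[OF t'(1), folded a_def] m2'[OF t'(2), unfolded e2] unfolding e1 b_def[symmetric] by linarith
    qed
  qed
  then obtain j m where jm: "\<And>i t. 0 < t \<Longrightarrow> t < 1 / Suc (m i) \<Longrightarrow> \<bar>g (x + axis i t) - g x - real_of_int (j i) / Suc k * t\<bar> \<le> ?e * t"
    by metis
  have "1 / real (Suc (sum m UNIV)) \<le> 1 / real (Suc (m i))" for i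
    using member_le_sum[of i UNIV m] by (auto simp: field_simps simp flip: of_nat_sum)
  then have "x \<in> lin_set (\<lambda>i. real_of_int (j i) / Suc k) ?e (sum m UNIV)"
    unfolding lin_set_def using jm by (auto intro: less_le_trans)
  then show ?thesis by blast
qed

text \<open>Countably many exceptional null sets suffice because the quantised slopes are integer
  vectors over a finite index type. Off these sets, for every \<open>k\<close>, the point lies in
  some \<open>lin_set\<close> of tolerance \<open>1 / Suc k\<close> that is not porous
  there.\<close>

theorem Rademacher: "negligible {x. \<not> g differentiable (at x)}"
proof -
  define A where "A = (\<Union>(i, j, k)\<in>(UNIV :: ('n \<times> int \<times> nat) set). dini_set i (real_of_int j / Suc k) (real_of_int (j + 1) / Suc k))"
  define E where "E j k m = lin_set (\<lambda>i. real_of_int (j i) / Suc k) (1 / Suc k) m" for j :: "'n \<Rightarrow> int" and k m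
  define B where "B = (\<Union>(j, k, m)\<in>(UNIV :: (('n \<Rightarrow> int) \<times> nat \<times> nat) set). {x \<in> E j k m. porous_at (E j k m) (1 / Suc k) x})"
  have "negligible A"
    unfolding A_def
  proof (rule negligible_countable_Union)
    show "negligible S" if S: "S \<in> (\<lambda>(i, j, k). dini_set i (real_of_int j / Suc k) (real_of_int (j + 1) / Suc k)) ` (UNIV :: ('n \<times> int \<times> nat) set)" for S
    proof -
      obtain i j k where S: "S = dini_set i (real_of_int j / Suc k) (real_of_int (j + 1) / Suc k)"
        using S by auto
      have "S \<in> null_sets lborel"
        unfolding S by (rule null_dini_set) (simp add: field_simps)
      then show ?thesis
        unfolding negligible_iff_null_sets by (rule null_sets_completionI)
    qed
  qed simp
  moreover have "negligible B"
    unfolding B_def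
  proof (rule negligible_countable_Union)
    show "negligible S" if S: "S \<in> (\<lambda>(j, k, m). {x \<in> E j k m. porous_at (E j k m) (1 / Suc k) x}) ` (UNIV :: (('n \<Rightarrow> int) \<times> nat \<times> nat) set)" for S
    proof -
      obtain j k m where S: "S = {x \<in> E j k m. porous_at (E j k m) (1 / Suc k) x}"
        using S by auto
      show ?thesis
        unfolding S by (rule negligible_porous) (auto simp: E_def closed_lin_set)
    qed
  qed simp
  moreover have "{x. \<not> g differentiable (at x)} \<subseteq> A \<union> B"
  proof (rule ccontr)
    assume "\<not> {x. \<not> g differentiable (at x)} \<subseteq> A \<union> B"
    then obtain x where x: "\<not> g differentiable (at x)" "x \<notin> A" "x \<notin> B" by blast
    have "g differentiable (at x)"
    proof (rule differentiable_by_linear_approx)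
      fix e :: real assume e: "e > 0"
      define c where "c = real CARD('n) * (1 + 4 * L)"
      have c: "c > 0" using L_nonneg by (simp add: c_def)
      obtain k where k: "1 / real (Suc k) < e / c"
        using nat_approx_posE[of "e / c"] e c by auto
      have "x \<notin> dini_set i (real_of_int j / Suc k) (real_of_int (j + 1) / Suc k)" for i j
        using x(2) unfolding A_def by blast
      then obtain j m where jm: "x \<in> E j k m"
        unfolding E_def using exists_lin_set by blast
      moreover have "\<not> porous_at (E j k m) (1 / Suc k) x"
        using jm x(3) unfolding B_def by blast
      ultimately obtain d where d: "d > 0" "\<And>y. norm y < d \<Longrightarrow>
          \<bar>g (x + y) - g x - (\<Sum>i\<in>UNIV. real_of_int (j i) / Suc k * y $ i)\<bar> \<le> (c * (1 / Suc k)) * norm y"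
        using lin_set_approx[of x "\<lambda>i. real_of_int (j i) / Suc k" "1 / Suc k" m] unfolding E_def c_def by auto
      show "\<exists>q d. d > 0 \<and> (\<forall>y. norm y < d \<longrightarrow> \<bar>g (x + y) - g x - q \<bullet> y\<bar> \<le> e * norm y)"
      proof (intro exI[of _ "\<chi> i. real_of_int (j i) / Suc k"] exI[of _ d] conjI d(1) allI impI)
        fix y :: "real^'n" assume "norm y < d"
        have "c * (1 / Suc k) \<le> e" using k c by (simp add: field_simps)
        then have "(c * (1 / Suc k)) * norm y \<le> e * norm y" by (rule mult_right_mono) simp
        with d(2)[OF \<open>norm y < d\<close>]
        show "\<bar>g (x + y) - g x - (\<chi> i. real_of_int (j i) / Suc k) \<bullet> y\<bar> \<le> e * norm y"
          by (simp add: inner_vec_def)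
      qed
    qed
    with x(1) show False by blast
  qed
  ultimately show ?thesis
    by (meson negligible_Un negligible_subset)
qed

end

section \<open>Aleksandrov estimates\<close>

text \<open>Among the matrices whose columns lead from \<open>x0\<close> into
  \<open>closure S\<close>, take one of maximal \<open>|det A|\<close>. Replacing column
  \<open>k\<close> by \<open>A *v c\<close> multiplies the determinant by \<open>c $ k\<close>
  (Cramer), so maximality forces \<open>|c $ k| \<le> 1\<close>.\<close>

lemma auerbach_basis:
  fixes S :: "(real^'n::finite) set"
  assumes S: "open S" "bounded S" "x0 \<in> S"
  obtains A :: "real^'n^'n" where "det A \<noteq> 0" "\<And>k. x0 + column k A \<in> closure S"
    "\<And>y. y \<in> closure S \<Longrightarrow> \<exists>c. y = x0 + A *v c \<and> (\<forall>k. \<bar>c $ k\<bar> \<le> 1)"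
proof -
  define K where "K = {A :: real^'n^'n. \<forall>k. x0 + column k A \<in> closure S}"
  have "closed K"
  proof -
    have "K = (\<Inter>k. (\<lambda>A. x0 + column k A) -` closure S)" by (auto simp: K_def)
    also have "closed \<dots>"
      by (intro closed_INT ballI closed_vimage) (auto simp: column_def intro!: continuous_intros)
    finally show ?thesis .
  qed
  moreover have "bounded K"
  proof -
    have "bounded (closure S)" using S by (simp add: bounded_closure)
    then obtain b where b: "\<And>y. y \<in> closure S \<Longrightarrow> norm y \<le> b" unfolding bounded_iff by blast
    have "norm A \<le> (\<Sum>i\<in>(UNIV::'n set). \<Sum>k\<in>(UNIV::'n set). b + norm x0)" if A: "A \<in> K" for A
    proof -
      have "\<bar>A $ i $ k\<bar> \<le> b + norm x0" for i k
      proof -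
        have "\<bar>A $ i $ k\<bar> = \<bar>column k A $ i\<bar>" by (simp add: column_def)
        also have "\<dots> \<le> norm (column k A)" by (rule component_le_norm_cart)
        also have "\<dots> \<le> norm (x0 + column k A) + norm x0"
          by (metis add.commute add_diff_cancel_left' norm_triangle_ineq4)
        finally show ?thesis using b[of "x0 + column k A"] A by (auto simp: K_def)
      qed
      then have "(\<Sum>k\<in>UNIV. \<bar>A $ i $ k\<bar>) \<le> (\<Sum>k\<in>(UNIV::'n set). b + norm x0)" for i by (intro sum_mono)
      then have "norm (A $ i) \<le> (\<Sum>k\<in>(UNIV::'n set). b + norm x0)" for i
        using norm_le_l1_cart[of "A $ i"] by (meson order_trans)
      then have "(\<Sum>i\<in>UNIV. norm (A $ i)) \<le> (\<Sum>i\<in>(UNIV::'n set). \<Sum>k\<in>(UNIV::'n set). b + norm x0)"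
        by (intro sum_mono)
      moreover have "norm A \<le> (\<Sum>i\<in>UNIV. norm (A $ i))"
        by (simp add: norm_vec_def L2_set_le_sum)
      ultimately show ?thesis by (rule order_trans[rotated])
    qed
    then show ?thesis unfolding bounded_iff by blast
  qed
  ultimately have comp: "compact K" by (simp add: compact_eq_bounded_closed)
  have K0: "0 \<in> K" using S by (auto simp: K_def column_def vec_eq_iff zero_vec_def[symmetric] closure_subset[THEN subsetD])
  have "continuous_on K (\<lambda>A. \<bar>det A\<bar>)"
    unfolding det_def by (intro continuous_intros)
  then obtain A where A: "A \<in> K" "\<And>A'. A' \<in> K \<Longrightarrow> \<bar>det A'\<bar> \<le> \<bar>det A\<bar>"
    using continuous_attains_sup[OF comp] K0 by blast
  obtain e where e: "e > 0" "cball x0 e \<subseteq> S" using S open_contains_cball by blast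
  have "matrix ((*\<^sub>R) e) \<in> K"
  proof -
    have "column k (matrix ((*\<^sub>R) e) :: real^'n^'n) = axis k e" for k
      by (simp add: column_def matrix_def vec_eq_iff axis_def)
    then show ?thesis
      using e closure_subset[of S] by (auto simp: K_def dist_norm norm_axis subset_iff)
  qed
  from A(2)[OF this] have dA: "det A \<noteq> 0" using zero_less_power[OF e(1), of "CARD('n)"] by auto
  show thesis
  proof (rule that[OF dA])
    show "x0 + column k A \<in> closure S" for k using A(1) by (simp add: K_def)
    show "\<exists>c. y = x0 + A *v c \<and> (\<forall>k. \<bar>c $ k\<bar> \<le> 1)" if y: "y \<in> closure S" for y
    proof -
      obtain c where c: "A *v c = y - x0"
        using dA invertible_det_nz[of A] by (metis invertible_def matrix_vector_mul_assoc matrix_vector_mul_lid)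
      have "\<bar>c $ k\<bar> \<le> 1" for k
      proof -
        let ?A' = "(\<chi> i j. if j = k then (A *v c) $ i else A $ i $ j) :: real^'n^'n"
        have "x0 + column j ?A' \<in> closure S" for j
        proof (cases "j = k")
          case True
          then have "column j ?A' = A *v c" by (simp add: column_def vec_eq_iff)
          then show ?thesis using c y by simp
        next
          case False
          then have "column j ?A' = column j A" by (simp add: column_def vec_eq_iff)
          then show ?thesis using A(1) by (simp add: K_def)
        qed
        then have "\<bar>det ?A'\<bar> \<le> \<bar>det A\<bar>" using A(2)[of ?A'] by (simp add: K_def)
        then have "\<bar>c $ k\<bar> * \<bar>det A\<bar> \<le> 1 * \<bar>det A\<bar>" by (simp only: cramer_lemma abs_mult mult_1)
        then show ?thesis using dA by (simp only: mult_le_cancel_right)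
      qed
      then show ?thesis using c by (intro exI[of _ c]) auto
    qed
  qed
qed

lemma affine_cube_measure:
  fixes M :: "real^'n::finite^'n"
  assumes "\<And>i. a $ i \<le> b $ i"
  shows "(\<lambda>c. q + M *v c) ` cbox a b \<in> lmeasurable"
    "measure lebesgue ((\<lambda>c. q + M *v c) ` cbox a b) = \<bar>det M\<bar> * (\<Prod>i\<in>UNIV. b $ i - a $ i)"
proof -
  have l: "linear ((*v) M)" by (rule matrix_vector_mul_linear)
  have eq: "(\<lambda>c. q + M *v c) ` cbox a b = (+) q ` ((*v) M) ` cbox a b" by (simp add: image_image)
  show "(\<lambda>c. q + M *v c) ` cbox a b \<in> lmeasurable"
    unfolding eq by (intro measurable_translation measure_linear_image_fin l) simp
  show "measure lebesgue ((\<lambda>c. q + M *v c) ` cbox a b) = \<bar>det M\<bar> * (\<Prod>i\<in>UNIV. b $ i - a $ i)"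
    unfolding eq measure_translation
    by (subst measure_linear_image_fin[OF l]) (use assms in \<open>auto simp: content_cbox_cart interval_ne_empty_cart\<close>)
qed

lemma matrix_vector_columns:
  fixes A :: "real^'n::finite^'m"
  shows "A *v c = (\<Sum>k\<in>UNIV. c $ k *\<^sub>R column k A)"
  by (simp add: matrix_mult_sum scalar_mult_eq_scaleR)

lemma closure_convex_cube:
  fixes A :: "real^'n::finite^'n"
  assumes S: "convex S" "x0 \<in> S" and col: "\<And>k. x0 + column k A \<in> closure S"
    and c: "\<And>k. 0 \<le> c $ k" "\<And>k. c $ k \<le> 1 / real CARD('n)"
  shows "x0 + A *v c \<in> closure S"
proof -
  have "(\<Sum>k\<in>UNIV. c $ k) \<le> (\<Sum>k\<in>(UNIV::'n set). 1 / real CARD('n))" by (intro sum_mono c)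
  then have s: "(\<Sum>k\<in>UNIV. c $ k) \<le> 1" by simp
  have cl: "convex (closure S)" "x0 \<in> closure S" using S closure_subset by (auto intro: convex_closure)
  \<comment> \<open>\<open>'n option\<close> indexes the \<open>n + 1\<close> vertices:
    \<open>None\<close> stands for \<open>x0\<close> and carries the remaining weight.\<close>
  let ?c' = "\<lambda>k::'n option. case k of None \<Rightarrow> 1 - (\<Sum>k\<in>UNIV. c $ k) | Some k \<Rightarrow> c $ k"
  let ?y' = "\<lambda>k::'n option. case k of None \<Rightarrow> x0 | Some k \<Rightarrow> x0 + column k A"
  have "(\<Sum>k\<in>UNIV. ?c' k *\<^sub>R ?y' k) \<in> closure S"
    by (rule convex_sum[OF _ cl(1)])
      (use s c cl col in \<open>auto simp: UNIV_option_conv sum.reindex split: option.splits\<close>)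
  also have "(\<Sum>k\<in>UNIV. ?c' k *\<^sub>R ?y' k) = x0 + (\<Sum>k\<in>UNIV. c $ k *\<^sub>R column k A)"
    by (simp add: UNIV_option_conv sum.reindex algebra_simps sum.distrib scaleR_sum_left)
  also have "(\<Sum>k\<in>UNIV. c $ k *\<^sub>R column k A) = A *v c"
    by (simp add: matrix_vector_columns)
  finally show ?thesis .
qed

lemma measure_closure_convex:
  fixes S :: "'a::euclidean_space set"
  assumes "convex S" "bounded S" "open S"
  shows "closure S \<in> lmeasurable" "measure lebesgue (closure S) = measure lebesgue S"
proof -
  show c: "closure S \<in> lmeasurable" using assms by (simp add: lmeasurable_compact)
  have "measure lebesgue (closure S) = measure lebesgue (S \<union> (frontier S))"
    by (simp add: closure_Un_frontier)
  also have "\<dots> = measure lebesgue S"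
  proof (rule measure_Un_null_set)
    show "S \<in> sets lebesgue" using assms by simp
    show "frontier S \<in> null_sets lebesgue"
      using negligible_convex_frontier[OF assms(1)] by (simp add: negligible_iff_null_sets)
  qed
  finally show "measure lebesgue (closure S) = measure lebesgue S" .
qed

lemma auerbach_volume_lower:
  fixes A :: "real^'n::finite^'n"
  assumes S: "convex S" "bounded S" "open S" "x0 \<in> S" and col: "\<And>k. x0 + column k A \<in> closure S"
  shows "\<bar>det A\<bar> / real CARD('n) ^ CARD('n) \<le> measure lebesgue S"
proof -
  let ?C = "(\<lambda>c. x0 + A *v c) ` cbox 0 (\<chi> i. 1 / real CARD('n))"
  have "?C \<subseteq> closure S"
    using closure_convex_cube[OF S(1,4) col] by (auto simp: mem_box_cart)
  then have "measure lebesgue ?C \<le> measure lebesgue (closure S)"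
    using measure_closure_convex[OF S(1-3)] affine_cube_measure[of 0 "\<chi> i. 1 / real CARD('n)" x0 A]
    by (intro measure_mono_fmeasurable) (auto simp: fmeasurableD)
  then show ?thesis
    using measure_closure_convex[OF S(1-3)] affine_cube_measure[of 0 "\<chi> i. 1 / real CARD('n)" x0 A]
    by (simp add: power_one_over field_simps)
qed

text \<open>Raise a plane of slope \<open>p\<close> until it touches \<open>v\<close> from below.
  Contact cannot occur on the frontier, where \<open>v \<ge> 0\<close>, because \<open>x0\<close>
  already gives \<open>v - p\<close> a smaller value.\<close>

lemma interior_subgradient:
  fixes v :: "'a::euclidean_space \<Rightarrow> real"
  assumes S: "open S" "bounded S" "x0 \<in> S" and cont: "continuous_on (closure S) v"
    and fr: "\<And>y. y \<in> frontier S \<Longrightarrow> 0 \<le> v y" and x0: "v x0 = - h"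
    and p: "\<And>y. y \<in> closure S \<Longrightarrow> p \<bullet> (y - x0) < h"
  shows "\<exists>x\<in>S. \<forall>y\<in>closure S. v x + p \<bullet> (y - x) \<le> v y"
proof -
  have comp: "compact (closure S)" using S by simp
  have x0c: "x0 \<in> closure S" using S closure_subset by blast
  have ne: "closure S \<noteq> {}" using x0c by auto
  have cv: "continuous_on (closure S) (\<lambda>y. v y - p \<bullet> y)" by (intro continuous_intros cont)
  obtain x where x: "x \<in> closure S" "\<And>y. y \<in> closure S \<Longrightarrow> v x - p \<bullet> x \<le> v y - p \<bullet> y"
    using continuous_attains_inf[OF comp ne cv] by blast
  have "x \<notin> frontier S"
  proof
    assume "x \<in> frontier S"
    then have "0 \<le> v x" by (rule fr)
    with x(2)[OF x0c] p[OF x(1)] x0 show False by (simp add: inner_diff_right)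
  qed
  then have "x \<in> S" using x(1) S(1) by (simp add: frontier_def interior_open)
  then show ?thesis
    using x(2) by (intro bexI[of _ x]) (auto simp: inner_diff_right algebra_simps)
qed

text \<open>Convexity turns local support into global support: shrink the segment from
  \<open>x\<close> to \<open>y\<close> until it stays in \<open>S\<close>.\<close>

lemma local_subgradient:
  assumes u: "convex_on \<Omega> u" "convex \<Omega>" and S: "open S" "S \<subseteq> \<Omega>" "x \<in> S"
    and p: "\<And>y. y \<in> S \<Longrightarrow> u x + p \<bullet> (y - x) \<le> u y"
  shows "p \<in> subdifferential \<Omega> u x"
  unfolding subdifferential_def
proof (intro CollectI ballI)
  fix y assume y: "y \<in> \<Omega>"
  have xO: "x \<in> \<Omega>" using S by blast
  obtain e where e: "e > 0" "ball x e \<subseteq> S" using S openE by blast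
  define t where "t = min 1 (e / (2 * (norm (y - x) + 1)))"
  have t: "0 < t" "t \<le> 1" using e by (auto simp: t_def add_nonneg_pos)
  have "t * norm (y - x) \<le> e / (2 * (norm (y - x) + 1)) * norm (y - x)"
    by (intro mult_right_mono) (auto simp: t_def)
  also have "\<dots> < e"
  proof -
    have "norm (y - x) < 2 * (norm (y - x) + 1)" using norm_ge_zero[of "y - x"] by argo
    then have "e * norm (y - x) < e * (2 * (norm (y - x) + 1))" using e by simp
    moreover have "0 < 2 * (norm (y - x) + 1)" using norm_ge_zero[of "y - x"] by argo
    ultimately show ?thesis by (simp only: times_divide_eq_left pos_divide_less_eq)
  qed
  finally have "x + t *\<^sub>R (y - x) \<in> S" using e t by (auto simp: dist_norm subset_iff)
  from p[OF this] have "u x + t * (p \<bullet> (y - x)) \<le> u (x + t *\<^sub>R (y - x))" by simp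
  also have "x + t *\<^sub>R (y - x) = (1 - t) *\<^sub>R x + t *\<^sub>R y" by (simp add: algebra_simps)
  also have "u \<dots> \<le> (1 - t) * u x + t * u y"
    by (rule convex_onD[OF u(1)]) (use t xO y in auto)
  finally have "t * (u x + p \<bullet> (y - x)) \<le> t * u y" by (simp add: algebra_simps)
  then show "u x + p \<bullet> (y - x) \<le> u y" using t by simp
qed

locale ma_bounds =
  fixes \<Omega> :: "(real^'n::finite) set" and u :: "real^'n \<Rightarrow> real" and lam Lam :: real
  assumes op: "open \<Omega>" and cvx: "convex \<Omega>" and bdd: "bounded \<Omega>" and ne: "\<Omega> \<noteq> {}"
    and lam: "0 < lam" and lamLam: "lam \<le> Lam"
    and cont: "continuous_on (closure \<Omega>) u" and ucvx: "convex_on \<Omega> u"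
    and bzero: "\<And>x. x \<in> frontier \<Omega> \<Longrightarrow> u x = 0"
    and ma_lower: "\<And>E. E \<in> sets borel \<Longrightarrow> E \<subseteq> \<Omega> \<Longrightarrow> ennreal lam * emeasure lborel E \<le> monge_ampere \<Omega> u E"
    and ma_upper: "\<And>E. E \<in> sets borel \<Longrightarrow> E \<subseteq> \<Omega> \<Longrightarrow> monge_ampere \<Omega> u E \<le> ennreal Lam * emeasure lborel E"
begin

text \<open>Relative to \<open>q\<close>, every slope \<open>q + P *v c\<close> with
  \<open>0 \<le> c $ k \<le> 1 / n\<close> rises from \<open>x0\<close> by at most
  \<open>h / 2\<close> on the section, whose depth at \<open>x0\<close> is \<open>h\<close>. Its
  plane therefore touches \<open>u\<close> inside \<open>S\<close>, and the volume of this
  parallelepiped of slopes is bounded by the Monge-Ampere measure of \<open>S\<close>.\<close>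

lemma subgradient_cube_upper:
  assumes S: "open S" "S \<subseteq> \<Omega>" and x0: "x0 \<in> S" "u x0 = q \<bullet> x0 + a - h"
    and fr: "\<And>y. y \<in> frontier S \<Longrightarrow> q \<bullet> y + a \<le> u y"
    and h: "0 < h" and P: "\<And>j y. y \<in> closure S \<Longrightarrow> column j P \<bullet> (y - x0) \<le> h / 2"
  shows "\<bar>det P\<bar> / real CARD('n) ^ CARD('n) \<le> Lam * measure lebesgue S"
proof (cases "det P = 0")
  case True
  then show ?thesis using lam lamLam by simp
next
  case False
  let ?n = "real CARD('n)"
  let ?C = "(\<lambda>c. q + P *v c) ` cbox 0 (\<chi> i. 1 / ?n)"
  have bS: "bounded S" using S bdd bounded_subset by blast
  have clS: "closure S \<subseteq> closure \<Omega>" using S closure_mono by blast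
  have sub: "?C \<subseteq> (\<Union>x\<in>S. subdifferential \<Omega> u x)"
  proof
    fix p assume "p \<in> ?C"
    then obtain c where c: "p = q + P *v c" "\<And>k. 0 \<le> c $ k" "\<And>k. c $ k \<le> 1 / ?n"
      by (auto simp: mem_box_cart)
    have "(p - q) \<bullet> (y - x0) < h" if y: "y \<in> closure S" for y
    proof -
      have "(p - q) \<bullet> (y - x0) = (\<Sum>k\<in>UNIV. c $ k * (column k P \<bullet> (y - x0)))"
        by (simp add: c(1) matrix_vector_columns inner_sum_left)
      also have "\<dots> \<le> (\<Sum>k\<in>(UNIV::'n set). 1 / ?n * (h / 2))"
      proof (rule sum_mono)
        fix k
        have "c $ k * (column k P \<bullet> (y - x0)) \<le> c $ k * (h / 2)"
          by (intro mult_left_mono P y c)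
        also have "\<dots> \<le> 1 / ?n * (h / 2)" using h by (intro mult_right_mono c) simp
        finally show "c $ k * (column k P \<bullet> (y - x0)) \<le> 1 / ?n * (h / 2)" .
      qed
      also have "\<dots> < h" using h by simp
      finally show ?thesis .
    qed
    moreover have "continuous_on (closure S) (\<lambda>y. u y - (q \<bullet> y + a))"
      by (intro continuous_intros continuous_on_subset[OF cont clS])
    ultimately obtain x where x: "x \<in> S" "\<And>y. y \<in> closure S \<Longrightarrow>
        u x - (q \<bullet> x + a) + (p - q) \<bullet> (y - x) \<le> u y - (q \<bullet> y + a)"
      using interior_subgradient[OF S(1) bS x0(1), of "\<lambda>y. u y - (q \<bullet> y + a)" h "p - q"] fr x0(2)
      by (auto simp: algebra_simps)
    have "p \<in> subdifferential \<Omega> u x"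
    proof (rule local_subgradient[OF ucvx cvx S x(1)])
      fix y assume "y \<in> S"
      then show "u x + p \<bullet> (y - x) \<le> u y"
        using x(2)[of y] closure_subset[of S] by (auto simp: inner_diff_left inner_diff_right)
    qed
    then show "p \<in> (\<Union>x\<in>S. subdifferential \<Omega> u x)" using x(1) by blast
  qed
  have C: "?C \<in> lmeasurable" "measure lebesgue ?C = \<bar>det P\<bar> / ?n ^ CARD('n)"
    using affine_cube_measure[of 0 "\<chi> i. 1 / ?n" q P] by (auto simp: power_one_over)
  have Slm: "S \<in> lmeasurable" using S bS by (simp add: lmeasurable_open)
  have Sb: "S \<in> sets borel" using S by simp
  have mS: "emeasure lborel S = ennreal (measure lebesgue S)"
    using emeasure_eq_measure2[OF Slm] Sb by simp
  \<comment> \<open>Monotonicity of \<open>emeasure\<close> needs a measurable superset. The union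
    of the subdifferentials has positive measure by the lower bound, whereas non-measurable sets
    have measure 0.\<close>
  have "measure lebesgue S > 0"
    using S x0 Slm by (metis measure_eq_0_null_sets zero_less_measure_iff negligible_iff_measure
        open_not_negligible empty_iff)
  then have "0 < ennreal lam * emeasure lborel S"
    unfolding mS using lam by (simp flip: ennreal_mult'')
  then have "monge_ampere \<Omega> u S > 0"
    using ma_lower[OF Sb S(2)] by (simp add: less_le_trans)
  then have "(\<Union>x\<in>S. subdifferential \<Omega> u x) \<in> sets lebesgue"
    unfolding monge_ampere_def by (metis emeasure_notin_sets less_irrefl)
  then have "emeasure lebesgue ?C \<le> monge_ampere \<Omega> u S"
    unfolding monge_ampere_def by (intro emeasure_mono sub)
  also have "\<dots> \<le> ennreal Lam * emeasure lborel S" by (rule ma_upper[OF Sb S(2)])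
  also have "\<dots> = ennreal (Lam * measure lebesgue S)"
    using lam lamLam by (simp add: mS ennreal_mult)
  finally have "ennreal (measure lebesgue ?C) \<le> ennreal (Lam * measure lebesgue S)"
    using C(1) by (simp add: emeasure_eq_measure2)
  then show ?thesis
    using C(2) lam lamLam by (simp add: ennreal_le_iff)
qed

text \<open>Bounded oscillation bounds the slopes away from the frontier. From a point of
  \<open>K\<close> one can move by a fixed fraction of each column of \<open>A\<close> in both
  directions within \<open>S\<close>, and \<open>u\<close> minus the plane varies by at most
  \<open>2 * h\<close>. All subgradients on \<open>K\<close> thus lie in a parallelepiped dual to
  \<open>A\<close>, and the lower measure bound on \<open>K\<close> controls
  \<open>|S| |det A|\<close>.\<close>

lemma subgradient_box_lower:
  assumes S: "open S" "convex S" "S \<subseteq> \<Omega>" and x0: "x0 \<in> S"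
    and A: "det A \<noteq> 0" "\<And>k. x0 + column k A \<in> closure S"
    and h: "0 < h" and bd: "\<And>x. x \<in> S \<Longrightarrow> q \<bullet> x + a - 2 * h \<le> u x \<and> u x \<le> q \<bullet> x + a"
  shows "lam * (measure lebesgue S * \<bar>det A\<bar>) \<le> 2 ^ CARD('n) * (16 * real CARD('n) * h) ^ CARD('n)"
proof -
  let ?n = "real CARD('n)"
  obtain A' where A': "A' ** A = mat 1"
    using A(1) invertible_det_nz[of A] unfolding invertible_def by blast
  \<comment> \<open>The centre of the parallelepiped spanned at \<open>x0\<close> by the columns
    divided by \<open>n\<close>, which lies in \<open>closure S\<close> by convexity.\<close>
  define x1 where "x1 = x0 + A *v (\<chi> i. 1 / (2 * ?n))"
  have n1: "?n \<ge> 1" by simp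
  have y1: "x1 + s *\<^sub>R (A *v axis k 1) \<in> closure S" if s: "\<bar>s\<bar> \<le> 1 / (2 * ?n)" for k s
  proof -
    have "x1 + s *\<^sub>R (A *v axis k 1) = x0 + A *v ((\<chi> i. 1 / (2 * ?n)) + s *\<^sub>R axis k 1)"
      by (simp add: x1_def matrix_vector_right_distrib matrix_vector_mult_scaleR)
    moreover have "\<dots> \<in> closure S"
    proof (rule closure_convex_cube[OF S(2) x0 A(2)])
      fix j
      have "((\<chi> i. 1 / (2 * ?n)) + s *\<^sub>R axis k 1 :: real^'n) $ j = 1 / (2 * ?n) + (if j = k then s else 0)"
        by (simp add: axis_def)
      moreover have "1 / (2 * ?n) + 1 / (2 * ?n) = 1 / ?n" "0 \<le> 1 / (2 * ?n)" by auto
      ultimately show "0 \<le> ((\<chi> i. 1 / (2 * ?n)) + s *\<^sub>R axis k 1 :: real^'n) $ j"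
        "((\<chi> i. 1 / (2 * ?n)) + s *\<^sub>R axis k 1 :: real^'n) $ j \<le> 1 / ?n"
        using s by (auto simp: abs_le_iff)
    qed
    ultimately show ?thesis by simp
  qed
  have mid: "(1/2) *\<^sub>R y + (1/2) *\<^sub>R z \<in> S" if "y \<in> closure S" "z \<in> S" for y z
  proof -
    have "y - (1/2) *\<^sub>R (y - z) \<in> interior S"
      by (rule mem_interior_closure_convex_shrink) (use S that in \<open>auto simp: interior_open\<close>)
    moreover have "y - (1/2) *\<^sub>R (y - z) = (1/2) *\<^sub>R y + (1/2) *\<^sub>R z"
      by (simp add: vec_eq_iff field_simps)
    ultimately show ?thesis using S by (simp add: interior_open)
  qed
  \<comment> \<open>The homothetic copy of \<open>S\<close> of ratio 1/2 about \<open>x1\<close>.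
    Half of any step admissible at \<open>x1\<close> keeps its points in \<open>S\<close>.\<close>
  define K where "K = (\<lambda>z. (1/2) *\<^sub>R z + (1/2) *\<^sub>R x1) ` S"
  have x1: "x1 \<in> closure S" using y1[of 0] by simp
  have KS: "K \<subseteq> S" using mid[OF x1] by (auto simp: K_def add.commute)
  have Ko: "open K"
  proof -
    have "K = (+) ((1/2) *\<^sub>R x1) ` (\<lambda>z. (1/2) *\<^sub>R z) ` S"
      by (simp add: K_def image_image add.commute)
    then show ?thesis using S(1) by (simp add: open_translation open_scaling)
  qed
  let ?b = "(\<chi> i. 8 * ?n * h) :: real^'n"
  let ?C = "(\<lambda>c. q + transpose A' *v c) ` cbox (- ?b) ?b"
  have sub: "(\<Union>x\<in>K. subdifferential \<Omega> u x) \<subseteq> ?C"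
  proof
    fix p assume "p \<in> (\<Union>x\<in>K. subdifferential \<Omega> u x)"
    then obtain z where z: "z \<in> S" and p: "p \<in> subdifferential \<Omega> u ((1/2) *\<^sub>R z + (1/2) *\<^sub>R x1)"
      by (auto simp: K_def)
    define x where "x = (1/2) *\<^sub>R z + (1/2) *\<^sub>R x1"
    have xS: "x \<in> S" using KS z by (auto simp: K_def x_def)
    have key: "(p - q) \<bullet> (s *\<^sub>R (A *v axis k 1)) \<le> 4 * h" if s: "\<bar>s\<bar> \<le> 1 / (2 * ?n)" for k s
    proof -
      define y where "y = (1/2) *\<^sub>R (x1 + s *\<^sub>R (A *v axis k 1)) + (1/2) *\<^sub>R z"
      have yS: "y \<in> S" unfolding y_def by (rule mid[OF y1[OF s] z])
      have "u x + p \<bullet> (y - x) \<le> u y"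
        using p yS S(3) by (auto simp: subdifferential_def x_def)
      then have "(p - q) \<bullet> (y - x) \<le> 2 * h"
        using bd[OF xS] bd[OF yS] by (simp add: inner_diff_left inner_diff_right)
      moreover have "y - x = (1/2) *\<^sub>R (s *\<^sub>R (A *v axis k 1))"
        by (simp add: y_def x_def algebra_simps)
      ultimately show ?thesis by simp
    qed
    define c where "c = (p - q) v* A"
    have ck: "c $ k = (p - q) \<bullet> (A *v axis k 1)" for k
      by (simp add: c_def flip: dot_lmul_matrix) (simp add: inner_axis)
    have "- (8 * ?n * h) \<le> c $ k \<and> c $ k \<le> 8 * ?n * h" for k
      using key[of "1 / (2 * ?n)" k] key[of "- 1 / (2 * ?n)" k] n1
      by (simp add: ck field_simps)
    then have "c \<in> cbox (- ?b) ?b" by (simp add: mem_box_cart)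
    moreover have "p = q + transpose A' *v c"
    proof -
      have "c v* A' = p - q"
      proof -
        have "A ** A' = mat 1" using A' matrix_left_right_inverse by blast
        then show ?thesis by (simp add: c_def vector_matrix_mul_assoc)
      qed
      then show ?thesis by simp
    qed
    ultimately show "p \<in> ?C" by blast
  qed
  have b: "(- ?b) $ i \<le> ?b $ i" for i using h by simp
  have C: "?C \<in> lmeasurable" "measure lebesgue ?C = \<bar>det A'\<bar> * (16 * ?n * h) ^ CARD('n)"
  proof -
    have "(\<Prod>i\<in>UNIV. ?b $ i - (- ?b) $ i) = (16 * ?n * h) ^ CARD('n)"
      by (simp add: power_mult_distrib)
    then show "?C \<in> lmeasurable" "measure lebesgue ?C = \<bar>det A'\<bar> * (16 * ?n * h) ^ CARD('n)"
      using affine_cube_measure[OF b, of q "transpose A'"] unfolding det_transpose by auto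
  qed
  have bS: "bounded S" using S bdd bounded_subset by blast
  have bK: "bounded K" using KS bS bounded_subset by blast
  have Klm: "K \<in> lmeasurable" using Ko bK by (simp add: lmeasurable_open)
  have mK: "measure lebesgue K = measure lebesgue S / 2 ^ CARD('n)"
    unfolding K_def by (subst measure_lebesgue_affine) (simp add: power_one_over)
  have "ennreal lam * emeasure lborel K \<le> monge_ampere \<Omega> u K"
    by (rule ma_lower) (use Ko KS S in auto)
  also have "\<dots> \<le> emeasure lebesgue ?C"
    unfolding monge_ampere_def by (rule emeasure_mono[OF sub]) (use C in \<open>auto simp: fmeasurableD\<close>)
  also have "emeasure lborel K = ennreal (measure lebesgue K)"
    using emeasure_eq_measure2[OF Klm] Ko by simp
  also have "emeasure lebesgue ?C = ennreal (measure lebesgue ?C)"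
    using C(1) by (rule emeasure_eq_measure2)
  finally have "lam * measure lebesgue K \<le> measure lebesgue ?C"
    using lam by (simp add: ennreal_le_iff flip: ennreal_mult)
  then have "lam * measure lebesgue S \<le> 2 ^ CARD('n) * (\<bar>det A'\<bar> * (16 * ?n * h) ^ CARD('n))"
    unfolding mK C(2) by (simp add: field_simps)
  then have "lam * measure lebesgue S * \<bar>det A\<bar> \<le> 2 ^ CARD('n) * (\<bar>det A'\<bar> * (16 * ?n * h) ^ CARD('n)) * \<bar>det A\<bar>"
    by (rule mult_right_mono) simp
  also have "\<dots> = 2 ^ CARD('n) * (16 * ?n * h) ^ CARD('n) * \<bar>det A' * det A\<bar>"
    by (simp add: abs_mult)
  also have "det A' * det A = 1" using A' by (metis det_I det_mul)
  finally show ?thesis by (simp add: mult.assoc)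
qed

lemma dual_basis:
  fixes A :: "real^'n^'n"
  assumes "det A \<noteq> 0"
  obtains B :: "real^'n^'n" where "\<And>r. (B *v r) v* A = r" "\<And>r. B *v (r v* A) = r" "det B * det A = 1"
proof -
  obtain A' where A': "A' ** A = mat 1" "A ** A' = mat 1"
    using assms invertible_det_nz[of A] unfolding invertible_def by blast
  show thesis
  proof (rule that[of "transpose A'"])
    show "(transpose A' *v r) v* A = r" "transpose A' *v (r v* A) = r" for r
      using A' by (simp_all add: vector_matrix_mul_assoc)
    show "det (transpose A') * det A = 1"
      using A'(1) by (metis det_I det_mul det_transpose)
  qed
qed

text \<open>The dual basis scaled by \<open>h / 2\<close> rises by at most \<open>h / 2\<close> on
  the section, because the coordinates there are at most 1 in absolute value. Its determinant is
  \<open>(h / 2) ^ n / det A\<close>, and \<open>|det A|\<close> is at most \<open>n ^ n\<close>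
  times the volume; this second use of the volume explains the square.\<close>

theorem alexandrov_estimate:
  assumes S: "open S" "convex S" "S \<subseteq> \<Omega>" and x0: "x0 \<in> S" "u x0 = q \<bullet> x0 + a - h"
    and fr: "\<And>y. y \<in> frontier S \<Longrightarrow> q \<bullet> y + a \<le> u y" and h: "0 < h"
  shows "h ^ CARD('n) \<le> (2 * real CARD('n) ^ 2) ^ CARD('n) * Lam * (measure lebesgue S)\<^sup>2"
proof -
  let ?n = "real CARD('n)" and ?N = "CARD('n)"
  have bS: "bounded S" using S bdd bounded_subset by blast
  obtain A where A: "det A \<noteq> 0" "\<And>k. x0 + column k A \<in> closure S"
    "\<And>y. y \<in> closure S \<Longrightarrow> \<exists>c. y = x0 + A *v c \<and> (\<forall>k. \<bar>c $ k\<bar> \<le> 1)"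
    using auerbach_basis[OF S(1) bS x0(1)] by metis
  obtain B where B: "\<And>r. (B *v r) v* A = r" "\<And>r. B *v (r v* A) = r" "det B * det A = 1"
    using dual_basis[OF A(1)] by metis
  define P where "P = B ** matrix ((*\<^sub>R) (h / 2))"
  have P: "column j P = B *v axis j (h / 2)" for j
  proof -
    have "matrix ((*\<^sub>R) (h / 2)) *v axis j 1 = axis j (h / 2)"
      by (simp add: matrix_works linear_scaleR flip: axis_scaleR)
    then show ?thesis
      by (simp add: P_def matrix_vector_mul_assoc[symmetric] flip: matrix_vector_mult_basis)
  qed
  have "\<bar>det P\<bar> / ?n ^ ?N \<le> Lam * measure lebesgue S"
  proof (rule subgradient_cube_upper[OF S(1,3) x0 fr h])
    fix j y assume "y \<in> closure S"
    then obtain c where c: "y = x0 + A *v c" "\<And>k. \<bar>c $ k\<bar> \<le> 1" using A(3) by blast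
    have "column j P \<bullet> (y - x0) = h / 2 * c $ j"
      by (simp add: P c B(1) flip: dot_lmul_matrix) (simp add: inner_axis')
    also have "\<dots> \<le> h / 2 * 1" using h c(2)[of j] by (intro mult_left_mono) (auto simp: abs_le_iff)
    finally show "column j P \<bullet> (y - x0) \<le> h / 2" by simp
  qed
  then have "\<bar>det P\<bar> / ?n ^ ?N * \<bar>det A\<bar> \<le> Lam * measure lebesgue S * \<bar>det A\<bar>"
    by (rule mult_right_mono) simp
  also have "\<bar>det P\<bar> / ?n ^ ?N * \<bar>det A\<bar> = (h / 2) ^ ?N / ?n ^ ?N * \<bar>det B * det A\<bar>"
    using h by (simp add: P_def det_mul abs_mult)
  finally have 1: "(h / 2) ^ ?N / ?n ^ ?N \<le> Lam * measure lebesgue S * \<bar>det A\<bar>"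
    using B(3) by simp
  also have "\<bar>det A\<bar> \<le> ?n ^ ?N * measure lebesgue S"
    using auerbach_volume_lower[OF S(2) bS S(1) x0(1) A(2)] by (simp add: field_simps)
  then have "Lam * measure lebesgue S * \<bar>det A\<bar> \<le> Lam * measure lebesgue S * (?n ^ ?N * measure lebesgue S)"
    using lam lamLam by (intro mult_left_mono) auto
  finally have "(h / 2) ^ ?N / ?n ^ ?N \<le> Lam * measure lebesgue S * (?n ^ ?N * measure lebesgue S)" .
  then show ?thesis
    by (simp add: power_divide field_simps power_mult_distrib power2_eq_square)
qed

text \<open>Quotient of the constant in \<open>subgradient_box_lower\<close> by the factor
  \<open>(h / 2) ^ n / n ^ n\<close> of the slope cube, with \<open>Lam / lam\<close> from the two
  measure bounds; the leading \<open>n\<close> adds up the coordinates of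
  \<open>e v* A\<close>.\<close>

definition aspect_const :: real where
  "aspect_const = real CARD('n) * (Lam / lam * 2 ^ CARD('n) * (16 * real CARD('n)) ^ CARD('n) * (2 * real CARD('n)) ^ CARD('n))"

lemma aspect_const_pos: "0 < aspect_const"
  using lam lamLam by (simp add: aspect_const_def)

text \<open>If \<open>x0\<close> is close to a supporting hyperplane of the section, the polar body of the section contains
  the long vector \<open>h e / \<rho>\<close>, hence has large volume. Against \<open>subgradient_box_lower\<close> this bounds \<open>R / \<rho>\<close>.\<close>

theorem section_aspect:
  assumes S: "open S" "convex S" "S \<subseteq> \<Omega>" and x0: "x0 \<in> S" "u x0 = q \<bullet> x0 + a - h"
    and fr: "\<And>y. y \<in> frontier S \<Longrightarrow> q \<bullet> y + a \<le> u y" and h: "0 < h"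
    and bd: "\<And>x. x \<in> S \<Longrightarrow> q \<bullet> x + a - 2 * h \<le> u x \<and> u x \<le> q \<bullet> x + a"
    and \<rho>: "\<And>x. x \<in> S \<Longrightarrow> e \<bullet> (x - x0) \<le> \<rho>" "0 < \<rho>"
    and y: "y \<in> S" "R \<le> e \<bullet> (x0 - y)"
  shows "R \<le> aspect_const * \<rho>"
proof -
  let ?n = "real CARD('n)" and ?N = "CARD('n)"
  have bS: "bounded S" using S bdd bounded_subset by blast
  obtain A where A: "det A \<noteq> 0" "\<And>k. x0 + column k A \<in> closure S"
    "\<And>y. y \<in> closure S \<Longrightarrow> \<exists>c. y = x0 + A *v c \<and> (\<forall>k. \<bar>c $ k\<bar> \<le> 1)"
    using auerbach_basis[OF S(1) bS x0(1)] by metis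
  obtain B where B: "\<And>r. (B *v r) v* A = r" "\<And>r. B *v (r v* A) = r" "det B * det A = 1"
    using dual_basis[OF A(1)] by metis
  define B' where "B' = B ** matrix ((*\<^sub>R) (h / 2))"
  have m: "matrix ((*\<^sub>R) r) *v v = r *\<^sub>R (v :: real^'n)" for r v
    by (simp add: matrix_works linear_scaleR)
  have B': "B' *v r = (h / 2) *\<^sub>R (B *v r)" for r
    by (simp add: B'_def matrix_vector_mul_assoc[symmetric] m matrix_vector_mult_scaleR)
  have detB': "det B' = (h / 2) ^ ?N * det B" by (simp add: B'_def det_mul)
  define w where "w = e v* A"
  have clS: "e \<bullet> (x - x0) \<le> \<rho>" if "x \<in> closure S" for x
  proof -
    have "closed {x. e \<bullet> (x - x0) \<le> \<rho>}" by (intro closed_Collect_le continuous_intros)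
    then show ?thesis using closure_minimal[of S "{x. e \<bullet> (x - x0) \<le> \<rho>}"] \<rho>(1) that by blast
  qed
  have wi: "\<bar>w $ i\<bar> \<le> \<rho> * (Lam / lam * 2 ^ ?N * (16 * ?n) ^ ?N * (2 * ?n) ^ ?N)" for i
  proof -
    \<comment> \<open>The scaled dual basis with column \<open>i\<close> replaced by
      \<open>h / (2 * \<rho>)\<close> times \<open>e\<close>; by Cramer's rule this multiplies the
      determinant by \<open>w $ i / \<rho>\<close>.\<close>
    define P where "P = ((\<chi> r j. if j = i then (B' *v ((1 / \<rho>) *\<^sub>R w)) $ r else B' $ r $ j) :: real^'n^'n)"
    have detP: "det P = w $ i / \<rho> * det B'"
      unfolding P_def cramer_lemma by simp
    have Pi: "column i P = (h / (2 * \<rho>)) *\<^sub>R e"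
    proof -
      have "column i P = B' *v ((1 / \<rho>) *\<^sub>R w)" by (simp add: P_def column_def vec_eq_iff)
      then show ?thesis by (simp add: B' matrix_vector_mult_scaleR w_def B(2))
    qed
    have Pj: "column j P = (h / 2) *\<^sub>R (B *v axis j 1)" if "j \<noteq> i" for j
    proof -
      have "column j P = column j B'" using that by (simp add: P_def column_def vec_eq_iff)
      then show ?thesis by (simp add: B' flip: matrix_vector_mult_basis)
    qed
    have "\<bar>det P\<bar> / ?n ^ ?N \<le> Lam * measure lebesgue S"
    proof (rule subgradient_cube_upper[OF S(1,3) x0 fr h])
      fix j y assume y: "y \<in> closure S"
      show "column j P \<bullet> (y - x0) \<le> h / 2"
      proof (cases "j = i")
        case True
        have "h / (2 * \<rho>) * (e \<bullet> (y - x0)) \<le> h / (2 * \<rho>) * \<rho>"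
          using h \<rho>(2) clS[OF y] by (intro mult_left_mono) auto
        then show ?thesis using True \<rho>(2) by (simp add: Pi)
      next
        case False
        obtain c where c: "y = x0 + A *v c" "\<And>k. \<bar>c $ k\<bar> \<le> 1" using A(3) y by blast
        have "(B *v axis j 1) \<bullet> (A *v c) = c $ j"
          by (simp add: B(1) flip: dot_lmul_matrix) (simp add: inner_axis')
        then have "column j P \<bullet> (y - x0) = h / 2 * c $ j"
          by (simp add: Pj False c)
        also have "\<dots> \<le> h / 2 * 1" using h c(2)[of j] by (intro mult_left_mono) (auto simp: abs_le_iff)
        finally show ?thesis by simp
      qed
    qed
    then have "\<bar>det P\<bar> / ?n ^ ?N * \<bar>det A\<bar> \<le> Lam * measure lebesgue S * \<bar>det A\<bar>"
      by (rule mult_right_mono) simp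
    also have "\<bar>det P\<bar> / ?n ^ ?N * \<bar>det A\<bar> = \<bar>w $ i\<bar> / \<rho> * (h / 2) ^ ?N / ?n ^ ?N * \<bar>det B * det A\<bar>"
      using h \<rho>(2) by (simp add: detP detB' abs_mult)
    finally have "\<bar>w $ i\<bar> / \<rho> * (h / 2) ^ ?N / ?n ^ ?N \<le> Lam * (measure lebesgue S * \<bar>det A\<bar>)"
      using B(3) by (simp add: mult.assoc)
    also have "\<dots> \<le> Lam * (2 ^ ?N * (16 * ?n * h) ^ ?N / lam)"
      using subgradient_box_lower[OF S x0(1) A(1,2) h bd] lam lamLam
      by (intro mult_left_mono) (auto simp: field_simps)
    finally have "h ^ ?N * \<bar>w $ i\<bar> \<le> h ^ ?N * (\<rho> * (Lam / lam * 2 ^ ?N * (16 * ?n) ^ ?N * (2 * ?n) ^ ?N))"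
      using \<rho>(2) by (simp add: power_divide power_mult_distrib field_simps)
    then show ?thesis using zero_less_power[OF h, of ?N] by (simp only: mult_le_cancel_left_pos)
  qed
  obtain c where c: "y = x0 + A *v c" "\<And>k. \<bar>c $ k\<bar> \<le> 1" using A(3) y(1) closure_subset by blast
  have "R \<le> - (w \<bullet> c)"
    using y(2) c(1) by (simp add: w_def dot_lmul_matrix)
  also have "\<dots> = (\<Sum>i\<in>UNIV. - (w $ i * c $ i))" by (simp add: inner_vec_def sum_negf)
  also have "\<dots> \<le> (\<Sum>i\<in>(UNIV::'n set). \<rho> * (Lam / lam * 2 ^ ?N * (16 * ?n) ^ ?N * (2 * ?n) ^ ?N))"
  proof (rule sum_mono)
    fix i
    have "- (w $ i * c $ i) \<le> \<bar>w $ i\<bar> * \<bar>c $ i\<bar>" by (simp add: abs_mult[symmetric])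
    also have "\<dots> \<le> \<bar>w $ i\<bar> * 1" by (intro mult_left_mono c) simp
    finally show "- (w $ i * c $ i) \<le> \<rho> * (Lam / lam * 2 ^ ?N * (16 * ?n) ^ ?N * (2 * ?n) ^ ?N)"
      using wi[of i] by linarith
  qed
  finally show ?thesis by (simp add: aspect_const_def algebra_simps)
qed

end

section \<open>Strict convexity and differentiability\<close>

lemma LIMSEQ_inverse_dist:
  fixes z :: "nat \<Rightarrow> 'a::metric_space"
  assumes "\<And>k. dist (z k) x < 1 / Suc k"
  shows "z \<longlonglongrightarrow> x"
proof (rule tendsto_dist_iff[THEN iffD2], rule tendsto_sandwich[of "\<lambda>_. 0"])
  show "(\<lambda>k. 1 / real (Suc k)) \<longlonglongrightarrow> 0" by (rule LIMSEQ_Suc[OF lim_1_over_n])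
  show "\<forall>\<^sub>F k in sequentially. dist (z k) x \<le> 1 / real (Suc k)"
    using assms by (auto intro: less_imp_le always_eventually)
qed auto

section \<open>Sign of the solution and compactness of subgradients\<close>

context ma_bounds
begin

lemma cont_in: "continuous_on \<Omega> u"
  by (rule continuous_on_subset[OF cont closure_subset])

lemma u_closure_convex:
  assumes a: "a \<in> closure \<Omega>" and b: "b \<in> closure \<Omega>" and t: "0 \<le> t" "t \<le> 1"
  shows "u ((1 - t) *\<^sub>R a + t *\<^sub>R b) \<le> (1 - t) * u a + t * u b"
proof -
  obtain f where f: "\<And>n. f n \<in> \<Omega>" "f \<longlonglongrightarrow> a" using a[unfolded closure_sequential] by blast
  obtain g where g: "\<And>n. g n \<in> \<Omega>" "g \<longlonglongrightarrow> b" using b[unfolded closure_sequential] by blast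
  let ?c = "(1 - t) *\<^sub>R a + t *\<^sub>R b" and ?h = "\<lambda>n. (1 - t) *\<^sub>R f n + t *\<^sub>R g n"
  have lim: "?h \<longlonglongrightarrow> ?c" by (intro tendsto_intros f g)
  have h: "?h n \<in> \<Omega>" for n using cvx f(1) g(1) t by (simp add: convex_alt)
  have c: "?c \<in> closure \<Omega>" unfolding closure_sequential using h lim by (intro exI[of _ ?h] conjI allI)
  have in_cl: "w \<in> closure \<Omega>" if "w \<in> \<Omega>" for w using that closure_subset by blast
  show ?thesis
  proof (rule LIMSEQ_le)
    show "(\<lambda>n. u (?h n)) \<longlonglongrightarrow> u ?c"
      by (rule continuous_on_tendsto_compose[OF cont lim c]) (simp add: h in_cl)
    show "(\<lambda>n. (1 - t) * u (f n) + t * u (g n)) \<longlonglongrightarrow> (1 - t) * u a + t * u b"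
      by (intro tendsto_intros continuous_on_tendsto_compose[OF cont f(2) a] continuous_on_tendsto_compose[OF cont g(2) b])
        (simp_all add: f g in_cl)
    show "\<exists>N. \<forall>n\<ge>N. u (?h n) \<le> (1 - t) * u (f n) + t * u (g n)"
      using convex_onD[OF ucvx t f(1) g(1)] by blast
  qed
qed

lemma extend_beyond:
  assumes "x \<in> \<Omega>"
  shows "\<exists>s>0. x + s *\<^sub>R (x - w) \<in> \<Omega>"
proof -
  obtain e where e: "e > 0" "ball x e \<subseteq> \<Omega>" using op assms openE by blast
  define s where "s = e / (2 * (norm (x - w) + 1))"
  have N: "0 < 2 * (norm (x - w) + 1)" using norm_ge_zero[of "x - w"] by argo
  have s: "s > 0" using e N by (simp add: s_def)
  have "s * norm (x - w) < e"
  proof -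
    have "norm (x - w) < 2 * (norm (x - w) + 1)" using norm_ge_zero[of "x - w"] by argo
    then have "e * norm (x - w) < e * (2 * (norm (x - w) + 1))" using e by simp
    then show ?thesis using N by (simp only: s_def times_divide_eq_left pos_divide_less_eq)
  qed
  then have "x + s *\<^sub>R (x - w) \<in> ball x e" using s by (simp add: dist_norm)
  then show ?thesis using s e by blast
qed

lemma midpoint_ineq:
  assumes w: "w \<in> closure \<Omega>" and s: "s > 0" "x + s *\<^sub>R (x - w) \<in> \<Omega>"
  shows "(1 + s) * u x \<le> s * u w + u (x + s *\<^sub>R (x - w))"
proof -
  let ?z = "x + s *\<^sub>R (x - w)"
  define t where "t = 1 / (1 + s)"
  let ?t = t
  have ts: "t * (1 + s) = 1" "0 \<le> t" "t \<le> 1" "1 - t - t * s = 0" using s by (auto simp: t_def field_simps)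
  have "(1 - ?t) *\<^sub>R w + ?t *\<^sub>R ?z = x"
  proof -
    have "(1 - ?t) *\<^sub>R w + ?t *\<^sub>R ?z = (1 - ?t - ?t * s) *\<^sub>R w + (?t * (1 + s)) *\<^sub>R x"
      by (simp add: algebra_simps)
    then show ?thesis by (simp add: ts)
  qed
  then have "u x \<le> (1 - ?t) * u w + ?t * u ?z"
    using u_closure_convex[OF w, of ?z ?t] s closure_subset[of \<Omega>] ts by auto
  also have "1 - ?t = ?t * s" using ts by simp
  finally have "(1 + s) * u x \<le> (1 + s) * (?t * s * u w + ?t * u ?z)"
    using s by (intro mult_left_mono) auto
  also have "\<dots> = ((1 + s) * ?t) * (s * u w + u ?z)" by (simp add: algebra_simps)
  also have "(1 + s) * ?t = 1" using ts by (simp add: mult.commute)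
  finally show ?thesis by simp
qed

lemma frontier_iff: "y \<in> frontier \<Omega> \<longleftrightarrow> y \<in> closure \<Omega> \<and> y \<notin> \<Omega>"
  using op by (simp add: frontier_def interior_open)

text \<open>Maximum principle: at an interior maximum \<open>z\<close>, continue the segment from a
  boundary zero a little beyond \<open>z\<close>; convexity gives
  \<open>(1 + s) * u z \<le> u z\<close>.\<close>

lemma u_nonpos:
  assumes "x \<in> closure \<Omega>"
  shows "u x \<le> 0"
proof -
  have "compact (closure \<Omega>)" "closure \<Omega> \<noteq> {}" using bdd ne by auto
  then obtain z where z: "z \<in> closure \<Omega>" "\<And>y. y \<in> closure \<Omega> \<Longrightarrow> u y \<le> u z"
    using continuous_attains_sup[OF _ _ cont] by blast
  have "u z \<le> 0"
  proof (cases "z \<in> \<Omega>")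
    case True
    obtain w where w: "w \<in> frontier \<Omega>"
      using frontier_eq_empty[of \<Omega>] ne bdd not_bounded_UNIV by auto
    obtain s where s: "s > 0" "z + s *\<^sub>R (z - w) \<in> \<Omega>" using extend_beyond[OF True] by blast
    have "w \<in> closure \<Omega>" using w frontier_iff by blast
    from midpoint_ineq[OF this s] have "(1 + s) * u z \<le> u (z + s *\<^sub>R (z - w))"
      using bzero[OF w] by simp
    also have "\<dots> \<le> u z" using z(2) s(2) closure_subset by blast
    finally have "s * u z \<le> 0" by (simp add: algebra_simps)
    then show ?thesis using s(1) by (simp add: mult_le_0_iff)
  next
    case False
    then show ?thesis using z frontier_iff bzero by force
  qed
  then show ?thesis using z(2)[OF assms] by linarith
qed

lemma subgradient_norm_bound:
  assumes p: "p \<in> subdifferential \<Omega> u x" and r: "0 \<le> r" "cball x r \<subseteq> \<Omega>"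
  shows "norm p * r \<le> - u x"
proof (cases "p = 0")
  case True
  have "x \<in> \<Omega>" using r by (auto simp: subset_iff)
  then show ?thesis using True u_nonpos closure_subset by auto
next
  case False
  let ?y = "x + (r / norm p) *\<^sub>R p"
  have y: "?y \<in> \<Omega>" using r False by (auto simp: subset_iff dist_norm)
  then have "u x + p \<bullet> (?y - x) \<le> u ?y" using p by (auto simp: subdifferential_def)
  also have "u ?y \<le> 0" using u_nonpos y closure_subset by blast
  also have "p \<bullet> (?y - x) = norm p * r"
    using False by (simp add: dot_square_norm power2_eq_square)
  finally show ?thesis by simp
qed

lemma emeasure_open_pos:
  fixes S :: "'a::euclidean_space set"
  assumes "open S" "S \<noteq> {}"
  shows "0 < emeasure lborel S"
proof -
  have "\<not> negligible S" using assms open_not_negligible by blast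
  then show ?thesis
    using assms(1) by (simp add: negligible_iff_null_sets null_sets_completion_iff null_sets_def zero_less_iff_neq_zero)
qed

text \<open>An interior zero would by convexity force \<open>u = 0\<close> on
  \<open>\<Omega>\<close>. The only subgradient would then be 0, against the lower measure
  bound.\<close>

lemma u_neg:
  assumes "x \<in> \<Omega>"
  shows "u x < 0"
proof (rule ccontr)
  assume "\<not> u x < 0"
  moreover have xc: "x \<in> closure \<Omega>" using assms closure_subset by blast
  ultimately have ux: "u x = 0" using u_nonpos[OF xc] by simp
  have u0: "u y = 0" if y: "y \<in> \<Omega>" for y
  proof -
    obtain s where s: "s > 0" "x + s *\<^sub>R (x - y) \<in> \<Omega>" using extend_beyond[OF assms] by blast
    have yc: "y \<in> closure \<Omega>" using y closure_subset by blast
    have "u (x + s *\<^sub>R (x - y)) \<le> 0" using s(2) closure_subset u_nonpos by blast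
    with midpoint_ineq[OF yc s] have "0 \<le> s * u y" using ux by simp
    then have "0 \<le> u y" using s by (simp add: zero_le_mult_iff)
    then show ?thesis using u_nonpos[OF yc] by simp
  qed
  have "(\<Union>x\<in>\<Omega>. subdifferential \<Omega> u x) \<subseteq> {0}"
  proof
    fix p assume "p \<in> (\<Union>x\<in>\<Omega>. subdifferential \<Omega> u x)"
    then obtain z where z: "z \<in> \<Omega>" "p \<in> subdifferential \<Omega> u z" by blast
    obtain r where r: "r > 0" "cball z r \<subseteq> \<Omega>" using op z open_contains_cball by blast
    have "norm p * r \<le> 0" using subgradient_norm_bound[OF z(2) _ r(2)] r u0[OF z(1)] by simp
    then show "p \<in> {0}" using r(1) by (simp add: mult_le_0_iff)
  qed
  then have "monge_ampere \<Omega> u \<Omega> \<le> emeasure lebesgue {0::real^'n}"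
    unfolding monge_ampere_def by (intro emeasure_mono) auto
  also have "\<dots> = 0" by simp
  finally have "monge_ampere \<Omega> u \<Omega> = 0" by simp
  moreover have "0 < ennreal lam * emeasure lborel \<Omega>"
    using lam emeasure_open_pos[OF op ne] by (simp add: ennreal_zero_less_mult_iff)
  moreover have "ennreal lam * emeasure lborel \<Omega> \<le> monge_ampere \<Omega> u \<Omega>"
    by (rule ma_lower) (use op in auto)
  ultimately show False by (metis not_le)
qed

lemma u_bounded: "\<exists>M>0. \<forall>x\<in>closure \<Omega>. \<bar>u x\<bar> \<le> M"
proof -
  have "compact (u ` closure \<Omega>)" using bdd by (intro compact_continuous_image cont) simp
  then have "bounded (u ` closure \<Omega>)" by (rule compact_imp_bounded)
  then show ?thesis by (auto simp: bounded_pos)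
qed

text \<open>Subgradients stay bounded near an interior point by
  \<open>subgradient_norm_bound\<close>, and the supporting inequality passes to limits.\<close>

lemma subgradient_limit:
  assumes x: "x \<in> \<Omega>" and z: "z \<longlonglongrightarrow> x" "\<And>k. z k \<in> \<Omega>" and p: "\<And>k. p k \<in> subdifferential \<Omega> u (z k)"
  obtains q \<phi> where "strict_mono (\<phi> :: nat \<Rightarrow> nat)" "(p \<circ> \<phi>) \<longlonglongrightarrow> q" "q \<in> subdifferential \<Omega> u x"
proof -
  obtain r where r: "r > 0" "cball x r \<subseteq> \<Omega>" using op x open_contains_cball by blast
  obtain M where M: "M > 0" "\<And>x. x \<in> closure \<Omega> \<Longrightarrow> \<bar>u x\<bar> \<le> M" using u_bounded by blast
  obtain N where N: "\<And>k. k \<ge> N \<Longrightarrow> dist (z k) x < r / 2"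
    using z(1) r(1) unfolding lim_sequentially by (metis half_gt_zero)
  have "norm (p (k + N)) \<le> M / (r / 2)" for k
  proof -
    have "cball (z (k + N)) (r / 2) \<subseteq> cball x r"
      using N[of "k + N"] by (intro cball_subset_cball_iff[THEN iffD2]) (auto simp: dist_commute)
    then have "norm (p (k + N)) * (r / 2) \<le> - u (z (k + N))"
      using r by (intro subgradient_norm_bound p) auto
    also have "\<dots> \<le> M" using M(2)[of "z (k + N)"] z(2)[of "k + N"] closure_subset by (force simp: abs_le_iff)
    finally show ?thesis using r by (simp add: field_simps)
  qed
  then have "bounded (range (\<lambda>k. p (k + N)))" by (auto simp: bounded_iff)
  then obtain q \<psi> where q: "strict_mono (\<psi> :: nat \<Rightarrow> nat)" "((\<lambda>k. p (k + N)) \<circ> \<psi>) \<longlonglongrightarrow> q"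
    using bounded_imp_convergent_subsequence by blast
  define \<phi> where "\<phi> k = \<psi> k + N" for k
  have \<phi>: "strict_mono \<phi>" using q(1) by (simp add: \<phi>_def strict_mono_def)
  have lim: "(p \<circ> \<phi>) \<longlonglongrightarrow> q" using q(2) by (simp add: \<phi>_def o_def)
  have zl: "(z \<circ> \<phi>) \<longlonglongrightarrow> x" by (rule LIMSEQ_subseq_LIMSEQ[OF z(1) \<phi>])
  have "q \<in> subdifferential \<Omega> u x"
    unfolding subdifferential_def
  proof (intro CollectI ballI)
    fix y assume y: "y \<in> \<Omega>"
    show "u x + q \<bullet> (y - x) \<le> u y"
    proof (rule LIMSEQ_le_const2)
      have "(\<lambda>k. u ((z \<circ> \<phi>) k)) \<longlonglongrightarrow> u x"
        by (rule continuous_on_tendsto_compose[OF cont_in zl x]) (simp add: z)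
      then show "(\<lambda>k. u ((z \<circ> \<phi>) k) + (p \<circ> \<phi>) k \<bullet> (y - (z \<circ> \<phi>) k)) \<longlonglongrightarrow> u x + q \<bullet> (y - x)"
        by (intro tendsto_intros lim zl)
      show "\<exists>N. \<forall>k\<ge>N. u ((z \<circ> \<phi>) k) + (p \<circ> \<phi>) k \<bullet> (y - (z \<circ> \<phi>) k) \<le> u y"
        using p y by (auto simp: subdifferential_def)
    qed
  qed
  then show thesis using that \<phi> lim by blast
qed

text \<open>A ball free of subgradients would have Monge-Ampere measure 0, against the lower bound.
  Points with subgradients are therefore dense, and limits supply the rest.\<close>

lemma subgradient_exists:
  assumes x: "x \<in> \<Omega>"
  shows "\<exists>p. p \<in> subdifferential \<Omega> u x"
proof -
  have "\<exists>z p. dist z x < 1 / Suc k \<and> z \<in> \<Omega> \<and> p \<in> subdifferential \<Omega> u z" for k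
  proof (rule ccontr)
    assume H: "\<not> ?thesis"
    let ?E = "\<Omega> \<inter> ball x (1 / Suc k)"
    have "(\<Union>z\<in>?E. subdifferential \<Omega> u z) = {}" using H by (auto simp: dist_commute)
    then have "monge_ampere \<Omega> u ?E = 0" by (simp add: monge_ampere_def)
    moreover have "0 < ennreal lam * emeasure lborel ?E"
    proof -
      have "x \<in> ?E" using x by simp
      then have "open ?E" "?E \<noteq> {}" using op by (auto simp del: Int_iff)
      from emeasure_open_pos[OF this] show ?thesis using lam by (simp add: ennreal_zero_less_mult_iff)
    qed
    moreover have "ennreal lam * emeasure lborel ?E \<le> monge_ampere \<Omega> u ?E"
      by (rule ma_lower) (use op in auto)
    ultimately show False by (metis not_le)
  qed
  then obtain z p where zp: "\<And>k. dist (z k) x < 1 / Suc k" "\<And>k. z k \<in> \<Omega>" "\<And>k. p k \<in> subdifferential \<Omega> u (z k)"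
    by metis
  have "z \<longlonglongrightarrow> x"
    by (rule LIMSEQ_inverse_dist) (rule zp(1))
  from subgradient_limit[OF x this zp(2,3)] show ?thesis by blast
qed

lemma supporting_closure:
  assumes p: "p \<in> subdifferential \<Omega> u x" and y: "y \<in> closure \<Omega>"
  shows "u x + p \<bullet> (y - x) \<le> u y"
proof -
  have "continuous_on (closure \<Omega>) (\<lambda>y. u y - (u x + p \<bullet> (y - x)))"
    by (intro continuous_intros cont)
  from continuous_ge_on_closure[OF this y, of 0] have "0 \<le> u y - (u x + p \<bullet> (y - x))"
    using p by (auto simp: subdifferential_def)
  then show ?thesis by simp
qed

text \<open>A frontier point of a section with closure in \<open>\<Omega>\<close> belongs to
  \<open>\<Omega>\<close> but not to the open section, so \<open>u\<close> is at least the plane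
  there. This discharges the boundary condition of \<open>section_aspect\<close>.\<close>

lemma section_aspect_compact:
  assumes cl: "closure {x\<in>\<Omega>. u x < q \<bullet> x + a} \<subseteq> \<Omega>"
    and x0: "x0 \<in> \<Omega>" "u x0 = q \<bullet> x0 + a - h" and h: "0 < h"
    and bd: "\<And>x. x \<in> \<Omega> \<Longrightarrow> u x < q \<bullet> x + a \<Longrightarrow> q \<bullet> x + a - 2 * h \<le> u x \<and> e \<bullet> (x - x0) \<le> \<rho>"
    and \<rho>: "0 < \<rho>"
    and y: "y \<in> \<Omega>" "u y < q \<bullet> y + a" "R \<le> e \<bullet> (x0 - y)"
  shows "R \<le> aspect_const * \<rho>"
proof -
  let ?S = "{x\<in>\<Omega>. u x < q \<bullet> x + a}"
  have "continuous_on \<Omega> (\<lambda>x. q \<bullet> x + a - u x)" by (intro continuous_intros cont_in)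
  from continuous_open_preimage[OF this op, of "{0<..}"]
  have opS: "open ?S" by (simp add: vimage_def Int_def)
  have cS: "convex ?S"
  proof (rule convexI)
    fix x y and s t :: real assume xy: "x \<in> ?S" "y \<in> ?S" and st: "0 \<le> s" "0 \<le> t" "s + t = 1"
    have "s *\<^sub>R x + t *\<^sub>R y \<in> \<Omega>" using cvx xy st by (auto intro: convexD)
    moreover have "u (s *\<^sub>R x + t *\<^sub>R y) < q \<bullet> (s *\<^sub>R x + t *\<^sub>R y) + a"
    proof -
      have "u (s *\<^sub>R x + t *\<^sub>R y) \<le> s * u x + t * u y"
        using ucvx xy st by (auto simp: convex_on_def)
      also have "\<dots> < s * (q \<bullet> x + a) + t * (q \<bullet> y + a)"
      proof (cases "s = 0")
        case True then show ?thesis using st xy by simp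
      next
        case False
        then have "s * u x < s * (q \<bullet> x + a)" using st xy by simp
        moreover have "t * u y \<le> t * (q \<bullet> y + a)" using st xy by (intro mult_left_mono) auto
        ultimately show ?thesis by linarith
      qed
      also have "\<dots> = q \<bullet> (s *\<^sub>R x + t *\<^sub>R y) + (s + t) * a" by (simp add: inner_add_right algebra_simps)
      finally show ?thesis using st by simp
    qed
    ultimately show "s *\<^sub>R x + t *\<^sub>R y \<in> ?S" by simp
  qed
  show ?thesis
  proof (rule section_aspect[OF opS cS])
    show "q \<bullet> y + a \<le> u y" if "y \<in> frontier ?S" for y
    proof -
      have "y \<in> closure ?S" "y \<notin> ?S" using that opS by (auto simp: frontier_def interior_open)
      then show ?thesis using cl by auto
    qed
  qed (use x0 h bd \<rho> y in \<open>auto simp: less_imp_le\<close>)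
qed


text \<open>Otherwise the contact set has an extreme point inside \<open>\<Omega>\<close>. Cut off a cap around it by \<open>e \<bullet> x \<ge> s\<close> and
  tilt the supporting plane by \<open>\<epsilon> (e \<bullet> x - s)\<close>: as \<open>\<epsilon> \<rightarrow> 0\<close>, the highest point \<open>z1\<close> of the cap comes arbitrarily
  close to the upper supporting hyperplane of the section, contradicting \<open>section_aspect\<close>.\<close>

theorem strictly_convex:
  assumes x: "x \<in> \<Omega>" and p: "p \<in> subdifferential \<Omega> u x" and y0: "y0 \<in> closure \<Omega>" "y0 \<noteq> x"
  shows "u x + p \<bullet> (y0 - x) < u y0"
proof (rule ccontr)
  assume neg: "\<not> ?thesis"
  define a where "a = u x - p \<bullet> x"
  define v where "v y = u y - (p \<bullet> y + a)" for y
  have v0: "0 \<le> v y" if "y \<in> closure \<Omega>" for y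
    using supporting_closure[OF p that] by (simp add: v_def a_def inner_diff_right)
  define G where "G = {y \<in> closure \<Omega>. v y \<le> 0}"
  have clc: "compact (closure \<Omega>)" using bdd by simp
  have vcont: "continuous_on (closure \<Omega>) v" unfolding v_def by (intro continuous_intros cont)
  have Gclosed: "closed G"
    unfolding G_def by (rule continuous_on_closed_Collect_le[OF vcont]) auto
  have Gcomp: "compact G"
    using Gclosed clc by (auto simp: G_def intro: compact_Int_closed[of "closure \<Omega>" G, THEN back_subst[of compact]])
  have Gv: "v y = 0" if "y \<in> G" for y using that v0 by (force simp: G_def)
  have Gconv: "convex G"
  proof (rule convexI)
    fix y z and s t :: real assume yz: "y \<in> G" "z \<in> G" and st: "0 \<le> s" "0 \<le> t" "s + t = 1"
    have c: "y \<in> closure \<Omega>" "z \<in> closure \<Omega>" using yz by (auto simp: G_def)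
    have s: "s = 1 - t" using st by simp
    have "u (s *\<^sub>R y + t *\<^sub>R z) \<le> s * u y + t * u z"
      unfolding s by (rule u_closure_convex) (use c st in auto)
    also have "\<dots> = s * (p \<bullet> y + a) + t * (p \<bullet> z + a)"
      using Gv[OF yz(1)] Gv[OF yz(2)] by (simp add: v_def)
    also have "\<dots> = p \<bullet> (s *\<^sub>R y + t *\<^sub>R z) + (s + t) * a" by (simp add: inner_add_right algebra_simps)
    finally have "v (s *\<^sub>R y + t *\<^sub>R z) \<le> 0" using st by (simp add: v_def)
    moreover have "s *\<^sub>R y + t *\<^sub>R z \<in> closure \<Omega>"
      using convex_closure[OF cvx] c st by (auto intro: convexD)
    ultimately show "s *\<^sub>R y + t *\<^sub>R z \<in> G" by (simp add: G_def)
  qed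
  have xG: "x \<in> G" using x closure_subset by (auto simp: G_def v_def a_def)
  have yG: "y0 \<in> G" using neg y0 by (auto simp: G_def v_def a_def inner_diff_right)
  \<comment> \<open>If all extreme points lay on the frontier, where \<open>u = 0\<close>, the
    supporting plane would vanish on their hull \<open>G\<close>, and hence
    \<open>u x = 0\<close>.\<close>
  have "\<exists>z. z extreme_point_of G \<and> z \<in> \<Omega>"
  proof (rule ccontr)
    assume H: "\<nexists>z. z extreme_point_of G \<and> z \<in> \<Omega>"
    have "p \<bullet> z + a = 0" if z: "z extreme_point_of G" for z
    proof -
      have "z \<in> G" using z by (simp add: extreme_point_of_def)
      moreover have "z \<notin> \<Omega>" using H z by blast
      ultimately have "z \<in> frontier \<Omega>" by (simp add: G_def frontier_iff)
      then show ?thesis using bzero[of z] Gv[OF \<open>z \<in> G\<close>] by (simp add: v_def)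
    qed
    then have "convex hull {z. z extreme_point_of G} \<subseteq> {z. p \<bullet> z = - a}"
      by (intro hull_minimal convex_hyperplane) (auto simp: eq_neg_iff_add_eq_0)
    then have "p \<bullet> x = - a" using Krein_Milman_Minkowski[OF Gcomp Gconv] xG by blast
    then have "u x = 0" using Gv[OF xG] by (simp add: v_def)
    then show False using u_neg[OF x] by simp
  qed
  then obtain z where z: "z extreme_point_of G" "z \<in> \<Omega>" by blast
  have zG: "z \<in> G" using z(1) by (simp add: extreme_point_of_def)
  obtain w where w: "w \<in> G" "w \<noteq> z" using xG yG y0(2) by blast
  obtain r0 where r0: "r0 > 0" "cball z r0 \<subseteq> \<Omega>" using op z(2) open_contains_cball by blast
  define r where "r = min r0 (dist w z / 2)"
  have r: "r > 0" "cball z r \<subseteq> \<Omega>" "w \<notin> ball z r"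
    using r0 w(2) by (auto simp: r_def dist_commute subset_iff)
  \<comment> \<open>An extreme point lies outside the hull of the part of \<open>G\<close> away from
    it, so a separating hyperplane cuts off a cap of \<open>G\<close> inside
    \<open>ball z r\<close>.\<close>
  define T where "T = convex hull (G - ball z r)"
  have "compact T"
    unfolding T_def by (intro compact_convex_hull compact_diff Gcomp) simp
  then have Tcl: "closed T" by (rule compact_imp_closed)
  have "T \<subseteq> G - {z}"
    unfolding T_def using z(1) r(1) extreme_point_of_stillconvex[OF Gconv]
    by (intro hull_minimal) auto
  then have "z \<notin> T" by blast
  then obtain \<alpha> b where sep: "\<alpha> \<bullet> z < b" "\<And>x. x \<in> T \<Longrightarrow> \<alpha> \<bullet> x > b"
    using separating_hyperplane_closed_point[OF _ Tcl, of z] by (auto simp: T_def)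
  define e where "e = - \<alpha>"
  define s where "s = - b"
  have ez: "e \<bullet> z > s" using sep(1) by (simp add: e_def s_def)
  have out: "x \<in> ball z r" if "x \<in> G" "e \<bullet> x \<ge> s" for x
  proof (rule ccontr)
    assume "x \<notin> ball z r"
    then have "x \<in> T" using that unfolding T_def by (intro hull_inc) auto
    from sep(2)[OF this] that show False by (simp add: e_def s_def)
  qed
  have ew: "e \<bullet> w < s" using out[OF w(1)] r(3) by force
  have "continuous_on G (\<lambda>x. e \<bullet> x)" by (intro continuous_intros)
  then obtain z1 where z1: "z1 \<in> G" "\<And>x. x \<in> G \<Longrightarrow> e \<bullet> x \<le> e \<bullet> z1"
    using continuous_attains_sup[OF Gcomp] zG by blast
  define m where "m = e \<bullet> z1"
  define \<mu> where "\<mu> = m - s"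
  have \<mu>: "\<mu> > 0" using z1(2)[OF zG] ez by (simp add: \<mu>_def m_def)
  have z1b: "z1 \<in> ball z r" by (rule out[OF z1(1)]) (use \<mu> in \<open>simp add: \<mu>_def m_def\<close>)
  \<comment> \<open>Chosen so that \<open>y\<close> is a contact point at half the height
    \<open>\<mu>\<close> of the cap; it lies in the tilted section and supplies the long side
    \<open>\<mu> / 2\<close>.\<close>
  define t where "t = (s + \<mu> / 2 - e \<bullet> w) / (m - e \<bullet> w)"
  have mw: "m - e \<bullet> w > 0" using ew \<mu> by (simp add: \<mu>_def)
  have t: "0 \<le> t" "t \<le> 1" using ew \<mu> mw by (auto simp: t_def \<mu>_def field_simps)
  define y where "y = (1 - t) *\<^sub>R w + t *\<^sub>R z1"
  have "e \<bullet> y = e \<bullet> w + t * (m - e \<bullet> w)" by (simp add: y_def inner_add_right m_def algebra_simps)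
  then have ey: "e \<bullet> y = s + \<mu> / 2" using mw by (simp add: t_def)
  have yG': "y \<in> G" unfolding y_def using Gconv w(1) z1(1) t by (simp add: convex_alt)
  have yb: "y \<in> ball z r" by (rule out[OF yG']) (use ey \<mu> in simp)
  have inO: "x \<in> \<Omega>" if "x \<in> ball z r" for x using that r(2) by (auto simp: subset_iff)
  define \<rho> where "\<rho> = min \<mu> (\<mu> / (4 * aspect_const))"
  have \<rho>: "0 < \<rho>" "\<rho> \<le> \<mu>" using \<mu> aspect_const_pos by (auto simp: \<rho>_def)
  \<comment> \<open>On \<open>K\<close> the function \<open>v\<close> is bounded below by some
    \<open>c > 0\<close>. A tilt with \<open>\<epsilon> * D < c\<close> therefore keeps the section
    off \<open>K\<close>, that is, inside the ball and below level
    \<open>m + \<rho>\<close>.\<close>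
  define K where "K = {x \<in> closure \<Omega>. s \<le> e \<bullet> x \<and> (m + \<rho> \<le> e \<bullet> x \<or> r \<le> dist z x)}"
  have Kcomp: "compact K"
  proof -
    have "K = closure \<Omega> \<inter> ({x. s \<le> e \<bullet> x} \<inter> ({x. m + \<rho> \<le> e \<bullet> x} \<union> {x. r \<le> dist z x}))"
      by (auto simp: K_def)
    also have "compact \<dots>"
      by (intro compact_Int_closed clc closed_Int closed_Un closed_Collect_le continuous_intros)
    finally show ?thesis .
  qed
  have Kpos: "v x > 0" if "x \<in> K" for x
  proof (rule ccontr)
    assume "\<not> v x > 0"
    then have xG: "x \<in> G" using that by (auto simp: K_def G_def)
    have "dist z x < r" using out[OF xG] that by (auto simp: K_def)
    moreover have "e \<bullet> x < m + \<rho>" using z1(2)[OF xG] \<rho> by (simp add: m_def)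
    ultimately show False using that by (auto simp: K_def)
  qed
  obtain c where c: "c > 0" "\<And>x. x \<in> K \<Longrightarrow> c \<le> v x"
  proof (cases "K = {}")
    case True then show thesis using that[of 1] by simp
  next
    case False
    have "continuous_on K v" by (rule continuous_on_subset[OF vcont]) (auto simp: K_def)
    from continuous_attains_inf[OF Kcomp False this] obtain x where "x \<in> K" "\<forall>y\<in>K. v x \<le> v y" by blast
    then show thesis using that[of "v x"] Kpos by blast
  qed
  obtain D where D: "D > 0" "\<And>x. x \<in> closure \<Omega> \<Longrightarrow> \<bar>e \<bullet> x - s\<bar> \<le> D"
  proof -
    have "compact ((\<lambda>x. e \<bullet> x - s) ` closure \<Omega>)" by (intro compact_continuous_image clc continuous_intros)
    then have "bounded ((\<lambda>x. e \<bullet> x - s) ` closure \<Omega>)" by (rule compact_imp_bounded)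
    then show thesis using that by (auto simp: bounded_pos)
  qed
  define \<epsilon> where "\<epsilon> = c / (2 * D)"
  have \<epsilon>: "\<epsilon> > 0" "\<epsilon> * D < c" using c D(1) by (auto simp: \<epsilon>_def)
  define q where "q = p + \<epsilon> *\<^sub>R e"
  define a' where "a' = a - \<epsilon> * s"
  have sec: "u x < q \<bullet> x + a' \<longleftrightarrow> v x < \<epsilon> * (e \<bullet> x - s)" for x
    by (auto simp: v_def q_def a'_def inner_add_left algebra_simps)
  have S: "s < e \<bullet> x \<and> e \<bullet> x < m + \<rho> \<and> x \<in> ball z r" if x: "x \<in> \<Omega>" "u x < q \<bullet> x + a'" for x
  proof -
    have xc: "x \<in> closure \<Omega>" using x closure_subset by blast
    have vx: "v x < \<epsilon> * (e \<bullet> x - s)" using x sec by simp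
    then have "0 < \<epsilon> * (e \<bullet> x - s)" using v0[OF xc] by linarith
    then have 1: "s < e \<bullet> x" using \<epsilon> by (simp add: zero_less_mult_iff)
    have "\<epsilon> * (e \<bullet> x - s) \<le> \<epsilon> * D" using \<epsilon> D(2)[OF xc] by (intro mult_left_mono) auto
    then have "v x < c" using vx \<epsilon> by linarith
    then have "x \<notin> K" using c(2) by force
    then show ?thesis using 1 xc by (auto simp: K_def)
  qed
  have "\<mu> / 2 \<le> aspect_const * \<rho>"
  proof (rule section_aspect_compact[of q a' z1 "\<epsilon> * \<mu>" e])
    have "{x \<in> \<Omega>. u x < q \<bullet> x + a'} \<subseteq> cball z r" using S by (auto simp: less_imp_le)
    then have "closure {x \<in> \<Omega>. u x < q \<bullet> x + a'} \<subseteq> cball z r" by (intro closure_minimal) auto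
    then show "closure {x \<in> \<Omega>. u x < q \<bullet> x + a'} \<subseteq> \<Omega>" using r(2) by blast
    show "z1 \<in> \<Omega>" using inO z1b by blast
    show "u z1 = q \<bullet> z1 + a' - \<epsilon> * \<mu>"
      using Gv[OF z1(1)] by (simp add: v_def q_def a'_def \<mu>_def m_def inner_add_left algebra_simps)
    show "0 < \<epsilon> * \<mu>" using \<epsilon> \<mu> by simp
    show "0 < \<rho>" by (rule \<rho>)
    show "y \<in> \<Omega>" using inO yb by blast
    show "u y < q \<bullet> y + a'" unfolding sec using Gv[OF yG'] ey \<epsilon> \<mu> by simp
    show "\<mu> / 2 \<le> e \<bullet> (z1 - y)" using ey by (simp add: inner_diff_right m_def[symmetric]) (simp add: \<mu>_def)
    fix x assume x: "x \<in> \<Omega>" "u x < q \<bullet> x + a'"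
    have "\<epsilon> * (e \<bullet> x - s) \<le> \<epsilon> * (2 * \<mu>)"
      using S[OF x] \<rho>(2) \<epsilon> by (intro mult_left_mono) (auto simp: \<mu>_def)
    moreover have "0 \<le> v x" using v0 x(1) closure_subset by blast
    ultimately have "q \<bullet> x + a' - 2 * (\<epsilon> * \<mu>) \<le> u x"
      by (simp add: v_def q_def a'_def inner_add_left algebra_simps)
    moreover have "e \<bullet> (x - z1) \<le> \<rho>" using S[OF x] by (simp add: inner_diff_right m_def)
    ultimately show "q \<bullet> x + a' - 2 * (\<epsilon> * \<mu>) \<le> u x \<and> e \<bullet> (x - z1) \<le> \<rho>" by blast
  qed
  also have "aspect_const * \<rho> \<le> aspect_const * (\<mu> / (4 * aspect_const))"
    using aspect_const_pos by (intro mult_left_mono) (auto simp: \<rho>_def)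
  also have "\<dots> = \<mu> / 4" using aspect_const_pos by simp
  finally show False using \<mu> by simp
qed


text \<open>At a corner, tilting a minimal supporting plane towards the other slopes by \<open>\<tau>\<close> gives sections whose extent
  beyond \<open>x\<close> is \<open>O(\<tau>)\<close> relative to their extent before \<open>x\<close>, contradicting \<open>section_aspect\<close> for small \<open>\<tau>\<close>.\<close>

theorem subgradient_unique:
  assumes x: "x \<in> \<Omega>" and p1: "p1 \<in> subdifferential \<Omega> u x" and p2: "p2 \<in> subdifferential \<Omega> u x"
  shows "p1 = p2"
proof (rule ccontr)
  assume "p1 \<noteq> p2"
  define e where "e = p1 - p2"
  have e0: "norm e > 0" using \<open>p1 \<noteq> p2\<close> by (simp add: e_def)
  obtain r where r: "r > 0" "cball x r \<subseteq> \<Omega>" using op x open_contains_cball by blast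
  \<comment> \<open>Approach \<open>x\<close> against \<open>e\<close>. A limit \<open>P\<close> of
    subgradients at the \<open>z k\<close> has slope at most \<open>p2 \<bullet> e\<close> in
    direction \<open>e\<close>, and along the subsequence \<open>u\<close> exceeds the plane of
    \<open>P\<close> at \<open>z k\<close> only by \<open>o(t k)\<close>.\<close>
  define t where "t k = r / (norm e * real (Suc k))" for k
  define z where "z k = x - t k *\<^sub>R e" for k
  have tpos: "t k > 0" for k using r e0 by (simp add: t_def)
  have t0: "t \<longlonglongrightarrow> 0"
  proof -
    have "(\<lambda>k. r / norm e * (1 / real (Suc k))) \<longlonglongrightarrow> r / norm e * 0"
      by (intro tendsto_intros LIMSEQ_Suc[OF lim_1_over_n])
    then show ?thesis by (simp add: t_def[abs_def])
  qed
  have zO: "z k \<in> \<Omega>" for k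
  proof -
    have "norm (t k *\<^sub>R e) = r / real (Suc k)" using e0 r by (simp add: t_def)
    also have "\<dots> \<le> r" using r by (simp add: field_simps)
    finally have "z k \<in> cball x r" by (simp add: z_def dist_norm)
    then show ?thesis using r by blast
  qed
  have zx: "z \<longlonglongrightarrow> x"
  proof -
    have "(\<lambda>k. x - t k *\<^sub>R e) \<longlonglongrightarrow> x - 0 *\<^sub>R e" by (intro tendsto_intros t0)
    then show ?thesis by (simp add: z_def[abs_def])
  qed
  obtain p where p: "\<And>k. p k \<in> subdifferential \<Omega> u (z k)" using subgradient_exists[OF zO] by metis
  obtain P \<phi> where P: "strict_mono (\<phi> :: nat \<Rightarrow> nat)" "(p \<circ> \<phi>) \<longlonglongrightarrow> P" "P \<in> subdifferential \<Omega> u x"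
    using subgradient_limit[OF x zx zO p] by metis
  have "p k \<bullet> e \<le> p2 \<bullet> e" for k
  proof -
    have "u (z k) + p k \<bullet> (x - z k) \<le> u x" using p x by (auto simp: subdifferential_def)
    moreover have "u x + p2 \<bullet> (z k - x) \<le> u (z k)" using p2 zO by (auto simp: subdifferential_def)
    ultimately have "t k * (p k \<bullet> e) \<le> t k * (p2 \<bullet> e)" by (simp add: z_def)
    then show ?thesis using tpos[of k] by simp
  qed
  then have "P \<bullet> e \<le> p2 \<bullet> e"
    by (intro LIMSEQ_le_const2[of "\<lambda>k. (p \<circ> \<phi>) k \<bullet> e"] tendsto_intros P(2)) auto
  define d where "d = p1 - P"
  define b where "b = d \<bullet> e"
  have b: "b > 0"
  proof -
    have "e \<bullet> e > 0" using e0 by simp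
    then have "p1 \<bullet> e > p2 \<bullet> e" by (simp add: e_def inner_diff_left)
    then show ?thesis using \<open>P \<bullet> e \<le> p2 \<bullet> e\<close> by (simp add: b_def d_def inner_diff_left)
  qed
  define a where "a = u x - P \<bullet> x"
  define v where "v y = u y - (P \<bullet> y + a)" for y
  have vcont: "continuous_on (closure \<Omega>) v" unfolding v_def by (intro continuous_intros cont)
  have v0: "0 \<le> v y" if "y \<in> closure \<Omega>" for y
    using supporting_closure[OF P(3) that] by (simp add: v_def a_def inner_diff_right)
  have vd: "d \<bullet> (y - x) \<le> v y" if "y \<in> closure \<Omega>" for y
    using supporting_closure[OF p1 that] by (simp add: v_def a_def d_def inner_diff_right inner_diff_left)
  have vx: "v x = 0" by (simp add: v_def a_def)
  \<comment> \<open>The factor 8 yields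
    \<open>aspect_const * (2 * \<tau> * \<sigma>) \<le> \<sigma> / 4\<close>, below the long side
    \<open>\<sigma> / 2\<close>.\<close>
  define \<tau> where "\<tau> = min (1/2) (1 / (8 * aspect_const))"
  have \<tau>: "0 < \<tau>" "\<tau> \<le> 1/2" using aspect_const_pos by (auto simp: \<tau>_def)
  define K where "K = closure \<Omega> - ball x r"
  have Kcomp: "compact K" unfolding K_def using bdd by (intro compact_diff) auto
  obtain c where c: "c > 0" "\<And>y. y \<in> K \<Longrightarrow> c \<le> v y"
  proof (cases "K = {}")
    case True then show thesis using that[of 1] by simp
  next
    case False
    have "continuous_on K v" by (rule continuous_on_subset[OF vcont]) (auto simp: K_def)
    from continuous_attains_inf[OF Kcomp False this] obtain w where w: "w \<in> K" "\<forall>y\<in>K. v w \<le> v y" by blast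
    have "w \<noteq> x" "w \<in> closure \<Omega>" using w(1) r(1) by (auto simp: K_def)
    then have "v w > 0" using strictly_convex[OF x P(3)] by (force simp: v_def a_def inner_diff_right)
    then show thesis using that[of "v w"] w by blast
  qed
  have tphi: "(t \<circ> \<phi>) \<longlonglongrightarrow> 0" by (rule LIMSEQ_subseq_LIMSEQ[OF t0 P(1)])
  have ev1: "\<forall>\<^sub>F k in sequentially. (t \<circ> \<phi>) k < c / (2 * b)"
    using order_tendstoD(2)[OF tphi, of "c / (2 * b)"] c b by simp
  have "(\<lambda>k. norm (P - (p \<circ> \<phi>) k)) \<longlonglongrightarrow> norm (P - P)" by (intro tendsto_intros P(2))
  then have ev2: "\<forall>\<^sub>F k in sequentially. norm (P - (p \<circ> \<phi>) k) < \<tau> * b / norm e"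
    using order_tendstoD(2)[of _ "norm (P - P)" _ "\<tau> * b / norm e"] \<tau> b e0 by simp
  obtain k0 where "(t \<circ> \<phi>) k0 < c / (2 * b)" "norm (P - (p \<circ> \<phi>) k0) < \<tau> * b / norm e"
    using eventually_happens[OF eventually_conj[OF ev1 ev2]] by auto
  then obtain k where k: "t k < c / (2 * b)" "norm (P - p k) < \<tau> * b / norm e" by auto
  \<comment> \<open>Twice the drop of \<open>d\<close> from \<open>x\<close> to \<open>z k\<close>,
    so that at \<open>z k\<close> the tilted plane still exceeds that of \<open>P\<close> by
    \<open>\<tau> * t k * b\<close>, which is more than \<open>v (z k)\<close>.\<close>
  define \<sigma> where "\<sigma> = 2 * t k * b"
  have \<sigma>: "\<sigma> > 0" "\<sigma> < c" using tpos[of k] b k(1) by (auto simp: \<sigma>_def field_simps)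
  have vz: "v (z k) < \<tau> * t k * b"
  proof -
    have "u (z k) + p k \<bullet> (x - z k) \<le> u x" using p x by (auto simp: subdifferential_def)
    then have "v (z k) \<le> t k * ((P - p k) \<bullet> e)"
      by (simp add: v_def a_def z_def inner_diff_left inner_diff_right algebra_simps)
    also have "\<dots> \<le> t k * (norm (P - p k) * norm e)"
      using tpos[of k] by (intro mult_left_mono norm_cauchy_schwarz) auto
    also have "\<dots> < t k * (\<tau> * b)"
      using k(2) e0 tpos[of k] by (intro mult_strict_left_mono) (simp_all add: field_simps)
    finally show ?thesis by (simp add: mult_ac)
  qed
  define q where "q = P + \<tau> *\<^sub>R d"
  define a' where "a' = a + \<tau> * (\<sigma> - d \<bullet> x)"
  have sec: "u y < q \<bullet> y + a' \<longleftrightarrow> v y < \<tau> * (d \<bullet> (y - x) + \<sigma>)" for y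
    by (auto simp: v_def q_def a'_def inner_add_left inner_diff_right algebra_simps)
  have S: "d \<bullet> (y - x) \<le> 2 * \<tau> * \<sigma> \<and> y \<in> ball x r" if y: "y \<in> \<Omega>" "u y < q \<bullet> y + a'" for y
  proof -
    have yc: "y \<in> closure \<Omega>" using y closure_subset by blast
    let ?D = "d \<bullet> (y - x)"
    have 1: "v y < \<tau> * (?D + \<sigma>)" using y sec by simp
    have "?D * (1 - \<tau>) < \<tau> * \<sigma>" using 1 vd[OF yc] by (simp add: algebra_simps)
    have D2: "?D \<le> 2 * \<tau> * \<sigma>"
    proof (cases "?D \<le> 0")
      case True then show ?thesis using \<tau> \<sigma> by (meson less_imp_le mult_pos_pos order_trans zero_less_numeral)
    next
      case False
      then have "?D * (1/2) \<le> ?D * (1 - \<tau>)" using \<tau> by (intro mult_left_mono) auto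
      then show ?thesis using \<open>?D * (1 - \<tau>) < \<tau> * \<sigma>\<close> by simp
    qed
    have "2 * \<tau> * \<sigma> \<le> 1 * \<sigma>" using \<tau> \<sigma> by (intro mult_right_mono) auto
    moreover have "\<tau> * (?D + \<sigma>) \<le> \<tau> * (2 * \<sigma>)"
      using D2 calculation \<tau> by (intro mult_left_mono) auto
    moreover have "\<tau> * (2 * \<sigma>) \<le> (1/2) * (2 * \<sigma>)" using \<tau> \<sigma> by (intro mult_right_mono) auto
    ultimately have "v y < c" using 1 \<sigma> by argo
    then have "y \<notin> K" using c(2) by force
    then show ?thesis using D2 yc by (simp add: K_def)
  qed
  have "\<sigma> / 2 \<le> aspect_const * (2 * \<tau> * \<sigma>)"
  proof (rule section_aspect_compact[of q a' x "\<tau> * \<sigma>" d])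
    have "{y \<in> \<Omega>. u y < q \<bullet> y + a'} \<subseteq> cball x r" using S by (auto simp: less_imp_le)
    then have "closure {y \<in> \<Omega>. u y < q \<bullet> y + a'} \<subseteq> cball x r" by (intro closure_minimal) auto
    then show "closure {y \<in> \<Omega>. u y < q \<bullet> y + a'} \<subseteq> \<Omega>" using r(2) by blast
    show "x \<in> \<Omega>" by (rule x)
    show "u x = q \<bullet> x + a' - \<tau> * \<sigma>"
      by (simp add: q_def a'_def a_def inner_add_left algebra_simps)
    show "0 < \<tau> * \<sigma>" "0 < 2 * \<tau> * \<sigma>" using \<tau> \<sigma> by auto
    show "z k \<in> \<Omega>" by (rule zO)
    have dz: "d \<bullet> (z k - x) = - (\<sigma> / 2)" by (simp add: z_def \<sigma>_def b_def)
    then show "\<sigma> / 2 \<le> d \<bullet> (x - z k)" by (simp add: inner_diff_right)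
    show "u (z k) < q \<bullet> z k + a'" unfolding sec dz using vz by (simp add: \<sigma>_def mult_ac)
    fix y assume y: "y \<in> \<Omega>" "u y < q \<bullet> y + a'"
    have "2 * \<tau> * \<sigma> \<le> 1 * \<sigma>" using \<tau> \<sigma> by (intro mult_right_mono) auto
    then have "\<tau> * (d \<bullet> (y - x) + \<sigma>) \<le> \<tau> * (2 * \<sigma>)"
      using S[OF y] \<tau> by (intro mult_left_mono) auto
    moreover have "0 \<le> v y" using v0 y(1) closure_subset by blast
    ultimately have "q \<bullet> y + a' - 2 * (\<tau> * \<sigma>) \<le> u y"
      by (simp add: v_def q_def a'_def inner_add_left inner_diff_right algebra_simps)
    then show "q \<bullet> y + a' - 2 * (\<tau> * \<sigma>) \<le> u y \<and> d \<bullet> (y - x) \<le> 2 * \<tau> * \<sigma>" using S[OF y] by blast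
  qed
  also have "\<dots> = (aspect_const * \<tau>) * (2 * \<sigma>)" by simp
  also have "\<dots> \<le> (1 / 8) * (2 * \<sigma>)"
  proof (rule mult_right_mono)
    have "aspect_const * \<tau> \<le> aspect_const * (1 / (8 * aspect_const))"
      using aspect_const_pos by (intro mult_left_mono) (auto simp: \<tau>_def)
    then show "aspect_const * \<tau> \<le> 1 / 8" using aspect_const_pos by simp
  qed (use \<sigma> in simp)
  finally show False using \<sigma> by simp
qed

section \<open>The gradient map\<close>

definition grad :: "real^'n \<Rightarrow> real^'n" where
  "grad x = (SOME p. p \<in> subdifferential \<Omega> u x)"

lemma grad: "x \<in> \<Omega> \<Longrightarrow> grad x \<in> subdifferential \<Omega> u x"
  unfolding grad_def by (rule someI_ex[OF subgradient_exists])

lemma grad_unique: "x \<in> \<Omega> \<Longrightarrow> p \<in> subdifferential \<Omega> u x \<Longrightarrow> p = grad x"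
  using grad subgradient_unique by blast

lemma grad_supports: "x \<in> \<Omega> \<Longrightarrow> y \<in> \<Omega> \<Longrightarrow> u x + grad x \<bullet> (y - x) \<le> u y"
  using grad[of x] by (auto simp: subdifferential_def)

lemma grad_mono: "x \<in> \<Omega> \<Longrightarrow> y \<in> \<Omega> \<Longrightarrow> 0 \<le> (grad y - grad x) \<bullet> (y - x)"
  using grad_supports[of x y] grad_supports[of y x] by (simp add: inner_diff_left inner_diff_right)

text \<open>A sequence violating continuity would have a limiting subgradient at \<open>x\<close>
  different from \<open>grad x\<close>, against uniqueness.\<close>

lemma grad_cont: "continuous_on \<Omega> grad"
  unfolding continuous_on_iff
proof (intro ballI allI impI)
  fix x and \<epsilon> :: real assume x: "x \<in> \<Omega>" and \<epsilon>: "0 < \<epsilon>"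
  show "\<exists>d>0. \<forall>y\<in>\<Omega>. dist y x < d \<longrightarrow> dist (grad y) (grad x) < \<epsilon>"
  proof (rule ccontr)
    assume H: "\<not> ?thesis"
    have "\<exists>y. y \<in> \<Omega> \<and> dist y x < 1 / Suc k \<and> \<epsilon> \<le> dist (grad y) (grad x)" for k
    proof -
      have "0 < 1 / real (Suc k)" by simp
      then show ?thesis using H by (metis not_le)
    qed
    then obtain z where z: "\<And>k. z k \<in> \<Omega>" "\<And>k. dist (z k) x < 1 / Suc k" "\<And>k. \<epsilon> \<le> dist (grad (z k)) (grad x)"
      by metis
    have zx: "z \<longlonglongrightarrow> x" by (rule LIMSEQ_inverse_dist) (rule z(2))
    obtain q \<phi> where q: "strict_mono (\<phi> :: nat \<Rightarrow> nat)" "((\<lambda>k. grad (z k)) \<circ> \<phi>) \<longlonglongrightarrow> q" "q \<in> subdifferential \<Omega> u x"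
      using subgradient_limit[OF x zx z(1), of "\<lambda>k. grad (z k)"] grad[OF z(1)] by metis
    have "q = grad x" by (rule grad_unique[OF x q(3)])
    then obtain k where "dist (((\<lambda>k. grad (z k)) \<circ> \<phi>) k) (grad x) < \<epsilon>"
      using metric_LIMSEQ_D[OF q(2) \<epsilon>] by blast
    then show False using z(3)[of "\<phi> k"] by simp
  qed
qed

text \<open>The increment \<open>u y - u x\<close> lies between \<open>grad x\<close> and
  \<open>grad y\<close> applied to \<open>y - x\<close>, and \<open>grad\<close> is
  continuous.\<close>

theorem u_has_derivative:
  assumes x: "x \<in> \<Omega>"
  shows "(u has_derivative (\<lambda>h. grad x \<bullet> h)) (at x)"
  unfolding has_derivative_at_alt
proof (intro conjI allI impI)
  fix e :: real assume e: "e > 0"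
  obtain d1 where d1: "d1 > 0" "\<And>y. y \<in> \<Omega> \<Longrightarrow> dist y x < d1 \<Longrightarrow> dist (grad y) (grad x) < e"
    using grad_cont x e unfolding continuous_on_iff by blast
  obtain d2 where d2: "d2 > 0" "ball x d2 \<subseteq> \<Omega>" using op x openE by blast
  show "\<exists>d>0. \<forall>y. norm (y - x) < d \<longrightarrow> norm (u y - u x - grad x \<bullet> (y - x)) \<le> e * norm (y - x)"
  proof (intro exI[of _ "min d1 d2"] conjI allI impI)
    fix y assume y: "norm (y - x) < min d1 d2"
    then have "y \<in> ball x d2" by (simp add: dist_norm norm_minus_commute)
    then have yO: "y \<in> \<Omega>" using d2 by blast
    have "norm (grad y - grad x) < e" using d1(2)[OF yO] y by (simp add: dist_norm)
    then have "(grad y - grad x) \<bullet> (y - x) \<le> e * norm (y - x)"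
      using norm_cauchy_schwarz[of "grad y - grad x" "y - x"]
      by (meson less_imp_le mult_right_mono norm_ge_zero order_trans)
    then show "norm (u y - u x - grad x \<bullet> (y - x)) \<le> e * norm (y - x)"
      using grad_supports[OF x yO] grad_supports[OF yO x]
      by (simp add: inner_diff_left inner_diff_right)
  qed (use d1 d2 in auto)
qed (rule bounded_linear_inner_right)

end

section \<open>Second derivatives almost everywhere\<close>

lemma directional_limit:
  fixes f :: "'a::real_normed_vector \<Rightarrow> 'b::real_normed_vector"
  assumes f: "(f has_derivative f') (at x)"
  shows "((\<lambda>t. (f (x + t *\<^sub>R e) - f x) /\<^sub>R t) \<longlongrightarrow> f' e) (at 0)"
  unfolding LIM_def
proof (intro allI impI)
  fix \<epsilon> :: real assume \<epsilon>: "\<epsilon> > 0"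
  have lin: "linear f'" using f by (rule has_derivative_linear)
  define N where "N = norm e + 1"
  have N: "N > 0" "norm e < N" by (auto simp: N_def add_nonneg_pos)
  obtain d where d: "d > 0" "\<And>y. norm (y - x) < d \<Longrightarrow> norm (f y - f x - f' (y - x)) \<le> \<epsilon> / N * norm (y - x)"
    using f \<epsilon> N unfolding has_derivative_at_alt by (metis divide_pos_pos)
  show "\<exists>s>0. \<forall>t. t \<noteq> 0 \<and> dist t 0 < s \<longrightarrow> dist ((f (x + t *\<^sub>R e) - f x) /\<^sub>R t) (f' e) < \<epsilon>"
  proof (intro exI[of _ "d / N"] conjI allI impI)
    fix t :: real assume t: "t \<noteq> 0 \<and> dist t 0 < d / N"
    then have "\<bar>t\<bar> * N < d" using N by (simp add: field_simps)
    moreover have "\<bar>t\<bar> * norm e \<le> \<bar>t\<bar> * N" using N by (intro mult_left_mono) auto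
    ultimately have "norm (x + t *\<^sub>R e - x) < d" by simp
    from d(2)[OF this] have b: "norm (f (x + t *\<^sub>R e) - f x - t *\<^sub>R f' e) \<le> \<epsilon> / N * (\<bar>t\<bar> * norm e)"
      using lin by (simp add: linear_scale)
    have "(f (x + t *\<^sub>R e) - f x) /\<^sub>R t - f' e = (f (x + t *\<^sub>R e) - f x - t *\<^sub>R f' e) /\<^sub>R t"
      using t by (simp add: scaleR_diff_right)
    then have "dist ((f (x + t *\<^sub>R e) - f x) /\<^sub>R t) (f' e) = norm (f (x + t *\<^sub>R e) - f x - t *\<^sub>R f' e) / \<bar>t\<bar>"
      by (simp add: dist_norm divide_inverse mult.commute)
    also have "\<dots> \<le> \<epsilon> / N * norm e"
      using b t by (simp add: divide_le_eq mult_ac)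
    also have "\<dots> < \<epsilon> / N * N" using \<epsilon> N by (intro mult_strict_left_mono) auto
    also have "\<dots> = \<epsilon>" using N by simp
    finally show "dist ((f (x + t *\<^sub>R e) - f x) /\<^sub>R t) (f' e) < \<epsilon>" .
  qed (use d N in simp)
qed

section \<open>The resolvent of the subdifferential and differentiability of the gradient\<close>

context ma_bounds
begin

text \<open>The proximal map of \<open>u\<close>. Minimising over the compact closure defines it on
  the whole space, where Rademacher's theorem applies to its components.\<close>

definition resolvent :: "real^'n \<Rightarrow> real^'n" where
  "resolvent y = (SOME x. x \<in> closure \<Omega> \<and> (\<forall>z\<in>closure \<Omega>. u x + (norm (x - y))\<^sup>2 / 2 \<le> u z + (norm (z - y))\<^sup>2 / 2))"

lemma resolvent:
  "resolvent y \<in> closure \<Omega>"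
  "z \<in> closure \<Omega> \<Longrightarrow> u (resolvent y) + (norm (resolvent y - y))\<^sup>2 / 2 \<le> u z + (norm (z - y))\<^sup>2 / 2"
proof -
  have c: "compact (closure \<Omega>)" "closure \<Omega> \<noteq> {}" using bdd ne by auto
  have "continuous_on (closure \<Omega>) (\<lambda>x. u x + (norm (x - y))\<^sup>2 / 2)"
    by (intro continuous_intros cont) auto
  from continuous_attains_inf[OF c this]
  have "\<exists>x. x \<in> closure \<Omega> \<and> (\<forall>z\<in>closure \<Omega>. u x + (norm (x - y))\<^sup>2 / 2 \<le> u z + (norm (z - y))\<^sup>2 / 2)"
    by blast
  from someI_ex[OF this]
  show "resolvent y \<in> closure \<Omega>"
    "z \<in> closure \<Omega> \<Longrightarrow> u (resolvent y) + (norm (resolvent y - y))\<^sup>2 / 2 \<le> u z + (norm (z - y))\<^sup>2 / 2"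
    unfolding resolvent_def by blast+
qed

text \<open>First-order condition at the minimum: compare with a point on the segment towards
  \<open>z\<close>, use convexity of \<open>u\<close>, divide by \<open>t\<close> and let
  \<open>t\<close> tend to 0.\<close>

lemma resolvent_variational:
  assumes z: "z \<in> closure \<Omega>"
  shows "(y - resolvent y) \<bullet> (z - resolvent y) \<le> u z - u (resolvent y)"
proof -
  let ?x = "resolvent y"
  let ?d = "u z - u ?x + (?x - y) \<bullet> (z - ?x)" and ?N = "(norm (z - ?x))\<^sup>2 / 2"
  have key: "0 \<le> ?d + t * ?N" if t: "0 < t" "t \<le> 1" for t
  proof -
    let ?w = "(1 - t) *\<^sub>R ?x + t *\<^sub>R z"
    have w: "?w \<in> closure \<Omega>" using convex_closure[OF cvx] resolvent(1) z t by (auto simp: convex_alt)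
    have "u ?w \<le> (1 - t) * u ?x + t * u z" by (rule u_closure_convex) (use resolvent(1) z t in auto)
    moreover have "(norm (?w - y))\<^sup>2 = (norm (?x - y))\<^sup>2 + 2 * t * ((?x - y) \<bullet> (z - ?x)) + t\<^sup>2 * (norm (z - ?x))\<^sup>2"
    proof -
      have "?w - y = (?x - y) + t *\<^sub>R (z - ?x)" by (simp add: algebra_simps)
      then show ?thesis
        by (simp only: power2_norm_eq_inner inner_add_left inner_add_right inner_scaleR_left inner_scaleR_right)
          (simp add: inner_commute power2_eq_square algebra_simps)
    qed
    ultimately have "0 \<le> t * (?d + t * ?N)"
      using resolvent(2)[OF w, of y] by (simp add: algebra_simps power2_eq_square)
    then show ?thesis using t by (simp add: zero_le_mult_iff)
  qed
  have "((\<lambda>t. ?d + t * ?N) \<longlongrightarrow> ?d + 0 * ?N) (at_right 0)"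
    by (intro tendsto_intros)
  moreover have "\<forall>\<^sub>F t in at_right 0. 0 \<le> ?d + t * ?N"
    using key eventually_at_right_less[of "0::real"] eventually_at_right[of 0 "1::real" "\<lambda>t. t < 1"]
    by (auto simp: eventually_at_right_field intro!: exI[of _ 1])
  ultimately have "0 \<le> ?d + 0 * ?N"
    by (intro tendsto_lowerbound[of "\<lambda>t. ?d + t * ?N" _ "at_right 0"]) auto
  then show ?thesis by (simp add: inner_diff_left)
qed

text \<open>Add the variational inequalities of the two points, each tested with the other; the
  values of \<open>u\<close> cancel.\<close>

lemma resolvent_nonexpansive: "norm (resolvent y1 - resolvent y2) \<le> norm (y1 - y2)"
proof -
  let ?x1 = "resolvent y1" and ?x2 = "resolvent y2"
  have "(y1 - ?x1) \<bullet> (?x2 - ?x1) + (y2 - ?x2) \<bullet> (?x1 - ?x2) \<le> 0"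
    using resolvent_variational[OF resolvent(1), of y1 y2] resolvent_variational[OF resolvent(1), of y2 y1] by linarith
  then have "(?x1 - ?x2) \<bullet> (?x1 - ?x2) \<le> (y1 - y2) \<bullet> (?x1 - ?x2)"
    by (simp add: inner_diff_left inner_diff_right inner_commute)
  also have "\<dots> \<le> norm (y1 - y2) * norm (?x1 - ?x2)" by (rule norm_cauchy_schwarz)
  finally have "norm (?x1 - ?x2) * norm (?x1 - ?x2) \<le> norm (y1 - y2) * norm (?x1 - ?x2)"
    by (simp add: power2_norm_eq_inner[symmetric] power2_eq_square)
  then show ?thesis by (cases "norm (?x1 - ?x2) = 0") (auto dest: mult_right_le_imp_le)
qed

lemma resolvent_grad:
  assumes x: "x \<in> \<Omega>"
  shows "resolvent (x + grad x) = x"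
proof -
  let ?y = "x + grad x" and ?z = "resolvent (x + grad x)"
  have "u ?z + (norm (?z - ?y))\<^sup>2 / 2 \<le> u x + (norm (x - ?y))\<^sup>2 / 2"
    by (rule resolvent(2)) (use x closure_subset in blast)
  moreover have "u x + grad x \<bullet> (?z - x) \<le> u ?z"
    by (rule supporting_closure[OF grad[OF x] resolvent(1)])
  moreover have "(norm (?z - ?y))\<^sup>2 = (norm (?z - x))\<^sup>2 - 2 * (grad x \<bullet> (?z - x)) + (norm (grad x))\<^sup>2"
  proof -
    have "?z - ?y = (?z - x) - grad x" by simp
    then show ?thesis
      by (simp only: power2_norm_eq_inner inner_diff_left inner_diff_right) (simp add: inner_commute)
  qed
  moreover have "(norm (x - ?y))\<^sup>2 = (norm (grad x))\<^sup>2" by simp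
  ultimately have "(norm (?z - x))\<^sup>2 \<le> 0" by linarith
  then show ?thesis by simp
qed

lemma linear_det_inverse:
  fixes f :: "real^'n \<Rightarrow> real^'n"
  assumes f: "linear f" and d: "det (matrix f) \<noteq> 0"
  obtains g where "bounded_linear g" "g \<circ> f = id"
proof -
  obtain M where M: "M ** matrix f = mat 1"
    using d invertible_det_nz[of "matrix f"] unfolding invertible_def by blast
  show thesis
  proof (rule that)
    show "bounded_linear ((*v) M)" by (rule matrix_vector_mul_bounded_linear)
    show "(*v) M \<circ> f = id"
    proof
      fix x
      have "M *v f x = M *v (matrix f *v x)" using f by (simp add: matrix_works)
      then show "((*v) M \<circ> f) x = id x" by (simp add: matrix_vector_mul_assoc M)
    qed
  qed
qed

text \<open>Every \<open>x\<close> in \<open>\<Omega>\<close> is the resolvent of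
  \<open>x + grad x\<close>. Where the resolvent has an invertible derivative at that point,
  inverting it gives the derivative of \<open>grad\<close>. The remaining \<open>x\<close> are
  images of a null set under a nonexpansive map, or critical values.\<close>

theorem grad_differentiable_ae: "negligible {x \<in> \<Omega>. \<not> grad differentiable (at x)}"
proof -
  let ?G = resolvent
  define N0 where "N0 = {y. \<not> ?G differentiable (at y)}"
  have N0: "negligible N0"
  proof -
    have "?G differentiable (at y)" if H: "\<And>i. (\<lambda>y. ?G y $ i) differentiable (at y)" for y
    proof (rule differentiable_componentwise_within[THEN iffD2], rule ballI)
      fix b :: "real^'n" assume "b \<in> Basis"
      then obtain i where "b = axis i 1" by (auto simp: Basis_vec_def)
      then show "(\<lambda>y. ?G y \<bullet> b) differentiable (at y)" using H[of i] by (simp add: inner_axis)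
    qed
    then have "N0 \<subseteq> (\<Union>i\<in>UNIV. {y. \<not> (\<lambda>y. ?G y $ i) differentiable (at y)})"
      unfolding N0_def by blast
    moreover have "negligible {y. \<not> (\<lambda>y. ?G y $ i) differentiable (at y)}" for i
    proof (rule Rademacher[of _ 1])
      fix x y
      have "\<bar>?G x $ i - ?G y $ i\<bar> \<le> norm (?G x - ?G y)"
        using component_le_norm_cart[of "?G x - ?G y" i] by simp
      then show "\<bar>?G x $ i - ?G y $ i\<bar> \<le> 1 * norm (x - y)" using resolvent_nonexpansive[of x y] by simp
    qed
    then have "negligible (\<Union>i\<in>UNIV. {y. \<not> (\<lambda>y. ?G y $ i) differentiable (at y)})"
      by (intro negligible_Union) auto
    ultimately show ?thesis by (rule negligible_subset[rotated])
  qed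
  have B1: "negligible (?G ` N0)"
    by (rule negligible_locally_Lipschitz_image[OF _ N0])
      (use resolvent_nonexpansive in \<open>auto intro!: exI[of _ "UNIV :: (real^'n) set"] exI[of _ "1::real"]\<close>)
  let ?G' = "\<lambda>y. frechet_derivative ?G (at y)"
  let ?Z = "{y. y \<notin> N0 \<and> det (matrix (?G' y)) = 0}"
  have der: "(?G has_derivative ?G' y) (at y)" if "y \<notin> N0" for y
    using that by (simp add: N0_def frechet_derivative_works)
  have B2: "negligible (?G ` ?Z)"
    by (rule Sard_fin[where f' = ?G']) (use der in \<open>auto intro: has_derivative_at_withinI\<close>)
  have "{x \<in> \<Omega>. \<not> grad differentiable (at x)} \<subseteq> ?G ` N0 \<union> ?G ` ?Z"
  proof (rule ccontr)
    assume "\<not> ?thesis"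
    then obtain x where x: "x \<in> \<Omega>" "\<not> grad differentiable (at x)" "x \<notin> ?G ` N0" "x \<notin> ?G ` ?Z" by blast
    define F where "F z = z + grad z" for z
    have GF: "?G (F z) = z" if "z \<in> \<Omega>" for z using resolvent_grad[OF that] by (simp add: F_def)
    have y1: "F x \<notin> N0" using x(3) GF[OF x(1)] by (metis imageI)
    have "F x \<notin> ?Z" using x(4) GF[OF x(1)] by (metis (no_types, lifting) imageI)
    with y1 have y: "F x \<notin> N0" "det (matrix (?G' (F x))) \<noteq> 0" by blast+
    have d: "(?G has_derivative ?G' (F x)) (at (F x))" by (rule der[OF y(1)])
    obtain M where M: "bounded_linear M" "M \<circ> ?G' (F x) = id"
      using linear_det_inverse[OF has_derivative_linear[OF d] y(2)] by blast
    have contF: "continuous (at x) F"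
      unfolding F_def using grad_cont op x(1) by (intro continuous_intros) (simp add: continuous_on_eq_continuous_at)
    have "(F has_derivative M) (at x)"
      by (rule has_derivative_inverse_basic[OF d M contF op x(1) GF])
    then have "((\<lambda>z. F z - z) has_derivative (\<lambda>h. M h - h)) (at x)"
      by (intro derivative_intros)
    then have "(grad has_derivative (\<lambda>h. M h - h)) (at x)" by (simp add: F_def)
    with x(2) show False by (auto simp: differentiable_def)
  qed
  with B1 B2 show ?thesis using negligible_Un negligible_subset by blast
qed

text \<open>Mean value theorem in direction \<open>w\<close> for the increment of \<open>u\<close>
  by \<open>t *\<^sub>R v\<close>. Both gradients that appear are expanded about \<open>x\<close>,
  so differentiability of \<open>grad\<close> at this single point is what gets used.\<close>

lemma second_difference_bound:
  assumes x: "x \<in> \<Omega>" and A: "(grad has_derivative A) (at x)" and \<epsilon>: "\<epsilon> > 0"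
  shows "\<forall>\<^sub>F t in at_right 0. \<bar>u (x + t *\<^sub>R v + t *\<^sub>R w) - u (x + t *\<^sub>R v) - u (x + t *\<^sub>R w) + u x - t\<^sup>2 * (A v \<bullet> w)\<bar>
    \<le> t\<^sup>2 * (2 * \<epsilon> * (norm v + norm w) * norm w)"
proof -
  obtain r where r: "r > 0" "ball x r \<subseteq> \<Omega>" using op x openE by blast
  obtain d where d: "d > 0" "\<And>y. norm (y - x) < d \<Longrightarrow> norm (grad y - grad x - A (y - x)) \<le> \<epsilon> * norm (y - x)"
    using A \<epsilon> unfolding has_derivative_at_alt by blast
  have lin: "linear A" using A by (rule has_derivative_linear)
  define N where "N = norm v + norm w"
  define T where "T = min r d / (N + 1)"
  have N: "0 \<le> N" by (simp add: N_def)
  have T: "T > 0" using r d N by (simp add: T_def)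
  have small: "norm (a *\<^sub>R v + b *\<^sub>R w) \<le> t * N \<and> t * N < min r d"
    if "0 \<le> a" "a \<le> t" "0 \<le> b" "b \<le> t" "0 < t" "t < T" for a b t
  proof
    have "norm (a *\<^sub>R v + b *\<^sub>R w) \<le> a * norm v + b * norm w"
      using norm_triangle_ineq[of "a *\<^sub>R v" "b *\<^sub>R w"] that by simp
    also have "\<dots> \<le> t * norm v + t * norm w" using that by (intro add_mono mult_right_mono) auto
    finally show "norm (a *\<^sub>R v + b *\<^sub>R w) \<le> t * N" by (simp add: N_def algebra_simps)
    have "t * N \<le> t * (N + 1)" using that by simp
    also have "\<dots> < T * (N + 1)" using that N by (intro mult_strict_right_mono) auto
    also have "\<dots> = min r d" using N by (simp add: T_def)
    finally show "t * N < min r d" .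
  qed
  have "\<bar>u (x + t *\<^sub>R v + t *\<^sub>R w) - u (x + t *\<^sub>R v) - u (x + t *\<^sub>R w) + u x - t\<^sup>2 * (A v \<bullet> w)\<bar>
    \<le> t\<^sup>2 * (2 * \<epsilon> * N * norm w)" if t: "0 < t" "t < T" for t
  proof -
    let ?\<phi> = "\<lambda>s. u (x + t *\<^sub>R v + s *\<^sub>R w) - u (x + s *\<^sub>R w)"
    have inO: "x + a *\<^sub>R v + b *\<^sub>R w \<in> \<Omega>" if "0 \<le> a" "a \<le> t" "0 \<le> b" "b \<le> t" for a b
    proof -
      have "norm (a *\<^sub>R v + b *\<^sub>R w) < r" using small[OF that t] by linarith
      then have "x + (a *\<^sub>R v + b *\<^sub>R w) \<in> ball x r" unfolding mem_ball dist_norm by (subst norm_minus_commute) simp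
      then show ?thesis using r(2) by (auto simp: add.assoc)
    qed
    have "((\<lambda>s. u (x + a *\<^sub>R v + s *\<^sub>R w)) has_derivative (\<lambda>h. grad (x + a *\<^sub>R v + s *\<^sub>R w) \<bullet> (h *\<^sub>R w))) (at s)"
      if "0 \<le> a" "a \<le> t" "0 \<le> s" "s \<le> t" for a s
    proof -
      have "((\<lambda>s. x + a *\<^sub>R v + s *\<^sub>R w) has_derivative (\<lambda>h. h *\<^sub>R w)) (at s)"
        by (auto intro!: derivative_eq_intros)
      from has_derivative_compose[OF this u_has_derivative[OF inO[OF that]]] show ?thesis .
    qed
    from this[of t] this[of 0] t
    have der: "(?\<phi> has_derivative (\<lambda>h. (grad (x + t *\<^sub>R v + s *\<^sub>R w) - grad (x + s *\<^sub>R w)) \<bullet> (h *\<^sub>R w))) (at s)"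
      if "0 \<le> s" "s \<le> t" for s
      using that by (auto intro!: derivative_eq_intros simp: inner_diff_left right_diff_distrib)
    have "\<exists>\<xi>\<in>{0<..<t}. ?\<phi> t - ?\<phi> 0 = (grad (x + t *\<^sub>R v + \<xi> *\<^sub>R w) - grad (x + \<xi> *\<^sub>R w)) \<bullet> ((t - 0) *\<^sub>R w)"
    proof (rule mvt)
      show "0 < t" by (rule t)
      show "continuous_on {0..t} ?\<phi>"
        by (intro continuous_at_imp_continuous_on ballI has_derivative_continuous[OF der]) auto
      show "(?\<phi> has_derivative (\<lambda>h. (grad (x + t *\<^sub>R v + s *\<^sub>R w) - grad (x + s *\<^sub>R w)) \<bullet> (h *\<^sub>R w))) (at s)"
        if "0 < s" "s < t" for s
        using der that by simp
    qed (rule bexI, assumption, simp)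
    then obtain \<xi> where \<xi>: "0 < \<xi>" "\<xi> < t"
      and eq: "?\<phi> t - ?\<phi> 0 = t * ((grad (x + t *\<^sub>R v + \<xi> *\<^sub>R w) - grad (x + \<xi> *\<^sub>R w)) \<bullet> w)" by auto
    let ?R = "\<lambda>h. grad (x + h) - grad x - A h"
    have R: "norm (?R (a *\<^sub>R v + \<xi> *\<^sub>R w)) \<le> \<epsilon> * (t * N)" if "0 \<le> a" "a \<le> t" for a
    proof -
      have s: "norm (a *\<^sub>R v + \<xi> *\<^sub>R w) \<le> t * N" "t * N < min r d"
        using small[OF that, of \<xi>] \<xi> t by auto
      have "norm (?R (a *\<^sub>R v + \<xi> *\<^sub>R w)) \<le> \<epsilon> * norm (a *\<^sub>R v + \<xi> *\<^sub>R w)"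
        using d(2)[of "x + (a *\<^sub>R v + \<xi> *\<^sub>R w)"] s by simp
      also have "\<dots> \<le> \<epsilon> * (t * N)" using s \<epsilon> by (intro mult_left_mono) auto
      finally show ?thesis .
    qed
    have "(grad (x + t *\<^sub>R v + \<xi> *\<^sub>R w) - grad (x + \<xi> *\<^sub>R w)) - t *\<^sub>R A v = ?R (t *\<^sub>R v + \<xi> *\<^sub>R w) - ?R (0 *\<^sub>R v + \<xi> *\<^sub>R w)"
      using lin by (simp add: linear_add linear_scale add.assoc)
    also have "norm \<dots> \<le> \<epsilon> * (t * N) + \<epsilon> * (t * N)"
      using norm_triangle_ineq4[of "?R (t *\<^sub>R v + \<xi> *\<^sub>R w)" "?R (0 *\<^sub>R v + \<xi> *\<^sub>R w)"] R[of t] R[of 0] t by linarith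
    finally have nb: "norm ((grad (x + t *\<^sub>R v + \<xi> *\<^sub>R w) - grad (x + \<xi> *\<^sub>R w)) - t *\<^sub>R A v) \<le> t * (2 * \<epsilon> * N)"
      by (simp add: mult_ac)
    have "\<bar>?\<phi> t - ?\<phi> 0 - t\<^sup>2 * (A v \<bullet> w)\<bar> = t * \<bar>((grad (x + t *\<^sub>R v + \<xi> *\<^sub>R w) - grad (x + \<xi> *\<^sub>R w)) - t *\<^sub>R A v) \<bullet> w\<bar>"
    proof -
      have "?\<phi> t - ?\<phi> 0 - t\<^sup>2 * (A v \<bullet> w) = t * (((grad (x + t *\<^sub>R v + \<xi> *\<^sub>R w) - grad (x + \<xi> *\<^sub>R w)) - t *\<^sub>R A v) \<bullet> w)"
        unfolding eq by (simp add: inner_diff_left power2_eq_square algebra_simps)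
      then show ?thesis using t by (simp add: abs_mult)
    qed
    also have "\<dots> \<le> t * (norm ((grad (x + t *\<^sub>R v + \<xi> *\<^sub>R w) - grad (x + \<xi> *\<^sub>R w)) - t *\<^sub>R A v) * norm w)"
      using t by (intro mult_left_mono Cauchy_Schwarz_ineq2) auto
    also have "\<dots> \<le> t * (t * (2 * \<epsilon> * N) * norm w)"
      using t nb by (intro mult_left_mono mult_right_mono) auto
    finally show ?thesis by (simp add: power2_eq_square algebra_simps)
  qed
  then show ?thesis
    unfolding N_def eventually_at_right_field using T by blast
qed

text \<open>The second difference is symmetric in \<open>v\<close> and \<open>w\<close>, and divided
  by \<open>t\<^sup>2\<close> it tends to \<open>A v \<bullet> w\<close>.\<close>

lemma grad_derivative_symmetric:
  assumes x: "x \<in> \<Omega>" and A: "(grad has_derivative A) (at x)"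
  shows "A v \<bullet> w = A w \<bullet> v"
proof -
  have "\<bar>A v \<bullet> w - A w \<bullet> v\<bar> \<le> 0 + e" if e: "e > 0" for e
  proof -
    define C where "C = 2 * (norm v + norm w) * norm w + 2 * (norm w + norm v) * norm v + 1"
    have C: "C > 0" by (auto simp: C_def intro: add_nonneg_pos)
    define \<epsilon> where "\<epsilon> = e / C"
    have \<epsilon>: "\<epsilon> > 0" using e C by (simp add: \<epsilon>_def)
    obtain t where t: "t > 0" and
      1: "\<bar>u (x + t *\<^sub>R v + t *\<^sub>R w) - u (x + t *\<^sub>R v) - u (x + t *\<^sub>R w) + u x - t\<^sup>2 * (A v \<bullet> w)\<bar>
        \<le> t\<^sup>2 * (2 * \<epsilon> * (norm v + norm w) * norm w)" and
      2: "\<bar>u (x + t *\<^sub>R w + t *\<^sub>R v) - u (x + t *\<^sub>R w) - u (x + t *\<^sub>R v) + u x - t\<^sup>2 * (A w \<bullet> v)\<bar>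
        \<le> t\<^sup>2 * (2 * \<epsilon> * (norm w + norm v) * norm v)"
      using eventually_happens'[OF _ eventually_conj[OF eventually_at_right_less[of "0::real"]
          eventually_conj[OF second_difference_bound[OF x A \<epsilon>, of v w] second_difference_bound[OF x A \<epsilon>, of w v]]]]
      by auto
    have "u (x + t *\<^sub>R w + t *\<^sub>R v) = u (x + t *\<^sub>R v + t *\<^sub>R w)" by (simp add: add_ac)
    with 1 2 have "\<bar>t\<^sup>2 * (A v \<bullet> w) - t\<^sup>2 * (A w \<bullet> v)\<bar> \<le>
        t\<^sup>2 * (2 * \<epsilon> * (norm v + norm w) * norm w) + t\<^sup>2 * (2 * \<epsilon> * (norm w + norm v) * norm v)"
      by linarith
    also have "\<bar>t\<^sup>2 * (A v \<bullet> w) - t\<^sup>2 * (A w \<bullet> v)\<bar> = t\<^sup>2 * \<bar>A v \<bullet> w - A w \<bullet> v\<bar>"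
      by (simp add: abs_mult flip: right_diff_distrib)
    also have "t\<^sup>2 * (2 * \<epsilon> * (norm v + norm w) * norm w) + t\<^sup>2 * (2 * \<epsilon> * (norm w + norm v) * norm v) = t\<^sup>2 * (\<epsilon> * (C - 1))"
      by (simp add: C_def algebra_simps)
    finally have "t\<^sup>2 * \<bar>A v \<bullet> w - A w \<bullet> v\<bar> \<le> t\<^sup>2 * (\<epsilon> * (C - 1))" .
    then have "\<bar>A v \<bullet> w - A w \<bullet> v\<bar> \<le> \<epsilon> * (C - 1)" using t by simp
    also have "\<dots> \<le> \<epsilon> * C" using \<epsilon> by simp
    also have "\<dots> = e" using C by (simp add: \<epsilon>_def)
    finally show ?thesis by simp
  qed
  then have "\<bar>A v \<bullet> w - A w \<bullet> v\<bar> \<le> 0" by (rule field_le_epsilon)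
  then show ?thesis by simp
qed


lemma grad_derivative_nonneg:
  assumes x: "x \<in> \<Omega>" and A: "(grad has_derivative A) (at x)"
  shows "0 \<le> A v \<bullet> v"
proof -
  obtain r where r: "r > 0" "ball x r \<subseteq> \<Omega>" using op x openE by blast
  have "((\<lambda>t. ((grad (x + t *\<^sub>R v) - grad x) /\<^sub>R t) \<bullet> v) \<longlongrightarrow> A v \<bullet> v) (at 0)"
    by (intro tendsto_intros directional_limit A)
  then have "((\<lambda>t. (grad (x + t *\<^sub>R v) \<bullet> v - grad x \<bullet> v) / t) \<longlongrightarrow> A v \<bullet> v) (at 0)"
    by (simp add: inner_diff_left divide_inverse mult.commute)
  then have lim: "((\<lambda>t. (grad (x + t *\<^sub>R v) \<bullet> v - grad x \<bullet> v) / t) \<longlongrightarrow> A v \<bullet> v) (at_right 0)"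
    by (rule filterlim_mono) (auto simp: at_le)
  show ?thesis
  proof (rule tendsto_lowerbound[OF lim])
    define T where "T = r / (norm v + 1)"
    have T: "T > 0" using r by (simp add: T_def add_nonneg_pos)
    have "0 \<le> (grad (x + t *\<^sub>R v) \<bullet> v - grad x \<bullet> v) / t" if t: "0 < t" "t < T" for t
    proof -
      have "t * norm v \<le> t * (norm v + 1)" using t by simp
      also have "\<dots> < T * (norm v + 1)" using t norm_ge_zero[of v] by (intro mult_strict_right_mono) (auto simp: add_nonneg_pos)
      also have "\<dots> = r" by (simp add: T_def add_nonneg_pos) (metis add_nonneg_pos less_irrefl norm_ge_zero zero_less_one)
      finally have "x + t *\<^sub>R v \<in> \<Omega>" using r t by (auto simp: subset_iff dist_norm)
      from grad_mono[OF x this] have "0 \<le> t * (grad (x + t *\<^sub>R v) \<bullet> v - grad x \<bullet> v)"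
        by (simp add: inner_diff_left)
      then show ?thesis using t by (simp add: zero_le_mult_iff)
    qed
    then show "\<forall>\<^sub>F t in at_right 0. 0 \<le> (grad (x + t *\<^sub>R v) \<bullet> v - grad x \<bullet> v) / t"
      unfolding eventually_at_right_field using T by blast
  qed simp
qed

lemma pderiv_eq_grad: "x \<in> \<Omega> \<Longrightarrow> pderiv_at j u x = grad x $ j"
  by (simp add: pderiv_at_def frechet_derivative_at[OF u_has_derivative, of x, symmetric] inner_axis)

text \<open>\<open>hessian\<close> has the outer derivative as row index, so a priori it is the
  transpose of \<open>matrix A\<close>; symmetry identifies the two.\<close>

lemma hessian_eq:
  assumes x: "x \<in> \<Omega>" and A: "(grad has_derivative A) (at x)"
  shows "hessian u x *v v = A v" "hessian u x = matrix A"
proof -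
  have lin: "linear A" using A by (rule has_derivative_linear)
  have "hessian u x $ i $ j = A (axis i 1) $ j" for i j
  proof -
    have "((\<lambda>y. grad y $ j) has_derivative (\<lambda>h. A h $ j)) (at x)"
      by (rule bounded_linear.has_derivative[OF bounded_linear_vec_nth A])
    then have "(pderiv_at j u has_derivative (\<lambda>h. A h $ j)) (at x)"
      by (rule has_derivative_transform_within_open[OF _ op x]) (simp add: pderiv_eq_grad)
    from frechet_derivative_at[OF this] have "frechet_derivative (pderiv_at j u) (at x) = (\<lambda>h. A h $ j)" ..
    then show ?thesis by (simp add: hessian_def pderiv_at_def)
  qed
  moreover have "A (axis i 1) $ j = A (axis j 1) $ i" for i j
    using grad_derivative_symmetric[OF x A, of "axis i 1" "axis j 1"] by (simp add: inner_axis)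
  ultimately show m: "hessian u x = matrix A" by (simp add: vec_eq_iff matrix_def)
  show "hessian u x *v v = A v" using lin by (simp add: m matrix_works)
qed

section \<open>Borel representatives of the second derivatives\<close>

definition grad0 :: "real^'n \<Rightarrow> real^'n" where
  "grad0 x = (if x \<in> \<Omega> then grad x else 0)"

lemma grad0_borel [measurable]: "grad0 \<in> borel_measurable borel"
proof -
  have "(\<lambda>x. if x \<in> \<Omega> then grad x else 0) \<in> borel_measurable borel"
    by (rule borel_measurable_continuous_on_if) (use op grad_cont in auto)
  then show ?thesis by (simp add: grad0_def[abs_def])
qed

definition dquot :: "real^'n \<Rightarrow> nat \<Rightarrow> real^'n \<Rightarrow> real^'n" where
  "dquot e k x = real (Suc k) *\<^sub>R (grad0 (x + (1 / real (Suc k)) *\<^sub>R e) - grad0 x)"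

lemma dquot_borel [measurable]: "dquot e k \<in> borel_measurable borel"
  unfolding dquot_def[abs_def] by measurable

lemma dquot_lim:
  assumes x: "x \<in> \<Omega>" and A: "(grad has_derivative A) (at x)"
  shows "(\<lambda>k. dquot e k x) \<longlonglongrightarrow> A e"
proof -
  note lim = directional_limit[OF A, of e]
  have l0: "filterlim (\<lambda>k. 1 / real (Suc k)) (at 0) sequentially"
    unfolding filterlim_at using LIMSEQ_Suc[OF lim_1_over_n] by simp
  have "(\<lambda>k. (grad (x + (1 / real (Suc k)) *\<^sub>R e) - grad x) /\<^sub>R (1 / real (Suc k))) \<longlonglongrightarrow> A e"
    by (rule filterlim_compose[OF lim l0])
  then show ?thesis
  proof (rule Lim_transform_eventually)
    have "(\<lambda>k. x + (1 / real (Suc k)) *\<^sub>R e) \<longlonglongrightarrow> x + 0 *\<^sub>R e"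
      by (intro tendsto_intros LIMSEQ_Suc[OF lim_1_over_n])
    then have "\<forall>\<^sub>F k in sequentially. x + (1 / real (Suc k)) *\<^sub>R e \<in> \<Omega>"
      using topological_tendstoD[OF _ op] x by simp
    then show "\<forall>\<^sub>F k in sequentially. (grad (x + (1 / real (Suc k)) *\<^sub>R e) - grad x) /\<^sub>R (1 / real (Suc k)) = dquot e k x"
      by eventually_elim (simp add: dquot_def grad0_def x)
  qed
qed

text \<open>A Borel version of the Hessian, wanted for the measurability of the Jacobian: limits of
  difference quotients along one fixed sequence, with an arbitrary value where they diverge.\<close>

definition hess :: "real^'n \<Rightarrow> real^'n^'n" where
  "hess x = (\<chi> i j. lim (\<lambda>k. dquot (axis j 1) k x $ i))"

lemma det_hess_borel: "(\<lambda>x. det (hess x)) \<in> borel_measurable borel"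
proof -
  have "(\<lambda>v :: real^'n. v $ i) \<in> borel_measurable borel" for i
    by (intro borel_measurable_continuous_onI continuous_intros)
  from measurable_compose[OF dquot_borel this]
  have "(\<lambda>x. dquot (axis j 1) k x $ i) \<in> borel_measurable borel" for i j k .
  from borel_measurable_lim_metric[OF this]
  have "(\<lambda>x. hess x $ i $ j) \<in> borel_measurable borel" for i j
    by (simp add: hess_def)
  then show ?thesis
    unfolding det_def by (intro borel_measurable_sum borel_measurable_times borel_measurable_prod) auto
qed

lemma hess_eq:
  assumes x: "x \<in> \<Omega>" and A: "(grad has_derivative A) (at x)"
  shows "hess x = matrix A"
proof -
  have "(\<lambda>k. dquot (axis j 1) k x $ i) \<longlonglongrightarrow> A (axis j 1) $ i" for i j
    by (intro tendsto_intros dquot_lim[OF x A])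
  then show ?thesis by (simp add: hess_def matrix_def vec_eq_iff limI)
qed

definition regular :: "real^'n \<Rightarrow> bool" where
  "regular x \<longleftrightarrow> (\<exists>A. (grad has_derivative A) (at x)) \<and> lam \<le> \<bar>det (hessian u x)\<bar>"

text \<open>On a set where the Jacobian of \<open>grad\<close> is at most
  \<open>lam - 1 / Suc k\<close>, the gradient image has at most that multiple of the measure of the
  set, whereas the lower bound demands the multiple \<open>lam\<close>. Such sets are null.\<close>

theorem regular_ae: "AE x in lborel. x \<in> \<Omega> \<longrightarrow> regular x"
proof -
  have "{x \<in> \<Omega>. \<not> grad differentiable (at x)} \<in> null_sets lebesgue"
    using grad_differentiable_ae by (simp add: negligible_iff_null_sets)
  then obtain N where N: "N \<in> null_sets lborel" "{x \<in> \<Omega>. \<not> grad differentiable (at x)} \<subseteq> N"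
    unfolding null_sets_completion_iff2 by blast
  have Nb: "N \<in> sets borel" using N(1) by (auto simp: null_sets_def)
  define E where "E k = {x \<in> \<Omega> - N. \<bar>det (hess x)\<bar> \<le> lam - 1 / real (Suc k)}" for k :: nat
  have "E k \<in> null_sets lborel" for k
  proof -
    let ?B = "lam - 1 / real (Suc k)"
    have Eb: "E k \<in> sets borel"
    proof -
      have "{x \<in> space borel. \<bar>det (hess x)\<bar> \<le> ?B} \<in> sets borel"
        using det_hess_borel by measurable
      then have "(\<Omega> - N) \<inter> {x. \<bar>det (hess x)\<bar> \<le> ?B} \<in> sets borel"
        using op Nb by auto
      then show ?thesis by (simp add: E_def Int_def)
    qed
    have EO: "E k \<subseteq> \<Omega>" by (auto simp: E_def)
    have Elm: "E k \<in> lmeasurable"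
      using Eb bounded_subset[OF bdd EO] by (simp add: bounded_set_imp_lmeasurable)
    let ?A = "\<lambda>x. frechet_derivative grad (at x)"
    have A: "(grad has_derivative ?A x) (at x)" if "x \<in> E k" for x
      using that N(2) frechet_derivative_works by (auto simp: E_def)
    have h: "matrix (?A x) = hess x" if "x \<in> E k" for x
      using hess_eq[OF _ A] that EO by auto
    have m: "(\<lambda>x. det (matrix (?A x))) \<in> borel_measurable (lebesgue_on (E k))"
    proof -
      have "(\<lambda>x. det (hess x)) \<in> borel_measurable (lebesgue_on (E k))"
        using det_hess_borel by (intro measurable_restrict_space1 measurable_completion) simp
      then show ?thesis
        by (rule measurable_cong[THEN iffD1, rotated]) (simp add: h space_restrict_space)
    qed
    have im: "(\<Union>x\<in>E k. subdifferential \<Omega> u x) = grad ` E k"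
      using grad grad_unique EO by fast
    have bd: "\<bar>det (matrix (?A x))\<bar> \<le> ?B" if "x \<in> E k" for x
      using that h by (auto simp: E_def)
    note im_meas = measure_bounded_differentiable_image_fin[OF Elm has_derivative_at_withinI[OF A] m bd]
    have "ennreal lam * emeasure lborel (E k) \<le> emeasure lebesgue (grad ` E k)"
      using ma_lower[OF Eb EO] by (simp add: monge_ampere_def im)
    also have "\<dots> = ennreal (measure lebesgue (grad ` E k))"
      using im_meas(1) by (rule emeasure_eq_measure2)
    also have "emeasure lborel (E k) = ennreal (measure lebesgue (E k))"
      using emeasure_eq_measure2[OF Elm] Eb by simp
    finally have "lam * measure lebesgue (E k) \<le> measure lebesgue (grad ` E k)"
      using lam by (simp add: ennreal_le_iff flip: ennreal_mult)
    also have "\<dots> \<le> ?B * measure lebesgue (E k)" by (rule im_meas(2))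
    finally have "1 / real (Suc k) * measure lebesgue (E k) \<le> 0" by (simp add: algebra_simps)
    then have "measure lebesgue (E k) = 0"
      by (simp add: mult_le_0_iff divide_le_0_iff measure_le_0_iff)
    then show ?thesis
      using emeasure_eq_measure2[OF Elm] Eb by (auto intro: null_setsI)
  qed
  then have "(\<Union>k. E k) \<in> null_sets lborel" by (rule null_sets_UN)
  then have Z: "N \<union> (\<Union>k. E k) \<in> null_sets lborel" using N(1) by auto
  show ?thesis
  proof (rule AE_I'[OF Z], rule subsetI)
    fix x assume "x \<in> {x \<in> space lborel. \<not> (x \<in> \<Omega> \<longrightarrow> regular x)}"
    then have x: "x \<in> \<Omega>" "\<not> regular x" by auto
    show "x \<in> N \<union> (\<Union>k. E k)"
    proof (cases "x \<in> N")
      case False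
      then have "grad differentiable (at x)" using N(2) x(1) by blast
      then obtain A where A: "(grad has_derivative A) (at x)" by (auto simp: differentiable_def)
      then have "\<bar>det (hessian u x)\<bar> < lam" using x(2) by (auto simp: regular_def)
      then have l: "\<bar>det (hess x)\<bar> < lam" using hess_eq[OF x(1) A] hessian_eq(2)[OF x(1) A] by simp
      then obtain k where "1 / real (Suc k) < lam - \<bar>det (hess x)\<bar>"
        using nat_approx_posE[of "lam - \<bar>det (hess x)\<bar>"] by auto
      then show ?thesis using x(1) False by (auto simp: E_def intro!: exI[of _ k])
    qed simp
  qed
qed

end

section \<open>Decay at the boundary\<close>

text \<open>A line in direction \<open>e\<close> meets the slab in a segment of length at most
  \<open>d\<close>. The unit translation range of \<open>line_integral_bound\<close> is what
  enlarges the radius to \<open>r + 1\<close>.\<close>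

lemma slab_emeasure:
  fixes e :: "'a::euclidean_space"
  assumes e: "norm e = 1" and A: "A \<in> sets borel" "A \<subseteq> cball 0 r" and d: "0 \<le> d"
    and slab: "\<And>x. x \<in> A \<Longrightarrow> s \<le> e \<bullet> x \<and> e \<bullet> x \<le> s + d"
  shows "emeasure lborel A \<le> ennreal d * emeasure lborel (cball (0::'a) (r + 1))"
proof -
  have "ennreal 1 * (\<integral>\<^sup>+x. indicator A x \<partial>lborel) \<le> ennreal d * emeasure lborel (cball (0::'a) (r + 1))"
  proof (rule line_integral_bound)
    show "x - t *\<^sub>R e \<in> cball 0 (r + 1)" if "indicator A x \<noteq> (0::ennreal)" "0 \<le> t" "t \<le> 1" for x t
    proof -
      have "x \<in> A" using that by (simp add: indicator_def split: if_splits)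
      then have "norm x \<le> r" using A(2) by auto
      then show ?thesis using norm_triangle_ineq4[of x "t *\<^sub>R e"] that e by simp
    qed
    show "(\<integral>\<^sup>+t\<in>{0..1}. indicator A (x + t *\<^sub>R e) \<partial>lborel) \<le> ennreal d" for x
    proof -
      have "(\<integral>\<^sup>+t\<in>{0..1}. indicator A (x + t *\<^sub>R e) \<partial>lborel) \<le> (\<integral>\<^sup>+t. indicator {s - e \<bullet> x..s - e \<bullet> x + d} t \<partial>lborel)"
      proof (rule nn_integral_mono)
        fix t :: real
        have "e \<bullet> e = 1" using e by (simp add: power2_norm_eq_inner[symmetric])
        then show "indicator A (x + t *\<^sub>R e) * indicator {0..1} t \<le> (indicator {s - e \<bullet> x..s - e \<bullet> x + d} t :: ennreal)"
          using slab[of "x + t *\<^sub>R e"] by (auto simp: indicator_def inner_add_right)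
      qed
      also have "\<dots> = ennreal d" using d by simp
      finally show ?thesis .
    qed
  qed (use A in auto)
  then show ?thesis using A(1) by simp
qed

context ma_bounds
begin

lemma supporting_normal:
  assumes z: "z \<in> frontier \<Omega>"
  obtains \<nu> where "norm \<nu> = 1" "\<And>y. y \<in> \<Omega> \<Longrightarrow> 0 < \<nu> \<bullet> (y - z)"
proof -
  have zO: "{z} \<inter> \<Omega> = {}" using z frontier_iff by auto
  obtain a b where ab: "a \<noteq> 0" "a \<bullet> z \<le> b" "\<And>y. y \<in> \<Omega> \<Longrightarrow> b \<le> a \<bullet> y"
    using separating_hyperplane_sets[OF _ cvx _ ne zO] by auto
  have pos: "0 < a \<bullet> (y - z)" if y: "y \<in> \<Omega>" for y
  proof -
    obtain r where r: "r > 0" "cball y r \<subseteq> \<Omega>" using op y open_contains_cball by blast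
    \<comment> \<open>Openness makes the inequality strict: \<open>y\<close> can be moved towards
      the hyperplane within \<open>\<Omega>\<close>.\<close>
    have "y - (r / norm a) *\<^sub>R a \<in> cball y r" using ab(1) r(1) by (simp add: dist_norm)
    then have "b \<le> a \<bullet> (y - (r / norm a) *\<^sub>R a)" using r(2) ab(3) by blast
    then have "b + r / norm a * (a \<bullet> a) \<le> a \<bullet> y" by (simp add: inner_diff_right)
    moreover have "0 < r / norm a * (a \<bullet> a)" using r(1) ab(1) by simp
    ultimately show ?thesis using ab(2) by (simp add: inner_diff_right)
  qed
  show thesis
  proof (rule that[of "a /\<^sub>R norm a"])
    show "norm (a /\<^sub>R norm a) = 1" using ab(1) by simp
    show "0 < (a /\<^sub>R norm a) \<bullet> (y - z)" if "y \<in> \<Omega>" for y using pos[OF that] ab(1) by simp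
  qed
qed

end

section \<open>Decay by halving over dyadic slabs\<close>

locale ma_ball = ma_bounds \<Omega> u lam Lam for \<Omega> :: "(real^'n::finite) set" and u lam Lam +
  fixes R :: real
  assumes R: "0 < R" "\<Omega> \<subseteq> cball 0 R"
begin

definition V :: real where "V = measure lebesgue (cball (0::real^'n) (R + 1))"

text \<open>Chosen so that \<open>alexandrov_estimate\<close> for a set of volume at most
  \<open>d * V\<close> reads \<open>h \<le> C0 * d powr (2 / n)\<close>.\<close>

definition C0 :: real where
  "C0 = root CARD('n) ((2 * real CARD('n) ^ 2) ^ CARD('n) * Lam * V\<^sup>2)"

lemma V_pos: "0 < V"
  using R by (simp add: V_def content_cball_pos)

lemma C0_nonneg: "0 \<le> C0"
  using lam lamLam by (simp add: C0_def)

lemma C0_power: "C0 ^ CARD('n) = (2 * real CARD('n) ^ 2) ^ CARD('n) * Lam * V\<^sup>2"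
  unfolding C0_def using lam lamLam by (intro real_root_pow_pos2) auto

lemma closure_cball: "closure \<Omega> \<subseteq> cball 0 R"
  using R by (intro closure_minimal) auto

lemma slab_volume:
  assumes e: "norm e = 1" and A: "A \<in> sets borel" "A \<subseteq> \<Omega>" and d: "0 \<le> d"
    and slab: "\<And>x. x \<in> A \<Longrightarrow> s \<le> e \<bullet> x \<and> e \<bullet> x \<le> s + d"
  shows "measure lebesgue A \<le> d * V"
proof -
  have "A \<subseteq> cball 0 R" using A(2) R(2) by blast
  then have "emeasure lborel A \<le> ennreal d * emeasure lborel (cball (0::real^'n) (R + 1))"
    by (rule slab_emeasure[OF e A(1) _ d slab])
  moreover have "emeasure lborel (cball (0::real^'n) (R + 1)) = ennreal V"
    unfolding V_def using emeasure_eq_measure2[OF lmeasurable_cball[of "0::real^'n" "R + 1"]] by simp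
  moreover have "A \<in> lmeasurable"
    using A bounded_subset[OF bdd] by (simp add: bounded_set_imp_lmeasurable)
  then have "emeasure lborel A = ennreal (measure lebesgue A)"
    using emeasure_eq_measure2[of A lebesgue] A(1) by simp
  ultimately have "ennreal (measure lebesgue A) \<le> ennreal d * ennreal V" by simp
  then show ?thesis using d V_pos by (simp add: ennreal_le_iff flip: ennreal_mult)
qed

lemma u_lower_bound: "x \<in> \<Omega> \<Longrightarrow> - u x \<le> C0"
proof -
  assume x: "x \<in> \<Omega>"
  have "(- u x) ^ CARD('n) \<le> (2 * real CARD('n) ^ 2) ^ CARD('n) * Lam * (measure lebesgue \<Omega>)\<^sup>2"
    by (rule alexandrov_estimate[of _ x 0 0]) (use op cvx x bzero u_neg[OF x] in auto)
  also have "\<dots> \<le> (2 * real CARD('n) ^ 2) ^ CARD('n) * Lam * V\<^sup>2"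
  proof (intro mult_left_mono power_mono)
    have "\<Omega> \<subseteq> cball 0 (R + 1)" using R by auto
    then show "measure lebesgue \<Omega> \<le> V"
      unfolding V_def using op by (intro measure_mono_fmeasurable) auto
  qed (use lam lamLam in auto)
  also have "\<dots> = C0 ^ CARD('n)" by (rule C0_power[symmetric])
  finally show ?thesis
    using power_mono_iff[of "- u x" C0 "CARD('n)"] C0_nonneg u_neg[OF x] by simp
qed

text \<open>Compare with the linear function that is 0 on the hyperplane and \<open>- M\<close> at
  distance \<open>d\<close>; it lies below \<open>u\<close> on the boundary of the slab. Up to
  distance \<open>d / 2\<close> it is at least \<open>- M / 2\<close>, and the Aleksandrov estimate
  in the slab bounds the depth of \<open>u\<close> below it.\<close>

lemma decay_step:
  assumes e: "norm e = 1" "\<And>y. y \<in> \<Omega> \<Longrightarrow> 0 < e \<bullet> (y - z)" and d: "0 < d" and M: "0 \<le> M"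
    and bd: "\<And>x. x \<in> \<Omega> \<Longrightarrow> e \<bullet> (x - z) \<le> d \<Longrightarrow> - u x \<le> M"
    and x: "x \<in> \<Omega>" "e \<bullet> (x - z) \<le> d / 2"
  shows "- u x \<le> M / 2 + C0 * d powr (2 / real CARD('n))"
proof -
  let ?n = "real CARD('n)"
  define q where "q = - (M / d) *\<^sub>R e"
  define a where "a = M / d * (e \<bullet> z)"
  have l: "q \<bullet> y + a = - (M / d) * (e \<bullet> (y - z))" for y by (simp add: q_def a_def inner_diff_right algebra_simps)
  define h where "h = q \<bullet> x + a - u x"
  have lx: "- (q \<bullet> x + a) \<le> M / 2"
  proof -
    have "M / d * (e \<bullet> (x - z)) \<le> M / d * (d / 2)" using M d x by (intro mult_left_mono) auto
    then show ?thesis using d by (simp add: l)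
  qed
  have "h \<le> C0 * d powr (2 / ?n)"
  proof (cases "h \<le> 0")
    case True
    then show ?thesis using C0_nonneg by (meson mult_nonneg_nonneg order_trans powr_ge_zero)
  next
    case False
    define D where "D = \<Omega> \<inter> {y. e \<bullet> (y - z) < d}"
    have Do: "open D" unfolding D_def by (intro open_Int op open_Collect_less continuous_intros)
    have Dc: "convex D"
    proof -
      have "{y. e \<bullet> (y - z) < d} = {y. e \<bullet> y < d + e \<bullet> z}" by (auto simp: inner_diff_right)
      then show ?thesis unfolding D_def by (intro convex_Int cvx) (simp add: convex_halfspace_lt)
    qed
    have "h ^ CARD('n) \<le> (2 * ?n ^ 2) ^ CARD('n) * Lam * (measure lebesgue D)\<^sup>2"
    proof (rule alexandrov_estimate[OF Do Dc])
      show "D \<subseteq> \<Omega>" by (auto simp: D_def)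
      show "x \<in> D" using x d by (auto simp: D_def)
      show "u x = q \<bullet> x + a - h" by (simp add: h_def)
      show "0 < h" using False by simp
      fix y assume "y \<in> frontier D"
      then have y: "y \<in> closure D" "y \<notin> D" using Do by (auto simp: frontier_def interior_open)
      have yO: "y \<in> closure \<Omega>" using y(1) closure_mono[of D \<Omega>] by (auto simp: D_def)
      have "closed {y. 0 \<le> e \<bullet> (y - z) \<and> e \<bullet> (y - z) \<le> d}"
        by (intro closed_Collect_conj closed_Collect_le continuous_intros)
      moreover have "D \<subseteq> {y. 0 \<le> e \<bullet> (y - z) \<and> e \<bullet> (y - z) \<le> d}"
        using e(2) by (auto simp: D_def less_imp_le)
      ultimately have yd: "0 \<le> e \<bullet> (y - z)" "e \<bullet> (y - z) \<le> d" using y(1) closure_minimal by blast+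
      show "q \<bullet> y + a \<le> u y"
      proof (cases "y \<in> \<Omega>")
        case True
        then have "e \<bullet> (y - z) = d" using y(2) yd by (auto simp: D_def)
        then show ?thesis using bd[OF True] d by (simp add: l)
      next
        case False
        then have "u y = 0" using bzero yO frontier_iff by blast
        moreover have "0 \<le> M / d * (e \<bullet> (y - z))" using M d yd by (intro mult_nonneg_nonneg) auto
        ultimately show ?thesis by (simp add: l)
      qed
    qed
    also have "\<dots> \<le> (2 * ?n ^ 2) ^ CARD('n) * Lam * (d * V)\<^sup>2"
    proof (intro mult_left_mono power_mono)
      show "measure lebesgue D \<le> d * V"
        by (rule slab_volume[OF e(1), of _ _ "e \<bullet> z"])
          (use Do d e(2) in \<open>auto simp: D_def inner_diff_right less_imp_le\<close>)
    qed (use lam lamLam in auto)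
    also have "\<dots> = C0 ^ CARD('n) * d ^ 2" by (simp add: C0_power power_mult_distrib)
    also have "d ^ 2 = (d powr (2 / ?n)) ^ CARD('n)"
      using d by (simp add: powr_powr flip: powr_realpow powr_numeral)
    finally have "h ^ CARD('n) \<le> (C0 * d powr (2 / ?n)) ^ CARD('n)" by (simp add: power_mult_distrib)
    then show ?thesis
      using power_mono_iff[of h "C0 * d powr (2 / ?n)" "CARD('n)"] False C0_nonneg by simp
  qed
  then show ?thesis using lx by (simp add: h_def)
qed

lemma slab_width:
  assumes e: "norm e = 1" and z: "z \<in> closure \<Omega>" and x: "x \<in> closure \<Omega>"
  shows "e \<bullet> (x - z) \<le> 2 * R"
proof -
  have "e \<bullet> (x - z) \<le> norm e * norm (x - z)" by (rule norm_cauchy_schwarz)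
  also have "\<dots> \<le> norm x + norm z" using e norm_triangle_ineq4 by simp
  also have "\<dots> \<le> R + R" using x z closure_cball by (intro add_mono) auto
  finally show ?thesis by simp
qed

lemma decay_dyadic:
  assumes e: "norm e = 1" "\<And>y. y \<in> \<Omega> \<Longrightarrow> 0 < e \<bullet> (y - z)" and z: "z \<in> closure \<Omega>"
    and m0: "C0 \<le> m 0" and m: "\<And>k. 0 \<le> m k" "\<And>k. m k / 2 + C0 * (2 * R / 2 ^ k) powr (2 / real CARD('n)) \<le> m (Suc k)"
    and x: "x \<in> \<Omega>" "e \<bullet> (x - z) \<le> 2 * R / 2 ^ k"
  shows "- u x \<le> m k"
  using x
proof (induction k arbitrary: x)
  case 0
  then show ?case using u_lower_bound m0 by force
next
  case (Suc k)
  have "- u x \<le> m k / 2 + C0 * (2 * R / 2 ^ k) powr (2 / real CARD('n))"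
    by (rule decay_step[OF e _ m(1)]) (use R Suc in \<open>auto simp: mult.commute\<close>)
  then show ?case using m(2)[of k] by linarith
qed

text \<open>A geometric sequence of ratio \<open>2 powr - \<alpha>\<close> solves the recursion if
  it decays no faster than the error, which is \<open>\<alpha> \<le> 2 / n\<close>, and strictly
  more slowly than the halving. The gap \<open>g\<close> between its ratio and 1/2 is positive
  because \<open>\<alpha> < 1\<close>.\<close>

lemma decay_powr:
  assumes \<alpha>: "0 < \<alpha>" "\<alpha> < 1" "\<alpha> \<le> 2 / real CARD('n)"
    and e: "norm e = 1" "\<And>y. y \<in> \<Omega> \<Longrightarrow> 0 < e \<bullet> (y - z)" and z: "z \<in> closure \<Omega>"
    and x: "x \<in> \<Omega>" "e \<bullet> (x - z) \<le> 2 * R / 2 ^ k"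
  shows "- u x \<le> C0 * (1 + (2 * R) powr (2 / real CARD('n)) / (2 powr - \<alpha> - 1/2)) * 2 powr (- \<alpha> * real k)"
proof -
  let ?n = "real CARD('n)"
  define g where "g = 2 powr - \<alpha> - 1/2"
  define B where "B = (2 * R) powr (2 / ?n)"
  have g: "g > 0" using \<alpha> powr_less_mono[of "-1" "- \<alpha>" 2] by (simp add: g_def powr_minus_divide)
  have B: "B \<ge> 0" by (simp add: B_def)
  define m where "m k = C0 * (1 + B / g) * 2 powr (- \<alpha> * real k)" for k
  have "- u x \<le> m k"
  proof (rule decay_dyadic[OF e z _ _ _ x])
    show "C0 \<le> m 0" using C0_nonneg g B by (simp add: m_def mult_le_cancel_left1)
    show "0 \<le> m k" for k using C0_nonneg g B by (simp add: m_def)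
    show "m k / 2 + C0 * (2 * R / 2 ^ k) powr (2 / ?n) \<le> m (Suc k)" for k
    proof -
      let ?E = "2 powr (- \<alpha> * real k)"
      have "(2 * R / 2 ^ k) powr (2 / ?n) = B * (2 powr (- real k)) powr (2 / ?n)"
        using R by (simp add: B_def powr_divide powr_minus_divide powr_realpow flip: powr_mult)
      also have "(2 powr (- real k)) powr (2 / ?n) = 2 powr (- real k * (2 / ?n))" by (rule powr_powr)
      also have "\<dots> \<le> ?E"
      proof -
        have "real k * \<alpha> \<le> real k * (2 / ?n)" using \<alpha> by (intro mult_left_mono) auto
        then show ?thesis by (intro powr_mono) (auto simp: mult.commute)
      qed
      finally have 1: "(2 * R / 2 ^ k) powr (2 / ?n) \<le> B * ?E" using B by (simp add: mult_left_mono)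
      have "m k / 2 + C0 * (2 * R / 2 ^ k) powr (2 / ?n) \<le> m k / 2 + C0 * (B * ?E)"
        using 1 C0_nonneg by (intro add_left_mono mult_left_mono)
      also have "\<dots> = C0 * ?E * ((1 + B / g) / 2 + B)" by (simp add: m_def field_simps)
      also have "\<dots> \<le> C0 * ?E * ((1 + B / g) * (g + 1/2))"
      proof (intro mult_left_mono)
        have "(1 + B / g) * (g + 1/2) = (1 + B / g) / 2 + g + B" using g by (simp add: field_simps)
        then show "(1 + B / g) / 2 + B \<le> (1 + B / g) * (g + 1/2)" using g by simp
      qed (use C0_nonneg in auto)
      also have "\<dots> = C0 * (1 + B / g) * (?E * 2 powr - \<alpha>)" by (simp add: g_def)
      also have "?E * 2 powr - \<alpha> = 2 powr (- \<alpha> * real (Suc k))" by (simp add: powr_add[symmetric] algebra_simps)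
      finally show ?thesis by (simp add: m_def)
    qed
  qed
  then show ?thesis by (simp add: m_def g_def B_def)
qed

text \<open>For \<open>n = 2\<close> the error is of order \<open>2 ^ - k\<close>, in resonance with
  the halving, so each step adds the same multiple of \<open>2 ^ - k\<close>; this is the factor
  \<open>Suc k\<close>. For larger \<open>n\<close> the exponent \<open>2 / n\<close> is admissible
  in \<open>decay_powr\<close>, and the bound is weakened to the common form.\<close>

lemma decay_critical:
  assumes n: "CARD('n) \<ge> 2"
  obtains B where "B > 0"
    "\<And>e z x k. norm e = 1 \<Longrightarrow> (\<And>y. y \<in> \<Omega> \<Longrightarrow> 0 < e \<bullet> (y - z)) \<Longrightarrow> z \<in> closure \<Omega> \<Longrightarrow> x \<in> \<Omega> \<Longrightarrow>
      e \<bullet> (x - z) \<le> 2 * R / 2 ^ k \<Longrightarrow> - u x \<le> B * (real (Suc k) / 2 ^ k) powr (2 / real CARD('n))"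
proof (cases "CARD('n) = 2")
  case True
  define B where "B = 2 * C0 * (1 + 2 * R) + 1"
  have B: "B > 0" using C0_nonneg R by (simp add: B_def add_nonneg_pos)
  show thesis
  proof (rule that[OF B])
    fix e z x k assume H: "norm e = 1" "\<And>y. y \<in> \<Omega> \<Longrightarrow> 0 < e \<bullet> (y - z)" "z \<in> closure \<Omega>" "x \<in> \<Omega>"
      "e \<bullet> (x - z) \<le> 2 * R / 2 ^ k"
    have "- u x \<le> B * (real (Suc k) / 2 ^ k)"
    proof (rule decay_dyadic[OF H(1-3) _ _ _ H(4,5)])
      have "C0 * 1 \<le> C0 * (2 * (1 + 2 * R))" using C0_nonneg R by (intro mult_left_mono) auto
      then show "C0 \<le> B * (real (Suc 0) / 2 ^ 0)" by (simp add: B_def algebra_simps)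
      show "0 \<le> B * (real (Suc k) / 2 ^ k)" for k using B by simp
      show "B * (real (Suc k) / 2 ^ k) / 2 + C0 * (2 * R / 2 ^ k) powr (2 / real CARD('n)) \<le> B * (real (Suc (Suc k)) / 2 ^ Suc k)" for k
      proof -
        have "C0 * (2 * R) \<le> B / 2" using C0_nonneg by (simp add: B_def algebra_simps)
        then have "C0 * (2 * R) / 2 ^ k \<le> B / 2 / 2 ^ k" by (intro divide_right_mono) auto
        then show ?thesis using True R by (simp add: field_simps)
      qed
    qed
    then show "- u x \<le> B * (real (Suc k) / 2 ^ k) powr (2 / real CARD('n))" using True by simp
  qed
next
  case False
  let ?\<alpha> = "2 / real CARD('n)"
  have \<alpha>: "0 < ?\<alpha>" "?\<alpha> < 1" using n False by (auto simp: field_simps)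
  define B where "B = C0 * (1 + (2 * R) powr ?\<alpha> / (2 powr - ?\<alpha> - 1/2)) + 1"
  have g: "2 powr - ?\<alpha> - 1/2 > 0" using \<alpha> powr_less_mono[of "-1" "- ?\<alpha>" 2] by (simp add: powr_minus_divide)
  have B: "B > 0" using C0_nonneg g by (simp add: B_def add_nonneg_pos)
  show thesis
  proof (rule that[OF B])
    fix e z x k assume H: "norm e = 1" "\<And>y. y \<in> \<Omega> \<Longrightarrow> 0 < e \<bullet> (y - z)" "z \<in> closure \<Omega>" "x \<in> \<Omega>"
      "e \<bullet> (x - z) \<le> 2 * R / 2 ^ k"
    have "- u x \<le> (B - 1) * 2 powr (- ?\<alpha> * real k)"
      using decay_powr[OF \<alpha> order_refl H] by (simp add: B_def)
    also have "\<dots> \<le> B * (real (Suc k) / 2 ^ k) powr ?\<alpha>"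
    proof (rule mult_mono)
      have "2 powr (- ?\<alpha> * real k) = (2 powr (- real k)) powr ?\<alpha>" by (simp add: powr_powr mult.commute)
      also have "\<dots> \<le> (real (Suc k) / 2 ^ k) powr ?\<alpha>"
        by (rule powr_mono2) (use \<alpha> in \<open>auto simp: powr_minus_divide powr_realpow divide_right_mono\<close>)
      finally show "2 powr (- ?\<alpha> * real k) \<le> (real (Suc k) / 2 ^ k) powr ?\<alpha>" .
    qed (use B in auto)
    finally show "- u x \<le> B * (real (Suc k) / 2 ^ k) powr (2 / real CARD('n))" .
  qed
qed

end

section \<open>Integrability of the Hessian\<close>

lemma nn_integral_diffquot_step:
  fixes \<psi> :: "real \<Rightarrow> real"
  assumes mono: "\<And>s t. s \<le> t \<Longrightarrow> \<psi> s \<le> \<psi> t" and nn: "\<And>t. 0 \<le> \<psi> t" and top: "\<And>t. \<psi> t \<le> M"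
    and lr: "l \<le> r" and h: "0 < h"
  shows "(\<integral>\<^sup>+t\<in>{l..<r}. ennreal (\<psi> (t + h) - \<psi> t) \<partial>lborel) \<le> ennreal (h * M)"
proof -
  have [measurable]: "\<psi> \<in> borel_measurable borel"
    by (rule borel_measurable_mono) (simp add: mono monoI)
  have M: "0 \<le> M" using nn[of 0] top[of 0] by linarith
  let ?f = "\<lambda>t. ennreal (\<psi> (t + h)) * indicator {l..<r} t" and ?g = "\<lambda>t. ennreal (\<psi> t) * indicator {l..<r} t"
  have gfin: "(\<integral>\<^sup>+t. ?g t \<partial>lborel) \<noteq> \<infinity>"
  proof -
    have "(\<integral>\<^sup>+t. ?g t \<partial>lborel) \<le> (\<integral>\<^sup>+t. ennreal M * indicator {l..<r} t \<partial>lborel)"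
      by (intro nn_integral_mono mult_right_mono ennreal_leI top) auto
    also have "\<dots> = ennreal M * ennreal (r - l)" using lr by (subst nn_integral_cmult_indicator) auto
    also have "\<dots> < \<infinity>" by (simp add: ennreal_mult_less_top)
    finally show ?thesis by simp
  qed
  have "(\<integral>\<^sup>+t. ?f t \<partial>lborel) \<le> (\<integral>\<^sup>+t. ?g t \<partial>lborel) + ennreal (h * M)"
  proof -
    have "(\<integral>\<^sup>+t. ?f t \<partial>lborel) = (\<integral>\<^sup>+t. ennreal (\<psi> (t + h)) * indicator {l+h..<r+h} (t + h) \<partial>lborel)"
      by (intro nn_integral_cong) (auto simp: indicator_def)
    also have "\<dots> = (\<integral>\<^sup>+s. ennreal (\<psi> s) * indicator {l+h..<r+h} s \<partial>distr lborel borel ((+) h))"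
      by (subst nn_integral_distr) (auto simp: add.commute)
    also have "\<dots> = (\<integral>\<^sup>+s. ennreal (\<psi> s) * indicator {l+h..<r+h} s \<partial>lborel)" by (simp add: lborel_distr_plus)
    \<comment> \<open>After the shift by \<open>h\<close> only \<open>{r..<r+h}\<close> is left
      unmatched, and \<open>\<psi> \<le> M\<close> there.\<close>
    also have "\<dots> \<le> (\<integral>\<^sup>+s. ?g s + ennreal M * indicator {r..<r+h} s \<partial>lborel)"
      using h top by (intro nn_integral_mono) (auto simp: indicator_def ennreal_leI)
    also have "\<dots> = (\<integral>\<^sup>+t. ?g t \<partial>lborel) + (\<integral>\<^sup>+s. ennreal M * indicator {r..<r+h} s \<partial>lborel)"
      by (rule nn_integral_add) auto
    also have "(\<integral>\<^sup>+s. ennreal M * indicator {r..<r+h} s \<partial>lborel) = ennreal (h * M)"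
      using h M by (subst nn_integral_cmult_indicator) (auto simp: ennreal_mult'[symmetric] mult.commute)
    finally show ?thesis .
  qed
  moreover have "(\<integral>\<^sup>+t\<in>{l..<r}. ennreal (\<psi> (t + h) - \<psi> t) \<partial>lborel) = (\<integral>\<^sup>+t. ?f t - ?g t \<partial>lborel)"
    by (intro nn_integral_cong) (auto simp: indicator_def ennreal_minus nn)
  moreover have "\<dots> = (\<integral>\<^sup>+t. ?f t \<partial>lborel) - (\<integral>\<^sup>+t. ?g t \<partial>lborel)"
    using gfin h mono by (intro nn_integral_diff) (auto simp: indicator_def intro!: AE_I2 ennreal_leI)
  ultimately show ?thesis
    using gfin by (simp add: ennreal_minus_le_iff add.commute)
qed

text \<open>Fatou's lemma with telescoping: the easy half of Lebesgue's theorem, an inequality that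
  simply omits any singular part. Clamping \<open>t\<close> to \<open>{l..r}\<close> makes the
  function monotone on the line, and on \<open>{l..<r}\<close> the quotients agree for large
  \<open>k\<close>.\<close>

lemma nn_integral_diffquot_mono:
  fixes \<phi> :: "real \<Rightarrow> real"
  assumes lr: "l \<le> r" and mono: "\<And>s t. l \<le> s \<Longrightarrow> s \<le> t \<Longrightarrow> t \<le> r \<Longrightarrow> \<phi> s \<le> \<phi> t"
  shows "(\<integral>\<^sup>+t\<in>{l..<r}. liminf (\<lambda>k. ennreal (real (Suc k) * (\<phi> (t + 1 / real (Suc k)) - \<phi> t))) \<partial>lborel)
    \<le> ennreal (\<phi> r - \<phi> l)"
proof -
  define \<psi> where "\<psi> t = \<phi> (max l (min t r)) - \<phi> l" for t
  have pm: "\<psi> s \<le> \<psi> t" if "s \<le> t" for s t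
    using that lr unfolding \<psi>_def by (intro diff_right_mono mono) auto
  have pn: "0 \<le> \<psi> t" for t using mono[of l "max l (min t r)"] lr by (simp add: \<psi>_def)
  have pt: "\<psi> t \<le> \<phi> r - \<phi> l" for t using mono[of "max l (min t r)" r] lr by (simp add: \<psi>_def)
  have [measurable]: "\<psi> \<in> borel_measurable borel"
    by (rule borel_measurable_mono) (simp add: pm monoI)
  let ?q = "\<lambda>k t. ennreal (real (Suc k) * (\<psi> (t + 1 / real (Suc k)) - \<psi> t)) * indicator {l..<r} t"
  have "(\<integral>\<^sup>+t\<in>{l..<r}. liminf (\<lambda>k. ennreal (real (Suc k) * (\<phi> (t + 1 / real (Suc k)) - \<phi> t))) \<partial>lborel)
      = (\<integral>\<^sup>+t. liminf (\<lambda>k. ?q k t) \<partial>lborel)"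
  proof (rule nn_integral_cong)
    fix t :: real
    show "liminf (\<lambda>k. ennreal (real (Suc k) * (\<phi> (t + 1 / real (Suc k)) - \<phi> t))) * indicator {l..<r} t = liminf (\<lambda>k. ?q k t)"
    proof (cases "t \<in> {l..<r}")
      case True
      then have "\<forall>\<^sub>F k in sequentially. 1 / real (Suc k) < r - t"
        using order_tendstoD(2)[OF LIMSEQ_Suc[OF lim_1_over_n], of "r - t"] by simp
      then have "\<forall>\<^sub>F k in sequentially. ennreal (real (Suc k) * (\<phi> (t + 1 / real (Suc k)) - \<phi> t)) = ?q k t"
      proof eventually_elim
        case (elim k)
        have "l \<le> t + 1 / real (Suc k)" using True by (simp add: add_increasing2)
        moreover have "t + 1 / real (Suc k) \<le> r" using elim by linarith
        ultimately show ?case using True by (simp add: \<psi>_def max_def min_def)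
      qed
      then have "liminf (\<lambda>k. ennreal (real (Suc k) * (\<phi> (t + 1 / real (Suc k)) - \<phi> t))) = liminf (\<lambda>k. ?q k t)"
        by (rule Liminf_eq)
      then show ?thesis using True by simp
    qed (simp add: Liminf_const)
  qed
  also have "\<dots> \<le> liminf (\<lambda>k. (\<integral>\<^sup>+t. ?q k t \<partial>lborel))"
    by (rule nn_integral_liminf) measurable
  also have "\<dots> \<le> liminf (\<lambda>k. ennreal (\<phi> r - \<phi> l))"
  proof (intro Liminf_mono always_eventually allI)
    fix k
    have "(\<integral>\<^sup>+t. ?q k t \<partial>lborel) = (\<integral>\<^sup>+t. ennreal (real (Suc k)) * (ennreal (\<psi> (t + 1 / real (Suc k)) - \<psi> t) * indicator {l..<r} t) \<partial>lborel)"
      by (intro nn_integral_cong) (simp add: ennreal_mult' mult.assoc del: of_nat_Suc)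
    also have "\<dots> = ennreal (real (Suc k)) * (\<integral>\<^sup>+t. ennreal (\<psi> (t + 1 / real (Suc k)) - \<psi> t) * indicator {l..<r} t \<partial>lborel)"
      by (rule nn_integral_cmult) measurable
    also have "\<dots> \<le> ennreal (real (Suc k)) * ennreal (1 / real (Suc k) * (\<phi> r - \<phi> l))"
      by (intro mult_left_mono nn_integral_diffquot_step pm pn pt lr) auto
    also have "\<dots> = ennreal (real (Suc k) * (1 / real (Suc k) * (\<phi> r - \<phi> l)))"
      by (rule ennreal_mult'[symmetric]) simp
    also have "real (Suc k) * (1 / real (Suc k) * (\<phi> r - \<phi> l)) = \<phi> r - \<phi> l" by simp
    finally show "(\<integral>\<^sup>+t. ?q k t \<partial>lborel) \<le> ennreal (\<phi> r - \<phi> l)" .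
  qed
  also have "\<dots> = ennreal (\<phi> r - \<phi> l)" by (simp add: Liminf_const)
  finally show ?thesis .
qed

text \<open>Split at \<open>c\<close>: below it the power is at most that of \<open>c\<close>, above
  it the decreasing power \<open>\<delta> - 1\<close> is. For infinite \<open>X\<close> the left
  side is 0, as \<open>enn2real\<close> sends infinity to 0.\<close>

lemma ennreal_powr_le_linear:
  fixes X :: ennreal
  assumes c: "0 < c" and \<delta>: "0 < \<delta>" "\<delta> < 1"
  shows "ennreal (enn2real X powr \<delta>) \<le> ennreal (c powr \<delta>) + ennreal (c powr (\<delta> - 1)) * X"
proof (cases X)
  case (real x)
  show ?thesis
  proof (cases "x \<le> c")
    case True
    then have "x powr \<delta> \<le> c powr \<delta>" using real \<delta> by (intro powr_mono2) auto
    then show ?thesis using real by (simp add: ennreal_leI add_increasing2)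
  next
    case False
    then have x: "0 < x" using c by simp
    have "x powr \<delta> = x powr (\<delta> - 1) * x" using x by (simp add: powr_mult_base[symmetric] mult.commute powr_diff)
    also have "\<dots> \<le> c powr (\<delta> - 1) * x"
      using False c \<delta> x by (intro mult_right_mono powr_mono2') auto
    finally show ?thesis using real by (simp add: ennreal_leI add_increasing flip: ennreal_mult')
  qed
next
  case top
  then show ?thesis using \<delta> by simp
qed

lemma nn_integral_powr_interval:
  fixes H :: "real \<Rightarrow> ennreal"
  assumes [measurable]: "H \<in> borel_measurable borel" and c: "0 < c" and \<delta>: "0 < \<delta>" "\<delta> < 1" and lr: "l \<le> r"
    and D: "0 \<le> D" "(\<integral>\<^sup>+t\<in>{l..<r}. H t \<partial>lborel) \<le> ennreal D"
  shows "(\<integral>\<^sup>+t\<in>{l..<r}. ennreal (enn2real (H t) powr \<delta>) \<partial>lborel) \<le> ennreal ((r - l) * c powr \<delta> + c powr (\<delta> - 1) * D)"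
proof -
  have "(\<integral>\<^sup>+t\<in>{l..<r}. ennreal (enn2real (H t) powr \<delta>) \<partial>lborel) \<le>
      (\<integral>\<^sup>+t. ennreal (c powr \<delta>) * indicator {l..<r} t + ennreal (c powr (\<delta> - 1)) * (H t * indicator {l..<r} t) \<partial>lborel)"
    using ennreal_powr_le_linear[OF c \<delta>] by (intro nn_integral_mono) (auto simp: indicator_def)
  also have "\<dots> = ennreal (c powr \<delta>) * ennreal (r - l) + ennreal (c powr (\<delta> - 1)) * (\<integral>\<^sup>+t\<in>{l..<r}. H t \<partial>lborel)"
    using lr by (subst nn_integral_add) (auto simp: nn_integral_cmult nn_integral_cmult_indicator)
  also have "\<dots> \<le> ennreal (c powr \<delta>) * ennreal (r - l) + ennreal (c powr (\<delta> - 1)) * ennreal D"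
    by (intro add_left_mono mult_left_mono D) auto
  also have "\<dots> = ennreal ((r - l) * c powr \<delta> + c powr (\<delta> - 1) * D)"
    using lr D by (simp add: ennreal_plus mult.commute flip: ennreal_mult')
  finally show ?thesis .
qed

text \<open>On an interval of length \<open>t\<close> the choice
  \<open>c = t powr (\<alpha> - 2)\<close>, the expected size of \<open>H\<close> there, balances
  both terms of \<open>nn_integral_powr_interval\<close> to order
  \<open>t powr (1 - \<delta> * (2 - \<alpha>))\<close>. This is a geometric sequence in
  \<open>j\<close>, and \<open>\<tau> \<le> R\<close> gives a bound common to all chords.\<close>

lemma nn_integral_powr_dyadic:
  fixes H :: "real \<Rightarrow> ennreal" and l :: "nat \<Rightarrow> real"
  assumes H: "H \<in> borel_measurable borel" and \<delta>: "0 < \<delta>" "\<delta> < 1" and K: "0 \<le> K" and \<tau>: "0 < \<tau>" "\<tau> \<le> R"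
    and s: "0 < 1 - \<delta> * (2 - \<alpha>)"
    and D: "\<And>j. (\<integral>\<^sup>+t\<in>{l j..<l j + \<tau> / 2 ^ j}. H t \<partial>lborel) \<le> ennreal (2 * K * (\<tau> / 2 ^ j) powr (\<alpha> - 1))"
  shows "(\<integral>\<^sup>+t\<in>(\<Union>j. {l j..<l j + \<tau> / 2 ^ j}). ennreal (enn2real (H t) powr \<delta>) \<partial>lborel)
    \<le> ennreal ((1 + 2 * K) * R powr (1 - \<delta> * (2 - \<alpha>)) / (1 - 2 powr - (1 - \<delta> * (2 - \<alpha>))))"
proof -
  note [measurable] = H
  define s where "s = 1 - \<delta> * (2 - \<alpha>)"
  define q where "q = 2 powr - s"
  have q: "0 < q" "q < 1" using s powr_less_mono[of "- s" 0 2] by (auto simp: q_def s_def)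
  let ?I = "\<lambda>j. {l j..<l j + \<tau> / 2 ^ j}" and ?F = "\<lambda>t. ennreal (enn2real (H t) powr \<delta>)"
  have step: "(\<integral>\<^sup>+t\<in>?I j. ?F t \<partial>lborel) \<le> ennreal ((1 + 2 * K) * R powr s * q ^ j)" for j
  proof -
    let ?t = "\<tau> / 2 ^ j"
    have t: "?t > 0" using \<tau> by simp
    have "(\<integral>\<^sup>+t\<in>?I j. ?F t \<partial>lborel) \<le>
        ennreal ((l j + ?t - l j) * (?t powr (\<alpha> - 2)) powr \<delta> + (?t powr (\<alpha> - 2)) powr (\<delta> - 1) * (2 * K * ?t powr (\<alpha> - 1)))"
      by (rule nn_integral_powr_interval[OF H _ \<delta> _ _ D]) (use t K in auto)
    also have "(l j + ?t - l j) * (?t powr (\<alpha> - 2)) powr \<delta> = ?t powr s"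
    proof -
      have "?t * (?t powr (\<alpha> - 2)) powr \<delta> = ?t powr 1 * ?t powr ((\<alpha> - 2) * \<delta>)" using \<tau> by (simp add: powr_powr)
      also have "\<dots> = ?t powr s" unfolding powr_add[symmetric] by (simp add: s_def algebra_simps)
      finally show ?thesis by simp
    qed
    also have "(?t powr (\<alpha> - 2)) powr (\<delta> - 1) * (2 * K * ?t powr (\<alpha> - 1)) = 2 * K * ?t powr s"
    proof -
      have "(?t powr (\<alpha> - 2)) powr (\<delta> - 1) * ?t powr (\<alpha> - 1) = ?t powr s"
        unfolding powr_powr powr_add[symmetric] by (simp add: s_def algebra_simps)
      then show ?thesis by (simp add: mult_ac)
    qed
    also have "?t powr s + 2 * K * ?t powr s = (1 + 2 * K) * (?t powr s)" by (simp add: algebra_simps)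
    also have "?t powr s \<le> (R / 2 ^ j) powr s"
      using \<tau> s by (intro powr_mono2 divide_right_mono) (auto simp: s_def)
    also have "(R / 2 ^ j) powr s = R powr s * q ^ j"
    proof -
      have "(2 ^ j) powr s = inverse (q ^ j)"
        by (simp add: q_def powr_minus power_inverse powr_powr powr_power flip: powr_realpow)
          (simp add: mult.commute)
      moreover have "(R / 2 ^ j) powr s = R powr s / (2 ^ j) powr s" by (rule powr_divide)
      ultimately show ?thesis by (simp add: divide_inverse)
    qed
    finally show ?thesis using K by (simp add: mult.assoc ennreal_leI mult_left_mono)
  qed
  have "(\<integral>\<^sup>+t\<in>(\<Union>j. ?I j). ?F t \<partial>lborel) \<le> (\<integral>\<^sup>+t. (\<Sum>j. ?F t * indicator (?I j) t) \<partial>lborel)"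
  proof (rule nn_integral_mono)
    fix t
    show "?F t * indicator (\<Union>j. ?I j) t \<le> (\<Sum>j. ?F t * indicator (?I j) t)"
    proof (cases "t \<in> (\<Union>j. ?I j)")
      case True
      then obtain j where j: "t \<in> ?I j" by blast
      define f :: "nat \<Rightarrow> ennreal" where "f j = ?F t * indicator (?I j) t" for j
      have "f j \<le> suminf f" using sum_le_suminf[of f "{j}"] by simp
      moreover have "?F t * indicator (\<Union>j. ?I j) t = f j" using True j by (simp add: f_def)
      ultimately show ?thesis by (simp only: f_def[abs_def])
    qed simp
  qed
  also have "\<dots> = (\<Sum>j. \<integral>\<^sup>+t. ?F t * indicator (?I j) t \<partial>lborel)"
    by (rule nn_integral_suminf) measurable
  also have "\<dots> \<le> (\<Sum>j. ennreal ((1 + 2 * K) * R powr s * q ^ j))"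
    by (intro suminf_le step) auto
  also have "\<dots> = ennreal (\<Sum>j. (1 + 2 * K) * R powr s * q ^ j)"
    using q K by (intro suminf_ennreal2) (auto intro!: summable_mult summable_geometric)
  also have "(\<Sum>j. (1 + 2 * K) * R powr s * q ^ j) = (1 + 2 * K) * R powr s * (1 / (1 - q))"
    using q by (subst suminf_mult) (auto simp: suminf_geometric summable_geometric)
  finally show ?thesis by (simp add: s_def q_def)
qed


lemma mult_indicator_subset_Un:
  fixes F :: ennreal
  shows "J \<subseteq> A \<union> B \<Longrightarrow> F * indicator J t \<le> F * indicator A t + F * indicator B t"
  by (auto simp: indicator_def)

section \<open>Second derivatives along chords\<close>

context ma_ball
begin

text \<open>The measurable function \<open>second e\<close> is the second derivative in direction \<open>e\<close> almost everywhere. Elsewhere it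
  may be infinite, where \<open>enn2real\<close> yields 0.\<close>

definition second :: "real^'n \<Rightarrow> real^'n \<Rightarrow> ennreal" where
  "second e x = liminf (\<lambda>k. ennreal (dquot e k x \<bullet> e))"

lemma second_borel [measurable]: "second e \<in> borel_measurable borel"
  unfolding second_def[abs_def] by measurable

lemma second_eq:
  assumes x: "x \<in> \<Omega>" and A: "(grad has_derivative A) (at x)"
  shows "second e x = ennreal (A e \<bullet> e)"
proof -
  have "(\<lambda>k. ennreal (dquot e k x \<bullet> e)) \<longlonglongrightarrow> ennreal (A e \<bullet> e)"
    by (intro tendsto_intros dquot_lim[OF x A])
  then show ?thesis unfolding second_def by (intro lim_imp_Liminf) auto
qed

lemma second_interval:
  assumes lr: "l \<le> r" and inO: "\<And>t. l \<le> t \<Longrightarrow> t \<le> r \<Longrightarrow> x + t *\<^sub>R e \<in> \<Omega>"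
  shows "(\<integral>\<^sup>+t\<in>{l..<r}. second e (x + t *\<^sub>R e) \<partial>lborel) \<le> ennreal (grad (x + r *\<^sub>R e) \<bullet> e - grad (x + l *\<^sub>R e) \<bullet> e)"
proof -
  define \<phi> where "\<phi> t = grad0 (x + t *\<^sub>R e) \<bullet> e" for t
  have eq: "second e (x + t *\<^sub>R e) = liminf (\<lambda>k. ennreal (real (Suc k) * (\<phi> (t + 1 / real (Suc k)) - \<phi> t)))" for t
    unfolding second_def dquot_def \<phi>_def
    by (simp add: inner_diff_left scaleR_add_left add.assoc del: of_nat_Suc)
  have "(\<integral>\<^sup>+t\<in>{l..<r}. second e (x + t *\<^sub>R e) \<partial>lborel) \<le> ennreal (\<phi> r - \<phi> l)"
    unfolding eq
  proof (rule nn_integral_diffquot_mono[OF lr])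
    fix s t assume st: "l \<le> s" "s \<le> t" "t \<le> r"
    show "\<phi> s \<le> \<phi> t"
    proof (cases "s = t")
      case False
      have O: "x + s *\<^sub>R e \<in> \<Omega>" "x + t *\<^sub>R e \<in> \<Omega>" using inO st by auto
      have "x + t *\<^sub>R e - (x + s *\<^sub>R e) = (t - s) *\<^sub>R e" by (simp add: algebra_simps)
      then have "0 \<le> (t - s) * ((grad (x + t *\<^sub>R e) - grad (x + s *\<^sub>R e)) \<bullet> e)"
        using grad_mono[OF O] by simp
      then show ?thesis using False st O by (simp add: \<phi>_def grad0_def inner_diff_left zero_le_mult_iff)
    qed simp
  qed
  also have "\<phi> r - \<phi> l = grad (x + r *\<^sub>R e) \<bullet> e - grad (x + l *\<^sub>R e) \<bullet> e"
    using inO lr by (simp add: \<phi>_def grad0_def)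
  finally show ?thesis .
qed

text \<open>\<open>s\<close> may have either sign: the end of the chord before \<open>x\<close>
  bounds the directional derivative from below, the one after it from above.\<close>

lemma grad_chord_bounds:
  assumes x: "x \<in> \<Omega>" and y: "x + s *\<^sub>R e \<in> closure \<Omega>"
  shows "s * (grad x \<bullet> e) \<le> - u x"
proof -
  have "u x + grad x \<bullet> (x + s *\<^sub>R e - x) \<le> u (x + s *\<^sub>R e)" by (rule supporting_closure[OF grad[OF x] y])
  also have "\<dots> \<le> 0" by (rule u_nonpos[OF y])
  finally show ?thesis by simp
qed

text \<open>The constant of \<open>decay_powr\<close>, divided by \<open>R powr \<alpha>\<close> in
  passing from the scales \<open>2 * R / 2 ^ k\<close> to powers of the distance.\<close>

definition K1 :: "real \<Rightarrow> real" where
  "K1 \<alpha> = C0 * (1 + (2 * R) powr (2 / real CARD('n)) / (2 powr - \<alpha> - 1/2)) / R powr \<alpha>"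

lemma K1_nonneg: "\<alpha> < 1 \<Longrightarrow> 0 \<le> K1 \<alpha>"
proof -
  assume "\<alpha> < 1"
  then have "0 < 2 powr - \<alpha> - 1/2" using powr_less_mono[of "-1" "- \<alpha>" 2] by (simp add: powr_minus_divide)
  then show ?thesis using C0_nonneg by (simp add: K1_def)
qed

text \<open>The distance to a supporting hyperplane at \<open>z\<close> is at most the distance to
  \<open>z\<close>, so the slab estimate applies at the dyadic scale of
  \<open>norm (x - z)\<close>.\<close>

lemma decay_dist:
  assumes \<alpha>: "0 < \<alpha>" "\<alpha> < 1" "\<alpha> \<le> 2 / real CARD('n)"
    and z: "z \<in> frontier \<Omega>" and x: "x \<in> \<Omega>"
  shows "- u x \<le> K1 \<alpha> * norm (x - z) powr \<alpha>"
proof -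
  obtain \<nu> where \<nu>: "norm \<nu> = 1" "\<And>y. y \<in> \<Omega> \<Longrightarrow> 0 < \<nu> \<bullet> (y - z)" using supporting_normal[OF z] by blast
  have zc: "z \<in> closure \<Omega>" and xc: "x \<in> closure \<Omega>" using z x frontier_iff closure_subset by auto
  define d where "d = norm (x - z)"
  have d0: "0 < d" using \<nu>(2)[OF x] by (auto simp: d_def)
  have d2: "d \<le> 2 * R"
  proof -
    have "norm x \<le> R" "norm z \<le> R" using xc zc closure_cball by auto
    then show ?thesis using norm_triangle_ineq4[of x z] by (simp add: d_def)
  qed
  have "\<exists>k. d \<le> 2 * R / 2 ^ k \<and> \<not> d \<le> 2 * R / 2 ^ Suc k"
  proof (rule ccontr)
    assume H: "\<not> ?thesis"
    have "d \<le> 2 * R / 2 ^ k" for k by (induction k) (use d2 H in auto)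
    moreover obtain k where "2 * R / d < 2 ^ k" using real_arch_pow[of 2 "2 * R / d"] by auto
    then have "2 * R / 2 ^ k < d" using d0 by (simp add: field_simps)
    ultimately show False by (meson not_le)
  qed
  then obtain k where k: "d \<le> 2 * R / 2 ^ k" "2 * R / 2 ^ Suc k < d" by auto
  have "\<nu> \<bullet> (x - z) \<le> norm \<nu> * norm (x - z)" by (rule norm_cauchy_schwarz)
  then have "\<nu> \<bullet> (x - z) \<le> 2 * R / 2 ^ k" using k \<nu>(1) by (simp add: d_def)
  from decay_powr[OF \<alpha> \<nu> zc x this]
  have "- u x \<le> K1 \<alpha> * R powr \<alpha> * 2 powr (- \<alpha> * real k)" using R by (simp add: K1_def)
  also have "\<dots> \<le> K1 \<alpha> * R powr \<alpha> * (d / R) powr \<alpha>"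
  proof (rule mult_left_mono)
    have "2 powr (- \<alpha> * real k) = (1 / 2 ^ k) powr \<alpha>"
      by (simp add: powr_powr powr_minus_divide mult.commute flip: powr_realpow) (simp add: powr_minus_divide[symmetric] powr_powr mult.commute)
    also have "\<dots> \<le> (d / R) powr \<alpha>"
      using k(2) R \<alpha> by (intro powr_mono2) (auto simp: field_simps)
    finally show "2 powr (- \<alpha> * real k) \<le> (d / R) powr \<alpha>" .
  qed (use K1_nonneg \<alpha> in auto)
  also have "\<dots> = K1 \<alpha> * d powr \<alpha>" using R d0 by (simp add: powr_divide)
  finally show ?thesis by (simp add: d_def)
qed

definition line_const :: "real \<Rightarrow> real \<Rightarrow> real" where
  "line_const \<alpha> \<delta> = 2 * ((1 + 2 * K1 \<alpha>) * R powr (1 - \<delta> * (2 - \<alpha>)) / (1 - 2 powr - (1 - \<delta> * (2 - \<alpha>))))"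

text \<open>On an interval of length \<open>m\<close> at distance \<open>m\<close> from one end of
  the chord and at least \<open>m\<close> from the other, the directional derivative grows by at
  most \<open>2 * K1 \<alpha> * m powr (\<alpha> - 1)\<close>. Dyadic intervals of this kind
  accumulate at both ends and fill the chord; hence the factor 2 in
  \<open>line_const\<close>.\<close>

lemma second_powr_line:
  assumes \<alpha>: "0 < \<alpha>" "\<alpha> < 1" "\<alpha> \<le> 2 / real CARD('n)" and \<delta>: "0 < \<delta>" "\<delta> < 1"
    and s: "0 < 1 - \<delta> * (2 - \<alpha>)" and e: "norm e = 1"
  shows "(\<integral>\<^sup>+t. ennreal (enn2real (second e (x + t *\<^sub>R e)) powr \<delta>) * indicator \<Omega> (x + t *\<^sub>R e) \<partial>lborel) \<le> ennreal (line_const \<alpha> \<delta>)"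
proof -
  let ?c = "(1 + 2 * K1 \<alpha>) * R powr (1 - \<delta> * (2 - \<alpha>)) / (1 - 2 powr - (1 - \<delta> * (2 - \<alpha>)))"
  have c0: "0 \<le> ?c"
  proof -
    have "2 powr - (1 - \<delta> * (2 - \<alpha>)) < 1" using s powr_less_mono[of "- (1 - \<delta> * (2 - \<alpha>))" 0 2] by auto
    then show ?thesis using K1_nonneg[OF \<alpha>(2)] by simp
  qed
  define J where "J = {t. x + t *\<^sub>R e \<in> \<Omega>}"
  let ?F = "\<lambda>t. ennreal (enn2real (second e (x + t *\<^sub>R e)) powr \<delta>)"
  have int_J: "(\<integral>\<^sup>+t. ?F t * indicator \<Omega> (x + t *\<^sub>R e) \<partial>lborel) = (\<integral>\<^sup>+t\<in>J. ?F t \<partial>lborel)"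
    by (simp add: J_def indicator_def)
  show ?thesis
  proof (cases "J = {}")
    case True
    then show ?thesis unfolding int_J by simp
  next
    case False
    have inj: "norm ((x + t *\<^sub>R e) - (x + t' *\<^sub>R e)) = \<bar>t - t'\<bar>" for t t'
    proof -
      have "(x + t *\<^sub>R e) - (x + t' *\<^sub>R e) = (t - t') *\<^sub>R e" by (simp add: algebra_simps)
      then show ?thesis using e by simp
    qed
    have Jo: "open J"
    proof -
      have "J = (\<lambda>t. x + t *\<^sub>R e) -` \<Omega>" by (auto simp: J_def)
      then show ?thesis by (auto intro!: open_vimage op continuous_intros)
    qed
    have Jb: "bounded J"
      unfolding bounded_iff
    proof (intro exI ballI)
      fix t assume "t \<in> J"
      then have "norm (x + t *\<^sub>R e) \<le> R" using R by (auto simp: J_def)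
      then show "norm t \<le> R + norm x" using norm_triangle_ineq4[of "x + t *\<^sub>R e" x] e by simp
    qed
    have Jconv: "s \<in> J" if "p \<in> J" "q \<in> J" "p \<le> s" "s \<le> q" for p q s
    proof (cases "p = q")
      case False
      define w where "w = (s - p) / (q - p)"
      have w: "0 \<le> w" "w \<le> 1" using that False by (auto simp: w_def field_simps)
      have sp: "s = p + w * (q - p)" using False by (simp add: w_def)
      have "x + s *\<^sub>R e = (1 - w) *\<^sub>R (x + p *\<^sub>R e) + w *\<^sub>R (x + q *\<^sub>R e)"
        unfolding sp by (simp add: algebra_simps)
      moreover have "\<dots> \<in> \<Omega>" using cvx that w by (simp add: convex_alt J_def)
      ultimately show ?thesis by (simp add: J_def)
    qed (use that in auto)
    define a where "a = Inf J"
    define b where "b = Sup J"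
    have bel: "bdd_below J" "bdd_above J" using Jb by (auto simp: bounded_imp_bdd_below bounded_imp_bdd_above)
    have Jab: "t \<in> J \<longleftrightarrow> a < t \<and> t < b" for t
    proof
      assume "t \<in> J"
      then obtain \<epsilon> where "\<epsilon> > 0" "ball t \<epsilon> \<subseteq> J" using Jo openE by blast
      then have "t - \<epsilon> / 2 \<in> J" "t + \<epsilon> / 2 \<in> J" by (auto simp: subset_iff dist_real_def)
      then have "a \<le> t - \<epsilon> / 2" "t + \<epsilon> / 2 \<le> b" using bel by (auto simp: a_def b_def intro: cInf_lower cSup_upper)
      then show "a < t \<and> t < b" using \<open>\<epsilon> > 0\<close> by auto
    next
      assume t: "a < t \<and> t < b"
      obtain p where "p \<in> J" "p < t" using t cInf_less_iff[OF False bel(1)] by (auto simp: a_def)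
      moreover obtain q where "q \<in> J" "t < q" using t less_cSup_iff[OF False bel(2)] by (auto simp: b_def)
      ultimately show "t \<in> J" using Jconv[of p q t] by simp
    qed
    have ab: "a < b" using False Jab by force
    have ends: "x + p *\<^sub>R e \<in> frontier \<Omega>" if p: "p = a \<or> p = b" for p
    proof -
      have "p \<in> closure {a<..<b}" using p ab by auto
      then have "p \<in> closure J" using Jab by (metis (no_types, lifting) greaterThanLessThan_iff subsetI subset_antisym)
      then obtain f where f: "\<And>n. f n \<in> J" "f \<longlonglongrightarrow> p" unfolding closure_sequential by blast
      have "(\<lambda>n. x + f n *\<^sub>R e) \<longlonglongrightarrow> x + p *\<^sub>R e" by (intro tendsto_intros f)
      moreover have "x + f n *\<^sub>R e \<in> \<Omega>" for n using f(1) by (simp add: J_def)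
      ultimately have "x + p *\<^sub>R e \<in> closure \<Omega>"
        unfolding closure_sequential by (intro exI[of _ "\<lambda>n. x + f n *\<^sub>R e"]) auto
      moreover have "p \<notin> J" using p Jab by auto
      ultimately show ?thesis by (simp add: frontier_iff J_def)
    qed
    \<comment> \<open>Half the chord length: the left family fills \<open>(a, a + L)\<close>, the
      right one \<open>[a + L, b)\<close>.\<close>
    define L where "L = (b - a) / 2"
    have L: "0 < L" "L \<le> R"
    proof -
      have "norm (x + b *\<^sub>R e) \<le> R" "norm (x + a *\<^sub>R e) \<le> R"
        using ends[of a] ends[of b] closure_cball frontier_iff by auto
      then have "norm ((x + b *\<^sub>R e) - (x + a *\<^sub>R e)) \<le> 2 * R"
        using norm_triangle_ineq4[of "x + b *\<^sub>R e" "x + a *\<^sub>R e"] by simp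
      then show "L \<le> R" "0 < L" using ab unfolding inj by (auto simp: L_def)
    qed
    let ?g = "\<lambda>t. grad (x + t *\<^sub>R e) \<bullet> e"
    have g_lower: "- (K1 \<alpha> * (t - a) powr (\<alpha> - 1)) \<le> ?g t" if t: "a < t" "t < b" for t
    proof -
      have xt: "x + t *\<^sub>R e \<in> \<Omega>" using t Jab by (simp add: J_def)
      have eq: "(x + t *\<^sub>R e) + (a - t) *\<^sub>R e = x + a *\<^sub>R e" by (simp add: algebra_simps)
      have "x + a *\<^sub>R e \<in> closure \<Omega>" using ends[of a] frontier_iff by blast
      then have "(a - t) * ?g t \<le> - u (x + t *\<^sub>R e)"
        by (intro grad_chord_bounds[OF xt]) (simp only: eq)
      also have "\<dots> \<le> K1 \<alpha> * (t - a) powr \<alpha>"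
        using decay_dist[OF \<alpha> ends[of a] xt, unfolded inj] t by simp
      also have "\<dots> = (t - a) * (K1 \<alpha> * (t - a) powr (\<alpha> - 1))" using t by (simp add: powr_diff)
      finally have "(t - a) * - (K1 \<alpha> * (t - a) powr (\<alpha> - 1)) \<le> (t - a) * ?g t" by (simp add: algebra_simps)
      then show ?thesis using t by (simp only: mult_le_cancel_left_pos diff_gt_0_iff_gt)
    qed
    have g_upper: "?g t \<le> K1 \<alpha> * (b - t) powr (\<alpha> - 1)" if t: "a < t" "t < b" for t
    proof -
      have xt: "x + t *\<^sub>R e \<in> \<Omega>" using t Jab by (simp add: J_def)
      have eq: "(x + t *\<^sub>R e) + (b - t) *\<^sub>R e = x + b *\<^sub>R e" by (simp add: algebra_simps)
      have "x + b *\<^sub>R e \<in> closure \<Omega>" using ends[of b] frontier_iff by blast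
      then have "(b - t) * ?g t \<le> - u (x + t *\<^sub>R e)"
        by (intro grad_chord_bounds[OF xt]) (simp only: eq)
      also have "\<dots> \<le> K1 \<alpha> * (b - t) powr \<alpha>"
        using decay_dist[OF \<alpha> ends[of b] xt, unfolded inj] t by simp
      also have "\<dots> = (b - t) * (K1 \<alpha> * (b - t) powr (\<alpha> - 1))" using t by (simp add: powr_diff)
      finally show ?thesis using t by (simp only: mult_le_cancel_left_pos diff_gt_0_iff_gt)
    qed
    have g_diff: "?g r - ?g l \<le> 2 * K1 \<alpha> * m powr (\<alpha> - 1)"
      if "a < l" "l \<le> r" "r < b" "0 < m" "m \<le> l - a" "m \<le> b - r" for l r m
    proof -
      have "(l - a) powr (\<alpha> - 1) \<le> m powr (\<alpha> - 1)" "(b - r) powr (\<alpha> - 1) \<le> m powr (\<alpha> - 1)"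
        using that \<alpha> by (auto intro: powr_mono2')
      then have "K1 \<alpha> * (l - a) powr (\<alpha> - 1) \<le> K1 \<alpha> * m powr (\<alpha> - 1)" "K1 \<alpha> * (b - r) powr (\<alpha> - 1) \<le> K1 \<alpha> * m powr (\<alpha> - 1)"
        using K1_nonneg[OF \<alpha>(2)] by (auto intro: mult_left_mono)
      then show ?thesis using g_lower[of l] g_upper[of r] that by simp
    qed
    have Hb: "(\<lambda>t. second e (x + t *\<^sub>R e)) \<in> borel_measurable borel" by measurable
    have left: "(\<integral>\<^sup>+t\<in>(\<Union>j. {a + L / 2 / 2 ^ j..<a + L / 2 / 2 ^ j + L / 2 / 2 ^ j}). ?F t \<partial>lborel) \<le> ennreal ?c"
    proof (rule nn_integral_powr_dyadic[OF Hb \<delta> K1_nonneg[OF \<alpha>(2)] _ _ s])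
      show "0 < L / 2" "L / 2 \<le> R" using L by auto
      fix j :: nat
      define m where "m = L / 2 / 2 ^ j"
      have m: "0 < m" "m \<le> L / 2" using L by (auto simp: m_def field_simps)
      have bL: "b = a + 2 * L" by (simp add: L_def field_simps)
      have "(\<integral>\<^sup>+t\<in>{a + m..<a + m + m}. second e (x + t *\<^sub>R e) \<partial>lborel) \<le> ennreal (?g (a + m + m) - ?g (a + m))"
        by (rule second_interval) (use m bL L Jab in \<open>auto simp: J_def\<close>)
      also have "\<dots> \<le> ennreal (2 * K1 \<alpha> * m powr (\<alpha> - 1))"
        by (intro ennreal_leI g_diff) (use m bL L in auto)
      finally show "(\<integral>\<^sup>+t\<in>{a + L / 2 / 2 ^ j..<a + L / 2 / 2 ^ j + L / 2 / 2 ^ j}. second e (x + t *\<^sub>R e) \<partial>lborel)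
          \<le> ennreal (2 * K1 \<alpha> * (L / 2 / 2 ^ j) powr (\<alpha> - 1))" by (simp only: m_def)
    qed
    have right: "(\<integral>\<^sup>+t\<in>(\<Union>j. {b - 2 * (L / 2 / 2 ^ j)..<b - 2 * (L / 2 / 2 ^ j) + L / 2 / 2 ^ j}). ?F t \<partial>lborel) \<le> ennreal ?c"
    proof (rule nn_integral_powr_dyadic[OF Hb \<delta> K1_nonneg[OF \<alpha>(2)] _ _ s])
      show "0 < L / 2" "L / 2 \<le> R" using L by auto
      fix j :: nat
      define m where "m = L / 2 / 2 ^ j"
      have m: "0 < m" "m \<le> L / 2" using L by (auto simp: m_def field_simps)
      have bL: "b = a + 2 * L" by (simp add: L_def field_simps)
      have "(\<integral>\<^sup>+t\<in>{b - 2 * m..<b - 2 * m + m}. second e (x + t *\<^sub>R e) \<partial>lborel) \<le> ennreal (?g (b - 2 * m + m) - ?g (b - 2 * m))"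
        by (rule second_interval) (use m bL L Jab in \<open>auto simp: J_def\<close>)
      also have "\<dots> \<le> ennreal (2 * K1 \<alpha> * m powr (\<alpha> - 1))"
        by (intro ennreal_leI g_diff) (use m bL L in auto)
      finally show "(\<integral>\<^sup>+t\<in>{b - 2 * (L / 2 / 2 ^ j)..<b - 2 * (L / 2 / 2 ^ j) + L / 2 / 2 ^ j}. second e (x + t *\<^sub>R e) \<partial>lborel)
          \<le> ennreal (2 * K1 \<alpha> * (L / 2 / 2 ^ j) powr (\<alpha> - 1))" by (simp only: m_def)
    qed
    let ?A = "\<Union>j. {a + L / 2 / 2 ^ j..<a + L / 2 / 2 ^ j + L / 2 / 2 ^ j}"
    let ?B = "\<Union>j. {b - 2 * (L / 2 / 2 ^ j)..<b - 2 * (L / 2 / 2 ^ j) + L / 2 / 2 ^ j}"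
    have scale: "\<exists>j::nat. L / 2 / 2 ^ j \<le> v \<and> v < L / 2 ^ j" if v: "0 < v" "v < L" for v
    proof (rule ccontr)
      assume H: "\<not> ?thesis"
      have "v < L / 2 ^ j" for j by (induction j) (use v H in \<open>auto simp: field_simps not_le\<close>)
      moreover obtain k where "L / v < 2 ^ k" using real_arch_pow[of 2 "L / v"] by auto
      then have "L / 2 ^ k < v" using v by (simp add: field_simps)
      ultimately show False by (meson less_asym)
    qed
    have cover: "J \<subseteq> ?A \<union> ?B"
    proof
      fix t assume "t \<in> J"
      then have t: "a < t" "t < b" using Jab by auto
      have bL: "b = a + 2 * L" by (simp add: L_def field_simps)
      show "t \<in> ?A \<union> ?B"
      proof (cases "t < a + L")
        case True
        then obtain j :: nat where "L / 2 / 2 ^ j \<le> t - a" "t - a < L / 2 ^ j" using scale[of "t - a"] t by auto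
        then have "t \<in> {a + L / 2 / 2 ^ j..<a + L / 2 / 2 ^ j + L / 2 / 2 ^ j}" by (simp add: field_simps)
        then show ?thesis by blast
      next
        case False
        \<comment> \<open>Strict and weak inequality are exchanged against \<open>scale\<close>, as
          the mirrored intervals are still closed on the left.\<close>
        have "\<exists>j::nat. L / 2 / 2 ^ j < b - t \<and> b - t \<le> L / 2 ^ j"
        proof (rule ccontr)
          assume H: "\<not> ?thesis"
          have "b - t \<le> L / 2 ^ j" for j by (induction j) (use t False bL H in \<open>auto simp: field_simps not_less\<close>)
          moreover obtain k where "L / (b - t) < 2 ^ k" using real_arch_pow[of 2 "L / (b - t)"] by auto
          then have "L / 2 ^ k < b - t" using t by (simp add: field_simps)
          ultimately show False by (meson not_le)
        qed
        then obtain j :: nat where "L / 2 / 2 ^ j < b - t" "b - t \<le> L / 2 ^ j" by blast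
        then have "t \<in> {b - 2 * (L / 2 / 2 ^ j)..<b - 2 * (L / 2 / 2 ^ j) + L / 2 / 2 ^ j}" by (simp add: field_simps)
        then show ?thesis by blast
      qed
    qed
    have "(\<integral>\<^sup>+t\<in>J. ?F t \<partial>lborel) \<le> (\<integral>\<^sup>+t. ?F t * indicator ?A t + ?F t * indicator ?B t \<partial>lborel)"
      by (intro nn_integral_mono mult_indicator_subset_Un cover)
    also have "\<dots> = (\<integral>\<^sup>+t\<in>?A. ?F t \<partial>lborel) + (\<integral>\<^sup>+t\<in>?B. ?F t \<partial>lborel)"
      by (rule nn_integral_add) measurable
    also have "\<dots> \<le> ennreal ?c + ennreal ?c" by (rule add_mono[OF left right])
    also have "\<dots> = ennreal (line_const \<alpha> \<delta>)" using c0 by (simp add: line_const_def flip: ennreal_plus)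
    finally show ?thesis unfolding int_J .
  qed
qed


lemma second_powr_integral:
  assumes \<alpha>: "0 < \<alpha>" "\<alpha> < 1" "\<alpha> \<le> 2 / real CARD('n)" and \<delta>: "0 < \<delta>" "\<delta> < 1"
    and s: "0 < 1 - \<delta> * (2 - \<alpha>)" and e: "norm e = 1"
  shows "(\<integral>\<^sup>+x\<in>\<Omega>. ennreal (enn2real (second e x) powr \<delta>) \<partial>lborel) \<le> ennreal (line_const \<alpha> \<delta>) * ennreal V"
proof -
  let ?F = "\<lambda>x. ennreal (enn2real (second e x) powr \<delta>) * indicator \<Omega> x"
  have \<Omega>b: "\<Omega> \<in> sets borel" using op by simp
  have "ennreal 1 * (\<integral>\<^sup>+x. ?F x \<partial>lborel) \<le> ennreal (line_const \<alpha> \<delta>) * emeasure lborel (cball (0::real^'n) (R + 1))"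
  proof (rule line_integral_bound)
    show "?F \<in> borel_measurable borel" using \<Omega>b by measurable
    show "x - t *\<^sub>R e \<in> cball 0 (R + 1)" if "?F x \<noteq> 0" "0 \<le> t" "t \<le> 1" for x t
    proof -
      have "x \<in> \<Omega>" using that by (auto simp: indicator_def split: if_splits)
      then have "norm x \<le> R" using R(2) by auto
      then show ?thesis using norm_triangle_ineq4[of x "t *\<^sub>R e"] that e by simp
    qed
    show "(\<integral>\<^sup>+t\<in>{0..1}. ?F (x + t *\<^sub>R e) \<partial>lborel) \<le> ennreal (line_const \<alpha> \<delta>)" for x
    proof -
      have "(\<integral>\<^sup>+t\<in>{0..1}. ?F (x + t *\<^sub>R e) \<partial>lborel) \<le> (\<integral>\<^sup>+t. ?F (x + t *\<^sub>R e) \<partial>lborel)"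
        by (rule nn_integral_mono) (auto simp: indicator_def)
      also have "\<dots> \<le> ennreal (line_const \<alpha> \<delta>)" by (rule second_powr_line[OF \<alpha> \<delta> s e])
      finally show ?thesis .
    qed
  qed auto
  moreover have "emeasure lborel (cball (0::real^'n) (R + 1)) = ennreal V"
    unfolding V_def using emeasure_eq_measure2[OF lmeasurable_cball[of "0::real^'n" "R + 1"]] by simp
  ultimately show ?thesis by simp
qed

text \<open>For a nonnegative symmetric matrix every entry is at most the trace, as testing with
  sums and differences of two axis vectors shows. The norm costs a factor \<open>n ^ 2\<close>, the
  trace against its largest term another \<open>n\<close>; the power of that term is then bounded by
  the sum over all directions.\<close>

lemma hessian_onorm_powr:
  assumes x: "x \<in> \<Omega>" and A: "(grad has_derivative A) (at x)" and \<delta>: "0 < \<delta>" "\<delta> < 1"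
  shows "ennreal (onorm (\<lambda>v. hessian u x *v v) powr \<delta>)
    \<le> (\<Sum>i\<in>UNIV. ennreal ((real CARD('n) ^ 3) powr \<delta>) * ennreal (enn2real (second (axis i 1) x) powr \<delta>))"
proof -
  let ?n = "real CARD('n)" and ?a = "\<lambda>i. A (axis i 1) \<bullet> axis i 1"
  have lin: "linear A" using A by (rule has_derivative_linear)
  have nn: "0 \<le> ?a i" for i by (rule grad_derivative_nonneg[OF x A])
  define T where "T = (\<Sum>i\<in>UNIV. ?a i)"
  have T: "0 \<le> T" unfolding T_def by (intro sum_nonneg nn)
  have aT: "?a i \<le> T" for i unfolding T_def by (rule member_le_sum) (auto intro: nn)
  have ent: "\<bar>hessian u x $ i $ j\<bar> \<le> T" for i j
  proof -
    have h: "hessian u x $ i $ j = A (axis j 1) \<bullet> axis i 1"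
      by (simp add: hessian_eq(2)[OF x A] matrix_def inner_axis)
    have sym: "A (axis i 1) \<bullet> axis j 1 = A (axis j 1) \<bullet> axis i 1" by (rule grad_derivative_symmetric[OF x A])
    have "0 \<le> A (axis i 1 + axis j 1) \<bullet> (axis i 1 + axis j 1)" "0 \<le> A (axis i 1 - axis j 1) \<bullet> (axis i 1 - axis j 1)"
      by (rule grad_derivative_nonneg[OF x A])+
    then have "2 * \<bar>A (axis j 1) \<bullet> axis i 1\<bar> \<le> ?a i + ?a j"
      using lin sym by (simp add: linear_add linear_diff inner_add_left inner_add_right inner_diff_left inner_diff_right)
    then show ?thesis using aT[of i] aT[of j] h by linarith
  qed
  have on: "onorm (\<lambda>v. hessian u x *v v) \<le> ?n * ?n * T"
    using onorm_le_matrix_component[of "hessian u x" T] ent by simp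
  obtain i where i: "\<And>j. ?a j \<le> ?a i"
  proof -
    have "\<exists>i. \<forall>j. ?a j \<le> ?a i"
      using Max_in[of "range ?a"] Max_ge[of "range ?a"] by (metis (mono_tags, lifting) UNIV_not_empty finite finite_imageI image_iff image_is_empty rangeI)
    then show thesis using that by blast
  qed
  have "T \<le> (\<Sum>j\<in>(UNIV::'n set). ?a i)" unfolding T_def by (intro sum_mono i)
  then have "T \<le> ?n * ?a i" by simp
  then have "?n * ?n * T \<le> ?n ^ 3 * ?a i"
    using mult_left_mono[of T "?n * ?a i" "?n * ?n"] by (simp add: power3_eq_cube mult.assoc)
  with on have "onorm (\<lambda>v. hessian u x *v v) \<le> ?n ^ 3 * ?a i" by linarith
  moreover have "0 \<le> onorm (\<lambda>v. hessian u x *v v)" by (rule onorm_pos_le) (rule matrix_vector_mul_bounded_linear)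
  ultimately have "onorm (\<lambda>v. hessian u x *v v) powr \<delta> \<le> (?n ^ 3 * ?a i) powr \<delta>"
    using \<delta> by (intro powr_mono2) auto
  also have "\<dots> = (?n ^ 3) powr \<delta> * ?a i powr \<delta>" by (rule powr_mult)
  finally have "ennreal (onorm (\<lambda>v. hessian u x *v v) powr \<delta>) \<le> ennreal ((?n ^ 3) powr \<delta> * ?a i powr \<delta>)" by (rule ennreal_leI)
  also have "\<dots> = ennreal ((?n ^ 3) powr \<delta>) * ennreal (enn2real (second (axis i 1) x) powr \<delta>)"
    by (simp add: second_eq[OF x A] nn ennreal_mult)
  also have "\<dots> \<le> (\<Sum>i\<in>UNIV. ennreal ((?n ^ 3) powr \<delta>) * ennreal (enn2real (second (axis i 1) x) powr \<delta>))"
    by (rule member_le_sum) auto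
  finally show ?thesis .
qed

theorem hessian_integral_bound:
  assumes \<alpha>: "0 < \<alpha>" "\<alpha> < 1" "\<alpha> \<le> 2 / real CARD('n)" and \<delta>: "0 < \<delta>" "\<delta> < 1"
    and s: "0 < 1 - \<delta> * (2 - \<alpha>)"
  shows "hessian_integral \<Omega> \<delta> u \<le> ennreal (real CARD('n) * ((real CARD('n) ^ 3) powr \<delta> * (line_const \<alpha> \<delta> * V)))"
proof -
  let ?n = "real CARD('n)"
  have lc: "0 \<le> line_const \<alpha> \<delta>"
  proof -
    have "2 powr - (1 - \<delta> * (2 - \<alpha>)) < 1" using s powr_less_mono[of "- (1 - \<delta> * (2 - \<alpha>))" 0 2] by auto
    then show ?thesis using K1_nonneg[OF \<alpha>(2)] by (simp add: line_const_def)
  qed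
  let ?F = "\<lambda>i x. ennreal (enn2real (second (axis i 1) x) powr \<delta>)"
  have \<Omega>b[measurable]: "\<Omega> \<in> sets borel" using op by simp
  have "hessian_integral \<Omega> \<delta> u \<le> (\<integral>\<^sup>+x. (\<Sum>i\<in>UNIV. ennreal ((?n ^ 3) powr \<delta>) * (?F i x * indicator \<Omega> x)) \<partial>lborel)"
    unfolding hessian_integral_def
  proof (rule nn_integral_mono_AE)
    show "AE x in lborel. ennreal (onorm (\<lambda>v. hessian u x *v v) powr \<delta>) * indicator \<Omega> x
        \<le> (\<Sum>i\<in>UNIV. ennreal ((?n ^ 3) powr \<delta>) * (?F i x * indicator \<Omega> x))"
      using regular_ae
    proof eventually_elim
      case (elim x)
      show ?case
      proof (cases "x \<in> \<Omega>")
        case True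
        then obtain A where "(grad has_derivative A) (at x)" using elim by (auto simp: regular_def)
        from hessian_onorm_powr[OF True this \<delta>] True show ?thesis by simp
      qed simp
    qed
  qed
  also have "\<dots> = (\<Sum>i\<in>UNIV. \<integral>\<^sup>+x. ennreal ((?n ^ 3) powr \<delta>) * (?F i x * indicator \<Omega> x) \<partial>lborel)"
    by (rule nn_integral_sum) measurable
  also have "\<dots> = (\<Sum>i\<in>UNIV. ennreal ((?n ^ 3) powr \<delta>) * (\<integral>\<^sup>+x\<in>\<Omega>. ?F i x \<partial>lborel))"
    by (intro sum.cong refl nn_integral_cmult) measurable
  also have "\<dots> \<le> (\<Sum>i\<in>(UNIV::'n set). ennreal ((?n ^ 3) powr \<delta>) * (ennreal (line_const \<alpha> \<delta>) * ennreal V))"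
    by (intro sum_mono mult_left_mono second_powr_integral[OF \<alpha> \<delta> s]) auto
  also have "\<dots> = ennreal (?n * ((?n ^ 3) powr \<delta> * (line_const \<alpha> \<delta> * V)))"
    using lc V_pos by (simp add: ennreal_mult ennreal_of_nat_eq_real_of_nat)
  finally show ?thesis .
qed

end

section \<open>Non-integrability on a box\<close>

lemma psd_Cauchy_Schwarz:
  fixes A :: "'a::real_inner \<Rightarrow> 'a"
  assumes lin: "linear A" and sym: "\<And>v w. A v \<bullet> w = A w \<bullet> v" and nn: "\<And>v. 0 \<le> A v \<bullet> v"
  shows "\<bar>A v \<bullet> w\<bar> \<le> sqrt (A v \<bullet> v) * sqrt (A w \<bullet> w)"
proof -
  define p q r where "p = A v \<bullet> v" and "q = A v \<bullet> w" and "r = A w \<bullet> w"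
  have quad: "0 \<le> s\<^sup>2 * p - 2 * s * t * q + t\<^sup>2 * r" for s t
    using nn[of "s *\<^sub>R v - t *\<^sub>R w"] sym[of w v] lin
    by (simp add: p_def q_def r_def linear_diff linear_scale inner_diff_left inner_diff_right power2_eq_square algebra_simps)
  have pr: "0 \<le> p" "0 \<le> r" using nn by (auto simp: p_def r_def)
  have "q\<^sup>2 \<le> p * r"
  proof (cases "r = 0")
    case True
    have "q = 0"
    proof (rule ccontr)
      assume "q \<noteq> 0"
      then have "0 < q\<^sup>2" by simp
      \<comment> \<open>With \<open>r = 0\<close> the quadratic is linear in \<open>t\<close>; this
        choice of \<open>t\<close> makes it equal to \<open>- p - 2\<close>.\<close>
      have "0 \<le> p - 2 * ((p + 1) / q) * q" using quad[of 1 "(p + 1) / q"] True by simp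
      then show False using \<open>q \<noteq> 0\<close> pr by simp
    qed
    then show ?thesis using pr by simp
  next
    case False
    then have r: "0 < r" using pr by simp
    have "0 \<le> r\<^sup>2 * p - 2 * r * q * q + q\<^sup>2 * r" by (rule quad)
    then have "0 \<le> r * (p * r - q\<^sup>2)" by (simp add: power2_eq_square algebra_simps)
    then show ?thesis using r by (simp add: zero_le_mult_iff)
  qed
  then have "sqrt (q\<^sup>2) \<le> sqrt (p * r)" by (rule real_sqrt_le_mono)
  then show ?thesis by (simp add: p_def q_def r_def real_sqrt_mult)
qed

text \<open>Each of the \<open>n!\<close> Leibniz terms is at most the product of the diagonal
  entries: a permutation meets every row and every column once, so the square roots pair up.\<close>

lemma det_bound_diagonal:
  fixes B :: "real^'n::finite^'n"
  assumes nn: "\<And>i. 0 \<le> B $ i $ i" and cs: "\<And>i j. \<bar>B $ i $ j\<bar> \<le> sqrt (B $ i $ i) * sqrt (B $ j $ j)"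
  shows "\<bar>det B\<bar> \<le> fact CARD('n) * (\<Prod>i\<in>UNIV. B $ i $ i)"
proof -
  have "\<bar>det B\<bar> \<le> (\<Sum>p | p permutes (UNIV :: 'n set). \<bar>of_int (sign p) * (\<Prod>i\<in>UNIV. B $ i $ p i)\<bar>)"
    unfolding det_def by (rule sum_abs)
  also have "\<dots> \<le> (\<Sum>p | p permutes (UNIV :: 'n set). \<Prod>i\<in>UNIV. B $ i $ i)"
  proof (rule sum_mono)
    fix p :: "'n \<Rightarrow> 'n" assume p: "p \<in> {p. p permutes UNIV}"
    have "\<bar>of_int (sign p) * (\<Prod>i\<in>UNIV. B $ i $ p i)\<bar> = (\<Prod>i\<in>UNIV. \<bar>B $ i $ p i\<bar>)"
      by (simp add: abs_mult abs_prod sign_def)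
    also have "\<dots> \<le> (\<Prod>i\<in>UNIV. sqrt (B $ i $ i) * sqrt (B $ p i $ p i))"
      by (rule prod_mono) (use cs in auto)
    also have "\<dots> = (\<Prod>i\<in>UNIV. sqrt (B $ i $ i)) * (\<Prod>i\<in>UNIV. sqrt (B $ p i $ p i))" by (rule prod.distrib)
    also have "(\<Prod>i\<in>UNIV. sqrt (B $ p i $ p i)) = (\<Prod>i\<in>UNIV. sqrt (B $ i $ i))"
      by (rule prod.reindex_bij_betw) (use p in \<open>auto simp: permutes_bij\<close>)
    also have "(\<Prod>i\<in>UNIV. sqrt (B $ i $ i)) * (\<Prod>i\<in>UNIV. sqrt (B $ i $ i)) = (\<Prod>i\<in>UNIV. B $ i $ i)"
      unfolding prod.distrib[symmetric] using nn by simp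
    finally show "\<bar>of_int (sign p) * (\<Prod>i\<in>UNIV. B $ i $ p i)\<bar> \<le> (\<Prod>i\<in>UNIV. B $ i $ i)" .
  qed
  also have "\<dots> = fact CARD('n) * (\<Prod>i\<in>UNIV. B $ i $ i)"
    by (simp add: card_permutations)
  finally show ?thesis .
qed

section \<open>The box and the strips along one of its faces\<close>

locale ma_box = ma_ball \<Omega> u lam Lam R for \<Omega> :: "(real^'n::finite) set" and u lam Lam R +
  fixes a b c :: "real^'n" and T :: "real^'n \<Rightarrow> real^'n" and i0 :: 'n
  assumes n2: "CARD('n) \<ge> 2" and ab: "\<And>i. a $ i < b $ i" and T: "orthogonal_transformation T"
    and box: "\<Omega> = (\<lambda>x. c + T x) ` box a b"
begin

definition f :: "'n \<Rightarrow> real^'n" where "f i = T (axis i 1)"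
text \<open>Coordinates in the frame of the box, which undo the rigid motion
  (\<open>coord_T\<close>).\<close>

definition coord :: "'n \<Rightarrow> real^'n \<Rightarrow> real" where "coord i x = f i \<bullet> (x - c)"
definition W :: "'n \<Rightarrow> real" where "W i = b $ i - a $ i"
definition \<rho> :: real where "\<rho> = W i0 / 2"

lemma T_inner: "T v \<bullet> T w = v \<bullet> w"
  using T by (simp add: orthogonal_transformation_def)

lemma T_linear: "linear T"
  using T by (simp add: orthogonal_transformation_def)

lemma W_pos: "0 < W i" and \<rho>_pos: "0 < \<rho>"
  using ab by (simp_all add: W_def \<rho>_def)

lemma f_inner: "f i \<bullet> f j = (if i = j then 1 else 0)"
  by (simp add: f_def T_inner inner_axis_axis)

lemma f_norm: "norm (f i) = 1"
  using f_inner[of i i] by (simp add: norm_eq_1)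

lemma coord_T: "coord i (c + T y) = y $ i"
  by (simp add: coord_def f_def T_inner inner_axis')

lemma coord_add: "coord i (x + t *\<^sub>R f j) = coord i x + (if i = j then t else 0)"
  by (simp add: coord_def inner_diff_right inner_add_right f_inner)

lemma obtain_T:
  obtains y where "x = c + T y"
proof -
  have "surj T" using T by (rule orthogonal_transformation_surj)
  then obtain y where "T y = x - c" by (metis surjD)
  then show thesis using that[of y] by simp
qed

lemma mem_\<Omega>: "x \<in> \<Omega> \<longleftrightarrow> (\<forall>i. a $ i < coord i x \<and> coord i x < b $ i)"
proof -
  obtain y where y: "x = c + T y" by (rule obtain_T)
  have "inj T" using T by (rule orthogonal_transformation_inj)
  then have "x \<in> \<Omega> \<longleftrightarrow> y \<in> box a b" by (auto simp: box y inj_eq)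
  then show ?thesis by (simp add: mem_box_cart y coord_T)
qed

lemma mem_closure_\<Omega>:
  assumes "\<And>i. a $ i \<le> coord i x" "\<And>i. coord i x \<le> b $ i"
  shows "x \<in> closure \<Omega>"
proof -
  obtain y where y: "x = c + T y" by (rule obtain_T)
  have "box a b \<noteq> {}" using ab by (simp add: interval_ne_empty_cart)
  then have "y \<in> closure (box a b)" using assms by (simp add: closure_box mem_box_cart y coord_T)
  moreover have "(\<lambda>x. c + T x) ` closure (box a b) \<subseteq> closure \<Omega>"
    unfolding box by (intro image_closure_subset continuous_intros linear_continuous_on closure_subset closed_closure
        linear_conv_bounded_linear[THEN iffD1] T_linear)
  ultimately show ?thesis by (auto simp: y)
qed

text \<open>The factor 3/4 separates consecutive strips.\<close>

definition lo :: "nat \<Rightarrow> real^'n" where "lo k = (\<chi> i. a $ i + (if i = i0 then 3 / 4 * (\<rho> / 2 ^ k) else W i / 4))"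
definition hi :: "nat \<Rightarrow> real^'n" where "hi k = (\<chi> i. a $ i + (if i = i0 then \<rho> / 2 ^ k else W i / 2))"
definition strip :: "nat \<Rightarrow> (real^'n) set" where "strip k = (\<lambda>y. c + matrix T *v y) ` cbox (lo k) (hi k)"
definition \<sigma> :: real where "\<sigma> = \<rho> / 4 * (\<Prod>i\<in>UNIV - {i0}. W i / 4)"

lemma mem_strip: "x \<in> strip k \<longleftrightarrow> (\<forall>i. lo k $ i \<le> coord i x \<and> coord i x \<le> hi k $ i)"
proof -
  obtain y where y: "x = c + T y" by (rule obtain_T)
  have "inj T" using T by (rule orthogonal_transformation_inj)
  then have "x \<in> strip k \<longleftrightarrow> y \<in> cbox (lo k) (hi k)"
    using T_linear by (auto simp: strip_def y inj_eq matrix_works)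
  then show ?thesis by (simp add: mem_box_cart y coord_T)
qed

lemma strip_bounds:
  assumes "x \<in> strip k"
  shows "3 / 4 * (\<rho> / 2 ^ k) \<le> coord i0 x - a $ i0" "coord i0 x - a $ i0 \<le> \<rho> / 2 ^ k"
    "i \<noteq> i0 \<Longrightarrow> W i / 4 \<le> coord i x - a $ i" "i \<noteq> i0 \<Longrightarrow> coord i x - a $ i \<le> W i / 2"
proof -
  have H: "lo k $ j \<le> coord j x \<and> coord j x \<le> hi k $ j" for j using assms mem_strip by blast
  show "3 / 4 * (\<rho> / 2 ^ k) \<le> coord i0 x - a $ i0" "coord i0 x - a $ i0 \<le> \<rho> / 2 ^ k"
    using H[of i0] by (auto simp: lo_def hi_def)
  show "i \<noteq> i0 \<Longrightarrow> W i / 4 \<le> coord i x - a $ i" "i \<noteq> i0 \<Longrightarrow> coord i x - a $ i \<le> W i / 2"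
    using H[of i] by (auto simp: lo_def hi_def)
qed

lemma \<rho>_pow: "0 < \<rho> / 2 ^ k" "\<rho> / 2 ^ k \<le> \<rho>"
  using \<rho>_pos by (auto simp: field_simps)

lemma strip_subset: "strip k \<subseteq> \<Omega>"
proof
  fix x assume x: "x \<in> strip k"
  show "x \<in> \<Omega>"
    unfolding mem_\<Omega>
  proof
    fix i
    define r where "r = \<rho> / 2 ^ k"
    have r: "0 < r" "r \<le> W i0 / 2" using \<rho>_pow[of k] by (auto simp: r_def \<rho>_def)
    have bW: "b $ j = a $ j + W j" for j by (simp add: W_def)
    show "a $ i < coord i x \<and> coord i x < b $ i"
    proof (cases "i = i0")
      case True
      then show ?thesis
        using strip_bounds(1,2)[OF x, folded r_def] r W_pos[of i0] bW[of i0] by simp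
    next
      case False
      then show ?thesis using strip_bounds(3,4)[OF x, of i] W_pos[of i] bW[of i] by simp
    qed
  qed
qed

lemma strip_borel: "strip k \<in> sets borel"
proof -
  have "compact (strip k)" unfolding strip_def
    by (intro compact_continuous_image continuous_intros linear_continuous_on matrix_vector_mul_bounded_linear compact_cbox)
  then show ?thesis by (simp add: compact_imp_closed)
qed

lemma \<sigma>_pos: "0 < \<sigma>"
  using \<rho>_pos W_pos by (auto simp: \<sigma>_def intro!: mult_pos_pos prod_pos)

lemma strip_emeasure: "emeasure lborel (strip k) = ennreal (\<sigma> / 2 ^ k)"
proof -
  have le: "lo k $ i \<le> hi k $ i" for i using \<rho>_pow(1)[of k] W_pos[of i] by (simp add: lo_def hi_def)
  have "\<bar>det (matrix T)\<bar> = 1"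
    using T det_orthogonal_matrix[of "matrix T"] by (auto simp: orthogonal_transformation_matrix)
  then have "measure lebesgue (strip k) = (\<Prod>i\<in>UNIV. hi k $ i - lo k $ i)"
    unfolding strip_def using affine_cube_measure(2)[OF le] by simp
  also have "\<dots> = (hi k $ i0 - lo k $ i0) * (\<Prod>i\<in>UNIV - {i0}. hi k $ i - lo k $ i)"
    by (rule prod.remove) auto
  also have "(\<Prod>i\<in>UNIV - {i0}. hi k $ i - lo k $ i) = (\<Prod>i\<in>UNIV - {i0}. W i / 4)"
    by (rule prod.cong) (auto simp: lo_def hi_def)
  also have "hi k $ i0 - lo k $ i0 = \<rho> / 4 / 2 ^ k" by (simp add: lo_def hi_def)
  finally have m: "measure lebesgue (strip k) = \<sigma> / 2 ^ k" by (simp add: \<sigma>_def)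
  have "strip k \<in> lmeasurable" unfolding strip_def by (rule affine_cube_measure(1)[OF le])
  from emeasure_eq_measure2[OF this] show ?thesis using m strip_borel[of k] by simp
qed

text \<open>The slab bound is applied to a set in the ball of radius \<open>R + 1\<close> and
  enlarges the radius by 1 more.\<close>

definition V' :: real where "V' = measure lebesgue (cball (0::real^'n) (R + 2))"

lemma V'_pos: "0 < V'"
  using R by (simp add: V'_def content_cball_pos)

text \<open>Integrate along segments parallel to the face. Beyond either end of
  \<open>{l..r}\<close> a length \<open>W i / 4\<close> remains inside the box, so
  \<open>grad_chord_bounds\<close> bounds the directional derivative above by
  \<open>4 * m / W i\<close> at \<open>r\<close> and below by its negative at \<open>l\<close>; the
  increment is at most \<open>8 * m / W i\<close>.\<close>

lemma strip_second_integral: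
  assumes i: "i \<noteq> i0" and bd: "\<And>x. x \<in> \<Omega> \<Longrightarrow> coord i0 x - a $ i0 \<le> \<rho> / 2 ^ k \<Longrightarrow> - u x \<le> m" and m: "0 \<le> m"
  shows "(\<integral>\<^sup>+x\<in>strip k. second (f i) x \<partial>lborel) \<le> ennreal (8 * m / W i * (\<rho> / 2 ^ k * V'))"
proof -
  let ?F = "\<lambda>x. second (f i) x * indicator (strip k) x"
  define B where "B = {x \<in> cball 0 (R + 1). a $ i0 \<le> coord i0 x \<and> coord i0 x \<le> a $ i0 + \<rho> / 2 ^ k}"
  have Bb: "B \<in> sets borel"
  proof -
    have "B = cball 0 (R + 1) \<inter> ({x. a $ i0 \<le> coord i0 x} \<inter> {x. coord i0 x \<le> a $ i0 + \<rho> / 2 ^ k})"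
      by (auto simp: B_def)
    also have "closed \<dots>" unfolding coord_def by (intro closed_Int closed_cball closed_Collect_le continuous_intros)
    finally show ?thesis by simp
  qed
  have sb: "strip k \<in> sets borel" by (rule strip_borel)
  have "ennreal 1 * (\<integral>\<^sup>+x. ?F x \<partial>lborel) \<le> ennreal (8 * m / W i) * emeasure lborel B"
  proof (rule line_integral_bound[OF _ Bb])
    show "?F \<in> borel_measurable borel" using sb by measurable
    show "x - t *\<^sub>R f i \<in> B" if x: "?F x \<noteq> 0" and t: "0 \<le> t" "t \<le> 1" for x t
    proof -
      have xs: "x \<in> strip k" using x by (auto simp: indicator_def split: if_splits)
      then have "norm x \<le> R" using strip_subset R(2) by force
      then have "norm (x - t *\<^sub>R f i) \<le> R + 1" using norm_triangle_ineq4[of x "t *\<^sub>R f i"] t f_norm[of i] by simp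
      moreover have "coord i0 (x - t *\<^sub>R f i) = coord i0 x" using coord_add[of i0 x "- t" i] i by simp
      ultimately show ?thesis using strip_bounds(1,2)[OF xs] \<rho>_pow[of k] by (simp add: B_def)
    qed
    show "(\<integral>\<^sup>+t\<in>{0..1}. ?F (x + t *\<^sub>R f i) \<partial>lborel) \<le> ennreal (8 * m / W i)" for x
    proof (cases "\<exists>t. x + t *\<^sub>R f i \<in> strip k")
      case False
      then show ?thesis by simp
    next
      case True
      then obtain t0 where t0: "x + t0 *\<^sub>R f i \<in> strip k" by blast
      define s where "s = coord i x - a $ i"
      \<comment> \<open>The middle half of the chord. The strip uses only the part from
        \<open>W i / 4\<close> to \<open>W i / 2\<close>, so the half-open interval loses
        nothing.\<close>
      define l where "l = W i / 4 - s"
      define r where "r = 3 * W i / 4 - s"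
      have Wi: "0 < W i" by (rule W_pos)
      have bW: "b $ i = a $ i + W i" by (simp add: W_def)
      have cj: "coord j (x + t *\<^sub>R f i) = coord j (x + t0 *\<^sub>R f i)" if "j \<noteq> i" for j t
        using that by (simp add: coord_add)
      have ci: "coord i (x + t *\<^sub>R f i) = a $ i + s + t" for t by (simp add: coord_add s_def)
      have t0O: "x + t0 *\<^sub>R f i \<in> \<Omega>" using t0 strip_subset by blast
      have inO: "x + t *\<^sub>R f i \<in> \<Omega>" if "l \<le> t" "t \<le> r" for t
        unfolding mem_\<Omega>
      proof
        fix j
        show "a $ j < coord j (x + t *\<^sub>R f i) \<and> coord j (x + t *\<^sub>R f i) < b $ j"
          using t0O[unfolded mem_\<Omega>, rule_format, of j] cj[of j t] ci[of t] that Wi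
          by (cases "j = i") (auto simp: l_def r_def bW)
      qed
      have mb: "- u (x + t *\<^sub>R f i) \<le> m" if "l \<le> t" "t \<le> r" for t
        using bd[OF inO[OF that]] strip_bounds(2)[OF t0] cj[of i0 t] i by simp
      have lr: "l \<le> r" using Wi by (simp add: l_def r_def)
      have up: "W i / 4 * (grad (x + r *\<^sub>R f i) \<bullet> f i) \<le> m"
      proof -
        have cc: "coord j (x + r *\<^sub>R f i + (W i / 4) *\<^sub>R f i) = (if j = i then b $ i else coord j (x + t0 *\<^sub>R f i))" for j
          by (simp add: coord_add s_def r_def bW)
        have "x + r *\<^sub>R f i + (W i / 4) *\<^sub>R f i \<in> closure \<Omega>"
          by (rule mem_closure_\<Omega>; unfold cc) (use t0O[unfolded mem_\<Omega>] ab in \<open>auto simp: less_imp_le\<close>)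
        from grad_chord_bounds[OF inO[of r] this] mb[of r] lr show ?thesis by simp
      qed
      have dn: "- (W i / 4) * (grad (x + l *\<^sub>R f i) \<bullet> f i) \<le> m"
      proof -
        have cc: "coord j (x + l *\<^sub>R f i + (- (W i / 4)) *\<^sub>R f i) = (if j = i then a $ i else coord j (x + t0 *\<^sub>R f i))" for j
          unfolding coord_add by (simp add: s_def l_def)
        have "x + l *\<^sub>R f i + (- (W i / 4)) *\<^sub>R f i \<in> closure \<Omega>"
          by (rule mem_closure_\<Omega>; unfold cc) (use t0O[unfolded mem_\<Omega>] ab in \<open>auto simp: less_imp_le\<close>)
        from grad_chord_bounds[OF inO[of l] this] mb[of l] lr show ?thesis by simp
      qed
      have "(\<integral>\<^sup>+t\<in>{0..1}. ?F (x + t *\<^sub>R f i) \<partial>lborel) \<le> (\<integral>\<^sup>+t\<in>{l..<r}. second (f i) (x + t *\<^sub>R f i) \<partial>lborel)"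
      proof (rule nn_integral_mono)
        fix t
        show "?F (x + t *\<^sub>R f i) * indicator {0..1} t \<le> second (f i) (x + t *\<^sub>R f i) * indicator {l..<r} t"
        proof (cases "x + t *\<^sub>R f i \<in> strip k")
          case True
          then have "t \<in> {l..<r}"
            using strip_bounds(3,4)[OF True i] ci[of t] Wi by (simp add: l_def r_def)
          then show ?thesis by (auto simp: indicator_def)
        qed simp
      qed
      also have "\<dots> \<le> ennreal (grad (x + r *\<^sub>R f i) \<bullet> f i - grad (x + l *\<^sub>R f i) \<bullet> f i)"
        by (rule second_interval[OF lr inO])
      also have "\<dots> \<le> ennreal (8 * m / W i)"
        using up dn Wi by (intro ennreal_leI) (simp add: field_simps)
      finally show ?thesis .
    qed
  qed simp
  also have "emeasure lborel B \<le> ennreal (\<rho> / 2 ^ k) * emeasure lborel (cball (0::real^'n) (R + 1 + 1))"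
    by (rule slab_emeasure[OF f_norm[of i0] Bb, where s = "a $ i0 + f i0 \<bullet> c"])
      (use \<rho>_pow[of k] in \<open>auto simp: B_def coord_def inner_diff_right\<close>)
  also have "R + 1 + 1 = R + 2" by simp
  also have "emeasure lborel (cball (0::real^'n) (R + 2)) = ennreal V'"
    unfolding V'_def using emeasure_eq_measure2[OF lmeasurable_cball[of "0::real^'n" "R + 2"]] by simp
  finally have "(\<integral>\<^sup>+x\<in>strip k. second (f i) x \<partial>lborel) \<le> ennreal (8 * m / W i) * (ennreal (\<rho> / 2 ^ k) * ennreal V')"
    by (simp add: mult_left_mono)
  also have "\<dots> = ennreal (8 * m / W i * (\<rho> / 2 ^ k * V'))"
    using m W_pos[of i] \<rho>_pow[of k] V'_pos by (simp flip: ennreal_mult)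
  finally show ?thesis .
qed


lemma hessian_lower_bound:
  assumes x: "x \<in> \<Omega>" and reg: "regular x" and M: "0 < M"
    and sec: "\<And>i. i \<noteq> i0 \<Longrightarrow> second (f i) x \<le> ennreal M"
  shows "lam / (fact CARD('n) * M ^ (CARD('n) - 1)) \<le> onorm (\<lambda>v. hessian u x *v v)"
proof -
  obtain A where A: "(grad has_derivative A) (at x)" and det: "lam \<le> \<bar>det (hessian u x)\<bar>"
    using reg by (auto simp: regular_def)
  have lin: "linear A" using A by (rule has_derivative_linear)
  have nn: "0 \<le> A v \<bullet> v" for v by (rule grad_derivative_nonneg[OF x A])
  let ?Q = "matrix T"
  \<comment> \<open>\<open>A\<close> in the frame of the box; the orthogonal change of basis
    preserves the absolute value of the determinant.\<close>
  define B where "B = transpose ?Q ** matrix A ** ?Q"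
  have B: "B $ i $ j = A (f j) \<bullet> f i" for i j
  proof -
    have "B $ i $ j = axis i 1 \<bullet> (B *v axis j 1)"
      by (simp add: inner_axis' matrix_vector_mult_basis column_def)
    also have "B *v axis j 1 = (matrix A *v (?Q *v axis j 1)) v* ?Q"
      unfolding B_def matrix_vector_mul_assoc[symmetric] by simp
    also have "axis i 1 \<bullet> \<dots> = (matrix A *v (?Q *v axis j 1)) \<bullet> (?Q *v axis i 1)"
      by (subst inner_commute) (rule dot_lmul_matrix)
    also have "\<dots> = A (f j) \<bullet> f i"
      using T_linear lin by (simp add: matrix_works f_def)
    finally show ?thesis .
  qed
  have "\<bar>det B\<bar> = \<bar>det (hessian u x)\<bar>"
    using T det_orthogonal_matrix[of ?Q]
    by (auto simp: B_def det_mul det_transpose orthogonal_transformation_matrix hessian_eq(2)[OF x A] abs_mult)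
  then have "lam \<le> \<bar>det B\<bar>" using det by simp
  also have "\<dots> \<le> fact CARD('n) * (\<Prod>i\<in>UNIV. B $ i $ i)"
  proof (rule det_bound_diagonal)
    show "0 \<le> B $ i $ i" for i by (simp add: B nn)
    show "\<bar>B $ i $ j\<bar> \<le> sqrt (B $ i $ i) * sqrt (B $ j $ j)" for i j
      using psd_Cauchy_Schwarz[OF lin grad_derivative_symmetric[OF x A] nn, of "f j" "f i"]
      by (simp add: B mult.commute)
  qed
  also have "(\<Prod>i\<in>UNIV. B $ i $ i) = B $ i0 $ i0 * (\<Prod>i\<in>UNIV - {i0}. B $ i $ i)"
    by (rule prod.remove) auto
  also have "fact CARD('n) * (B $ i0 $ i0 * (\<Prod>i\<in>UNIV - {i0}. B $ i $ i)) \<le> fact CARD('n) * (B $ i0 $ i0 * M ^ (CARD('n) - 1))"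
  proof (intro mult_left_mono)
    have "B $ i $ i \<le> M" if "i \<noteq> i0" for i
      using sec[OF that] M by (simp add: second_eq[OF x A] B ennreal_le_iff)
    then have "(\<Prod>i\<in>UNIV - {i0}. B $ i $ i) \<le> (\<Prod>i\<in>UNIV - {i0}. M)"
      by (intro prod_mono) (auto simp: B nn)
    then show "(\<Prod>i\<in>UNIV - {i0}. B $ i $ i) \<le> M ^ (CARD('n) - 1)" by (simp add: card_Diff_singleton)
  qed (auto simp: B nn)
  also have "B $ i0 $ i0 \<le> onorm (\<lambda>v. hessian u x *v v)"
  proof -
    have "B $ i0 $ i0 \<le> norm (A (f i0)) * norm (f i0)" unfolding B by (rule norm_cauchy_schwarz)
    also have "\<dots> = norm (hessian u x *v f i0)" by (simp add: f_norm hessian_eq(1)[OF x A])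
    also have "\<dots> \<le> onorm (\<lambda>v. hessian u x *v v) * norm (f i0)"
      by (rule onorm) (rule matrix_vector_mul_bounded_linear)
    finally show ?thesis by (simp add: f_norm)
  qed
  finally have "lam \<le> fact CARD('n) * (onorm (\<lambda>v. hessian u x *v v) * M ^ (CARD('n) - 1))"
    using M by (simp add: mult_right_mono)
  then show ?thesis using M by (simp add: divide_le_eq mult_ac)
qed

text \<open>Markov's inequality in each tangential direction. The constant 16, twice that of
  \<open>strip_second_integral\<close>, and the factor \<open>n\<close> confine each bad set to a
  \<open>1 / n\<close> part of half the strip, so at least half the strip is good in all directions
  at once.\<close>

lemma strip_good_part:
  assumes m: "0 < m" and bd: "\<And>x. x \<in> \<Omega> \<Longrightarrow> coord i0 x - a $ i0 \<le> \<rho> / 2 ^ k \<Longrightarrow> - u x \<le> m"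
    and w: "0 < w" "\<And>i. w \<le> W i"
  defines "M \<equiv> 16 * real CARD('n) * V' * \<rho> / (w * \<sigma>) * m"
  shows "ennreal (\<sigma> / 2 / 2 ^ k) \<le> emeasure lborel {x \<in> strip k. \<forall>i. i \<noteq> i0 \<longrightarrow> second (f i) x \<le> ennreal M}"
    and "{x \<in> strip k. \<forall>i. i \<noteq> i0 \<longrightarrow> second (f i) x \<le> ennreal M} \<in> sets borel"
proof -
  let ?n = "real CARD('n)"
  have M: "0 < M" using m w V'_pos \<rho>_pos \<sigma>_pos by (simp add: M_def)
  have sb[measurable]: "strip k \<in> sets borel" by (rule strip_borel)
  define Bad where "Bad i = {x \<in> strip k. ennreal M < second (f i) x}" for i
  have Badb[measurable]: "Bad i \<in> sets borel" for i
  proof -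
    have "{x \<in> space borel. x \<in> strip k \<and> ennreal M < second (f i) x} \<in> sets borel" by measurable
    then show ?thesis by (simp add: Bad_def)
  qed
  let ?G = "{x \<in> strip k. \<forall>i. i \<noteq> i0 \<longrightarrow> second (f i) x \<le> ennreal M}"
  have G: "?G = strip k - (\<Union>i\<in>UNIV - {i0}. Bad i)" by (auto simp: Bad_def not_less)
  show Gb: "?G \<in> sets borel" unfolding G by (intro sets.Diff sb sets.finite_UN Badb) auto
  have bad: "emeasure lborel (Bad i) \<le> ennreal (\<sigma> / 2 / 2 ^ k / ?n)" if i: "i \<noteq> i0" for i
  proof -
    have "ennreal M * emeasure lborel (Bad i) = (\<integral>\<^sup>+x. ennreal M * indicator (Bad i) x \<partial>lborel)"
      using Badb by (subst nn_integral_cmult_indicator) auto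
    also have "\<dots> \<le> (\<integral>\<^sup>+x\<in>strip k. second (f i) x \<partial>lborel)"
      by (rule nn_integral_mono) (auto simp: indicator_def Bad_def)
    also have "\<dots> \<le> ennreal (8 * m / W i * (\<rho> / 2 ^ k * V'))"
      by (rule strip_second_integral[OF i bd]) (use m in auto)
    also have "\<dots> \<le> ennreal (8 * m / w * (\<rho> / 2 ^ k * V'))"
      using m w W_pos[of i] \<rho>_pos V'_pos by (intro ennreal_leI mult_right_mono divide_left_mono) auto
    also have "8 * m / w * (\<rho> / 2 ^ k * V') = M * (\<sigma> / 2 / 2 ^ k / ?n)"
      using \<sigma>_pos w by (simp add: M_def field_simps)
    also have "ennreal (M * (\<sigma> / 2 / 2 ^ k / ?n)) = ennreal M * ennreal (\<sigma> / 2 / 2 ^ k / ?n)"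
      by (rule ennreal_mult') (use M in simp)
    finally show ?thesis using M by (simp add: ennreal_mult_le_mult_iff)
  qed
  have "emeasure lborel (\<Union>i\<in>UNIV - {i0}. Bad i) \<le> (\<Sum>i\<in>UNIV - {i0}. emeasure lborel (Bad i))"
    by (rule emeasure_subadditive_finite) auto
  also have "\<dots> \<le> (\<Sum>i\<in>UNIV - {i0}. ennreal (\<sigma> / 2 / 2 ^ k / ?n))"
    by (rule sum_mono) (use bad in auto)
  also have "\<dots> \<le> (\<Sum>i\<in>(UNIV :: 'n set). ennreal (\<sigma> / 2 / 2 ^ k / ?n))"
    by (rule sum_mono2) auto
  also have "\<dots> = ennreal (\<Sum>i\<in>(UNIV :: 'n set). \<sigma> / 2 / 2 ^ k / ?n)"
    by (rule sum_ennreal) (use \<sigma>_pos in auto)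
  also have "(\<Sum>i\<in>(UNIV :: 'n set). \<sigma> / 2 / 2 ^ k / ?n) = \<sigma> / 2 / 2 ^ k" by simp
  finally have U: "emeasure lborel (\<Union>i\<in>UNIV - {i0}. Bad i) \<le> ennreal (\<sigma> / 2 / 2 ^ k)" .
  have "ennreal (\<sigma> / 2 / 2 ^ k) + ennreal (\<sigma> / 2 / 2 ^ k) = emeasure lborel (strip k)"
    unfolding strip_emeasure using \<sigma>_pos by (simp flip: ennreal_plus)
  also have "\<dots> \<le> emeasure lborel (?G \<union> (\<Union>i\<in>UNIV - {i0}. Bad i))"
    unfolding G by (rule emeasure_mono) auto
  also have "\<dots> \<le> emeasure lborel ?G + emeasure lborel (\<Union>i\<in>UNIV - {i0}. Bad i)"
    using Gb by (intro emeasure_subadditive) auto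
  also have "\<dots> \<le> emeasure lborel ?G + ennreal (\<sigma> / 2 / 2 ^ k)" by (rule add_left_mono[OF U])
  finally show "ennreal (\<sigma> / 2 / 2 ^ k) \<le> emeasure lborel ?G" by simp
qed

theorem hessian_not_in_Lp: "hessian_integral \<Omega> (real CARD('n) / (2 * (real CARD('n) - 1))) u = \<infinity>"
proof -
  let ?n = "real CARD('n)"
  define p where "p = ?n / (2 * (?n - 1))"
  have n1: "?n > 1" using n2 by simp
  have p: "0 < p" using n1 by (simp add: p_def)
  \<comment> \<open>Puts the depth \<open>\<rho> / 2 ^ k\<close> within the scale
    \<open>2 * R / 2 ^ k\<close> of \<open>decay_critical\<close>.\<close>
  have W2R: "2 * \<rho> \<le> 2 * R"
  proof -
    have "c + T b \<in> closure \<Omega>" "c + T a \<in> closure \<Omega>"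
      by (rule mem_closure_\<Omega>; use ab in \<open>auto simp: coord_T less_imp_le\<close>)+
    from slab_width[OF f_norm[of i0] this(2) this(1)]
    have "f i0 \<bullet> (c + T b - (c + T a)) \<le> 2 * R" .
    moreover have "f i0 \<bullet> (c + T b - (c + T a)) = W i0"
      using coord_T[of i0 b] coord_T[of i0 a] by (simp add: coord_def W_def inner_diff_right)
    ultimately show ?thesis by (simp add: \<rho>_def)
  qed
  obtain B where B: "B > 0"
    "\<And>e z x k. norm e = 1 \<Longrightarrow> (\<And>y. y \<in> \<Omega> \<Longrightarrow> 0 < e \<bullet> (y - z)) \<Longrightarrow> z \<in> closure \<Omega> \<Longrightarrow> x \<in> \<Omega> \<Longrightarrow>
      e \<bullet> (x - z) \<le> 2 * R / 2 ^ k \<Longrightarrow> - u x \<le> B * (real (Suc k) / 2 ^ k) powr (2 / ?n)"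
    using decay_critical[OF n2] by blast
  define m where "m k = B * (real (Suc k) / 2 ^ k) powr (2 / ?n)" for k :: nat
  have m: "0 < m k" for k using B(1) by (simp add: m_def)
  have fz: "f i0 \<bullet> (x - (c + T a)) = coord i0 x - a $ i0" for x
    using coord_T[of i0 a] by (simp add: coord_def inner_diff_right inner_add_right)
  have bd: "- u x \<le> m k" if x: "x \<in> \<Omega>" "coord i0 x - a $ i0 \<le> \<rho> / 2 ^ k" for x k
    unfolding m_def
  proof (rule B(2)[OF f_norm _ _ x(1)])
    show "0 < f i0 \<bullet> (y - (c + T a))" if "y \<in> \<Omega>" for y using that by (simp add: fz mem_\<Omega>)
    show "c + T a \<in> closure \<Omega>" by (rule mem_closure_\<Omega>) (use ab in \<open>auto simp: coord_T less_imp_le\<close>)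
    have "\<rho> / 2 ^ k \<le> 2 * R / 2 ^ k" using W2R \<rho>_pos by (intro divide_right_mono) auto
    then show "f i0 \<bullet> (x - (c + T a)) \<le> 2 * R / 2 ^ k" using x(2) by (simp add: fz)
  qed
  define w where "w = Min (range W)"
  have w: "0 < w" "w \<le> W i" for i
    using W_pos by (auto simp: w_def)
  define N where "N = 16 * ?n * V' * \<rho> / (w * \<sigma>)"
  have N: "0 < N" using w(1) V'_pos \<rho>_pos \<sigma>_pos by (simp add: N_def)
  define G where "G k = {x \<in> strip k. \<forall>i. i \<noteq> i0 \<longrightarrow> second (f i) x \<le> ennreal (N * m k)}" for k
  have Gm: "ennreal (\<sigma> / 2 / 2 ^ k) \<le> emeasure lborel (G k)" and Gb: "G k \<in> sets borel" for k
    using strip_good_part[where m = "m k" and k = k and w = w, OF m bd w] unfolding G_def N_def by blast+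
  have GO: "G k \<subseteq> \<Omega>" and Gs: "G k \<subseteq> strip k" for k using strip_subset by (auto simp: G_def)
  define v where "v k = (lam / (fact CARD('n) * (N * m k) ^ (CARD('n) - 1))) powr p" for k
  define \<kappa> where "\<kappa> = (lam / (fact CARD('n) * (N * B) ^ (CARD('n) - 1))) powr p * (\<sigma> / 2)"
  have \<kappa>: "0 < \<kappa>" using lam N B(1) \<sigma>_pos by (simp add: \<kappa>_def)
  have vk: "\<kappa> / real (Suc k) = v k * (\<sigma> / 2 / 2 ^ k)" for k
  proof -
    define s where "s = real (Suc k) / 2 ^ k"
    have s: "s > 0" by (simp add: s_def)
    define Y where "Y = (s powr (2 / ?n)) ^ (CARD('n) - 1)"
    define D where "D = fact CARD('n) * (N * B) ^ (CARD('n) - 1)"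
    \<comment> \<open>The exponent is critical here: \<open>2 / n * (n - 1) * p = 1\<close>. Hence
      \<open>v k\<close> is of order \<open>2 ^ k / Suc k\<close>, and the volume of the strip
      cancels \<open>2 ^ k\<close>.\<close>
    have Y: "Y powr p = s"
    proof -
      have "Y = s powr (2 / ?n * real (CARD('n) - 1))"
        using s by (simp add: Y_def powr_realpow[symmetric] powr_powr)
      then have "Y powr p = s powr (2 / ?n * real (CARD('n) - 1) * p)" by (simp only: powr_powr)
      also have "2 / ?n * real (CARD('n) - 1) * p = 1" using n1 n2 by (simp add: p_def of_nat_diff field_simps)
      finally show ?thesis using s by simp
    qed
    have mk: "m k = B * s powr (2 / ?n)" by (simp only: m_def s_def)
    have "fact CARD('n) * (N * m k) ^ (CARD('n) - 1) = D * Y"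
      unfolding mk by (simp only: D_def Y_def power_mult_distrib mult_ac)
    then have "v k = (lam / D / Y) powr p" by (simp add: v_def)
    also have "\<dots> = (lam / D) powr p / Y powr p" by (rule powr_divide)
    finally have "v k = (lam / (fact CARD('n) * (N * B) ^ (CARD('n) - 1))) powr p / s"
      unfolding Y by (simp only: D_def)
    then show ?thesis by (simp add: \<kappa>_def s_def)
  qed
  have disj: "x \<notin> strip l" if "x \<in> strip k" "k < l" for x k l
  proof
    assume "x \<in> strip l"
    have "\<rho> / 2 ^ l \<le> \<rho> / 2 ^ Suc k"
      using that(2) \<rho>_pos by (intro divide_left_mono power_increasing) auto
    then show False
      using strip_bounds(1)[OF that(1)] strip_bounds(2)[OF \<open>x \<in> strip l\<close>] \<rho>_pow[of k] by simp
  qed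
  \<comment> \<open>The good parts are disjoint, so at most one summand is nonzero at a point, and
    the partial sums of a harmonic series stay below the integral.\<close>
  have part: "ennreal (\<Sum>k<K. \<kappa> / real (Suc k)) \<le> hessian_integral \<Omega> p u" for K
  proof -
    have "ennreal (\<Sum>k<K. \<kappa> / real (Suc k)) = (\<Sum>k<K. ennreal (\<kappa> / real (Suc k)))"
      using \<kappa> by (intro sum_ennreal[symmetric]) auto
    also have "\<dots> \<le> (\<Sum>k<K. ennreal (v k) * emeasure lborel (G k))"
    proof (rule sum_mono)
      fix k
      have "ennreal (\<kappa> / real (Suc k)) = ennreal (v k) * ennreal (\<sigma> / 2 / 2 ^ k)"
        unfolding vk by (rule ennreal_mult') (simp add: v_def)
      also have "\<dots> \<le> ennreal (v k) * emeasure lborel (G k)" by (rule mult_left_mono[OF Gm]) simp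
      finally show "ennreal (\<kappa> / real (Suc k)) \<le> ennreal (v k) * emeasure lborel (G k)" .
    qed
    also have "\<dots> = (\<Sum>k<K. \<integral>\<^sup>+x. ennreal (v k) * indicator (G k) x \<partial>lborel)"
      using Gb by (intro sum.cong refl) (simp add: nn_integral_cmult_indicator)
    also have "\<dots> = (\<integral>\<^sup>+x. (\<Sum>k<K. ennreal (v k) * indicator (G k) x) \<partial>lborel)"
      using Gb by (intro nn_integral_sum[symmetric]) auto
    also have "\<dots> \<le> hessian_integral \<Omega> p u"
      unfolding hessian_integral_def
    proof (rule nn_integral_mono_AE)
      show "AE x in lborel. (\<Sum>k<K. ennreal (v k) * indicator (G k) x)
          \<le> ennreal (onorm (\<lambda>v. hessian u x *v v) powr p) * indicator \<Omega> x"
        using regular_ae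
      proof eventually_elim
        case (elim x)
        show ?case
        proof (cases "\<exists>k<K. x \<in> G k")
          case False
          then have "(\<Sum>k<K. ennreal (v k) * indicator (G k) x) = 0" by (intro sum.neutral) auto
          then show ?thesis by simp
        next
          case True
          then obtain k where k: "k < K" "x \<in> G k" by blast
          have other: "x \<notin> G l" if "l \<noteq> k" for l
            using disj[of x k l] disj[of x l k] k(2) Gs that by (metis linorder_neqE_nat subsetD)
          have xO: "x \<in> \<Omega>" using k GO by blast
          have "(\<Sum>k<K. ennreal (v k) * indicator (G k) x) = (\<Sum>l\<in>{k}. ennreal (v l) * indicator (G l) x)"
            by (rule sum.mono_neutral_right) (use k other in auto)
          also have "\<dots> = ennreal (v k)" using k by simp
          also have "\<dots> \<le> ennreal (onorm (\<lambda>v. hessian u x *v v) powr p)"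
          proof (rule ennreal_leI)
            have "lam / (fact CARD('n) * (N * m k) ^ (CARD('n) - 1)) \<le> onorm (\<lambda>v. hessian u x *v v)"
              by (rule hessian_lower_bound[OF xO]) (use elim xO N m[of k] k(2) in \<open>auto simp: G_def\<close>)
            then show "v k \<le> onorm (\<lambda>v. hessian u x *v v) powr p"
              unfolding v_def using p lam N m[of k] by (intro powr_mono2) auto
          qed
          finally show ?thesis using xO by simp
        qed
      qed
    qed
    finally show ?thesis .
  qed
  show ?thesis
  proof (rule ccontr)
    assume "\<not> ?thesis"
    then have "hessian_integral \<Omega> p u < top" by (simp add: p_def less_top[symmetric])
    then obtain X where X: "0 \<le> X" "hessian_integral \<Omega> p u = ennreal X" by (cases "hessian_integral \<Omega> p u") auto
    have "(\<Sum>k<K. \<kappa> / real (Suc k)) \<le> X" for K using part[of K] X by (simp add: ennreal_le_iff)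
    then have "summable (\<lambda>k. \<kappa> / real (Suc k))"
      using \<kappa> by (intro summableI_nonneg_bounded) auto
    then have "summable (\<lambda>k. (1 / \<kappa>) * (\<kappa> / real (Suc k)))" by (rule summable_mult)
    then have "summable (\<lambda>k. inverse (real (Suc k)))" using \<kappa> by (simp add: divide_inverse)
    then have "summable (\<lambda>k. inverse (of_nat k) :: real)" using summable_Suc_iff by blast
    then show False using not_summable_harmonic by blast
  qed
qed

end

section \<open>The theorem\<close>

lemma ma_bounds_of_dirichlet_solution:
  fixes \<Omega> :: "(real^'n::finite) set"
  assumes \<Omega>: "open \<Omega>" "convex \<Omega>" "bounded \<Omega>" "\<Omega> \<noteq> {}" and lam: "0 < lam" "lam \<le> Lam"
    and f: "\<And>x. x \<in> closure \<Omega> \<Longrightarrow> lam \<le> f x \<and> f x \<le> Lam" and u: "dirichlet_solution \<Omega> f u"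
  shows "ma_bounds \<Omega> u lam Lam"
proof
  have MA: "monge_ampere \<Omega> u E = (\<integral>\<^sup>+x\<in>E. ennreal (f x) \<partial>lborel)" if "E \<in> sets borel" "E \<subseteq> \<Omega>" for E
    using u that by (auto simp: dirichlet_solution_def aleksandrov_solution_def)
  have f': "lam \<le> f x \<and> f x \<le> Lam" if "x \<in> \<Omega>" for x using f that closure_subset by blast
  show "ennreal lam * emeasure lborel E \<le> monge_ampere \<Omega> u E" if E: "E \<in> sets borel" "E \<subseteq> \<Omega>" for E
  proof -
    have "ennreal lam * emeasure lborel E = (\<integral>\<^sup>+x\<in>E. ennreal lam \<partial>lborel)"
      using E by (subst nn_integral_cmult_indicator) auto
    also have "\<dots> \<le> (\<integral>\<^sup>+x\<in>E. ennreal (f x) \<partial>lborel)"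
      using E f' by (intro nn_integral_mono) (auto simp: indicator_def intro: ennreal_leI)
    finally show ?thesis using MA[OF E] by simp
  qed
  show "monge_ampere \<Omega> u E \<le> ennreal Lam * emeasure lborel E" if E: "E \<in> sets borel" "E \<subseteq> \<Omega>" for E
  proof -
    have "(\<integral>\<^sup>+x\<in>E. ennreal (f x) \<partial>lborel) \<le> (\<integral>\<^sup>+x\<in>E. ennreal Lam \<partial>lborel)"
      using E f' by (intro nn_integral_mono) (auto simp: indicator_def intro: ennreal_leI)
    also have "\<dots> = ennreal Lam * emeasure lborel E"
      using E by (subst nn_integral_cmult_indicator) auto
    finally show ?thesis using MA[OF E] by simp
  qed
qed (use \<Omega> lam u in \<open>auto simp: dirichlet_solution_def aleksandrov_solution_def\<close>)

text \<open>For \<open>n \<ge> 3\<close> the exponent \<open>2 / n\<close> works. For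
  \<open>n = 2\<close> it would be 1, which \<open>decay_powr\<close> excludes, so
  \<open>\<alpha>\<close> is taken halfway between \<open>max 0 (2 - 1 / \<delta>)\<close> and
  1.\<close>

lemma decay_exponent_exists:
  assumes n: "2 \<le> n" and \<delta>: "0 < \<delta>" "\<delta> < 1 / (real n - 1)"
  shows "\<exists>\<alpha>. 0 < \<alpha> \<and> \<alpha> < 1 \<and> \<alpha> \<le> 2 / real n \<and> 0 < 1 - \<delta> * (2 - \<alpha>)"
proof (cases "n = 2")
  case True
  then have \<delta>1: "\<delta> < 1" using \<delta> by simp
  define \<alpha> where "\<alpha> = (max 0 (2 - 1 / \<delta>) + 1) / 2"
  have "2 - 1 / \<delta> < 1" using \<delta>(1) \<delta>1 by (simp add: field_simps)
  then have \<alpha>: "0 < \<alpha>" "\<alpha> < 1" "2 - 1 / \<delta> < \<alpha>" by (auto simp: \<alpha>_def max_def)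
  have "\<delta> * (2 - \<alpha>) < \<delta> * (1 / \<delta>)" using \<alpha>(3) \<delta>(1) by (intro mult_strict_left_mono) auto
  then have "0 < 1 - \<delta> * (2 - \<alpha>)" using \<delta>(1) by simp
  then show ?thesis using \<alpha> True by auto
next
  case False
  then have n3: "3 \<le> real n" using n by simp
  have "\<delta> * (2 - 2 / real n) < 1 / (real n - 1) * (2 - 2 / real n)"
    using \<delta> n3 by (intro mult_strict_right_mono) (auto simp: field_simps)
  also have "\<dots> = 2 / real n" using n3 by (simp add: field_simps)
  also have "\<dots> < 1" using n3 by simp
  finally show ?thesis using n3 by (intro exI[of _ "2 / real n"]) auto
qed

theorem theorem1p1:
  assumes "CARD('n::finite) \<ge> 2"
  shows "\<exists>C :: (real^'n) set \<Rightarrow> real \<Rightarrow> real \<Rightarrow> real \<Rightarrow> real \<Rightarrow> real.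
    \<forall>(\<Omega> :: (real^'n) set) (\<beta> :: real) (f :: real^'n \<Rightarrow> real) (lam :: real) (Lam :: real) (u :: real^'n \<Rightarrow> real).
      open \<Omega> \<and> convex \<Omega> \<and> bounded \<Omega> \<and> \<Omega> \<noteq> {} \<and>
      0 < \<beta> \<and> \<beta> < 1 \<and> C2_hoelder_closure \<Omega> \<beta> f \<and>
      0 < lam \<and> lam \<le> Lam \<and> (\<forall>x\<in>closure \<Omega>. lam \<le> f x \<and> f x \<le> Lam) \<and>
      dirichlet_solution \<Omega> f u \<longrightarrow>
        (\<forall>\<delta>. 0 < \<delta> \<and> \<delta> < 1 / (real CARD('n) - 1) \<longrightarrow>
           hessian_in_Lp \<Omega> \<delta> u \<and>
           hessian_integral \<Omega> \<delta> u \<le> ennreal (C \<Omega> \<delta> lam Lam (C2_norm \<Omega> (\<lambda>x. ln (f x))))) \<and>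
        (rectangular_box \<Omega> \<longrightarrow>
           \<not> hessian_in_Lp \<Omega> (real CARD('n) / (2 * (real CARD('n) - 1))) u)"
proof -
  let ?n = "real CARD('n)"
  \<comment> \<open>Choices that depend on \<open>\<Omega>\<close> or \<open>\<delta>\<close> alone,
    made before \<open>f\<close> and \<open>u\<close> are fixed; this makes \<open>C\<close> uniform
    over all solutions.\<close>
  define rad where "rad \<Omega> = (SOME r. 0 < r \<and> \<Omega> \<subseteq> cball 0 r)" for \<Omega> :: "(real^'n) set"
  define expo where "expo \<delta> = (SOME \<alpha>. 0 < \<alpha> \<and> \<alpha> < 1 \<and> \<alpha> \<le> 2 / ?n \<and> 0 < 1 - \<delta> * (2 - \<alpha>))" for \<delta>
  define C where "C \<Omega> \<delta> lam Lam N = ?n * ((?n ^ 3) powr \<delta> *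
      (ma_ball.line_const TYPE('n) Lam (rad \<Omega>) (expo \<delta>) \<delta> * ma_ball.V TYPE('n) (rad \<Omega>)))"
    for \<Omega> :: "(real^'n) set" and \<delta> lam Lam N :: real
  show ?thesis
  proof (intro exI[of _ C] allI impI)
    fix \<Omega> :: "(real^'n) set" and \<beta> lam Lam :: real and f u :: "real^'n \<Rightarrow> real"
    assume H: "open \<Omega> \<and> convex \<Omega> \<and> bounded \<Omega> \<and> \<Omega> \<noteq> {} \<and>
      0 < \<beta> \<and> \<beta> < 1 \<and> C2_hoelder_closure \<Omega> \<beta> f \<and>
      0 < lam \<and> lam \<le> Lam \<and> (\<forall>x\<in>closure \<Omega>. lam \<le> f x \<and> f x \<le> Lam) \<and>
      dirichlet_solution \<Omega> f u"
    have "\<exists>r. 0 < r \<and> \<Omega> \<subseteq> cball 0 r"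
    proof -
      obtain r where "0 < r" "\<And>x. x \<in> \<Omega> \<Longrightarrow> norm x \<le> r" using H bounded_pos[of \<Omega>] by blast
      then show ?thesis by (intro exI[of _ r]) auto
    qed
    from someI_ex[OF this] have rad: "0 < rad \<Omega>" "\<Omega> \<subseteq> cball 0 (rad \<Omega>)" by (auto simp: rad_def)
    interpret ma_bounds \<Omega> u lam Lam
      by (rule ma_bounds_of_dirichlet_solution[of _ _ _ f]) (use H in auto)
    interpret ma_ball \<Omega> u lam Lam "rad \<Omega>"
      by unfold_locales (rule rad)+
    show "(\<forall>\<delta>. 0 < \<delta> \<and> \<delta> < 1 / (?n - 1) \<longrightarrow>
           hessian_in_Lp \<Omega> \<delta> u \<and>
           hessian_integral \<Omega> \<delta> u \<le> ennreal (C \<Omega> \<delta> lam Lam (C2_norm \<Omega> (\<lambda>x. ln (f x))))) \<and>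
        (rectangular_box \<Omega> \<longrightarrow> \<not> hessian_in_Lp \<Omega> (?n / (2 * (?n - 1))) u)"
    proof (intro conjI allI impI)
      fix \<delta> assume \<delta>: "0 < \<delta> \<and> \<delta> < 1 / (?n - 1)"
      have "1 / (?n - 1) \<le> 1" using assms by simp
      then have \<delta>1: "0 < \<delta>" "\<delta> < 1" using \<delta> by auto
      have "\<exists>\<alpha>. 0 < \<alpha> \<and> \<alpha> < 1 \<and> \<alpha> \<le> 2 / ?n \<and> 0 < 1 - \<delta> * (2 - \<alpha>)"
        using decay_exponent_exists[OF assms] \<delta> by blast
      from someI_ex[OF this]
      have ex: "0 < expo \<delta>" "expo \<delta> < 1" "expo \<delta> \<le> 2 / ?n" "0 < 1 - \<delta> * (2 - expo \<delta>)"
        by (auto simp: expo_def)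
      show "hessian_integral \<Omega> \<delta> u \<le> ennreal (C \<Omega> \<delta> lam Lam (C2_norm \<Omega> (\<lambda>x. ln (f x))))"
        unfolding C_def by (rule hessian_integral_bound[OF ex(1-3) \<delta>1 ex(4)])
      then show "hessian_in_Lp \<Omega> \<delta> u"
        unfolding hessian_in_Lp_def using ennreal_less_top le_less_trans by (metis infinity_ennreal_def)
    next
      assume "rectangular_box \<Omega>"
      then obtain a b c :: "real^'n" and T where box: "\<And>i. a $ i < b $ i" "orthogonal_transformation T"
        "\<Omega> = (\<lambda>x. c + T x) ` box a b"
        unfolding rectangular_box_def by blast
      \<comment> \<open>\<open>i0\<close> carries no assumption and is absent from the predicate:
        any coordinate direction provides a face.\<close>
      have mb: "ma_box \<Omega> u lam Lam (rad \<Omega>) a b c T"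
        by unfold_locales (use assms box in auto)
      show "\<not> hessian_in_Lp \<Omega> (?n / (2 * (?n - 1))) u"
        unfolding hessian_in_Lp_def ma_box.hessian_not_in_Lp[OF mb] by simp
    qed
  qed
qed

end
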